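(* Let $\widehat H\in\mathbb{C}[x,y]$ be a normalized homogeneous polynomial of degree $n+1$. There exist two positive finite constants $\alpha=\alpha(\widehat H)$ and $\beta=\beta(\widehat H)$, depending only on $\widehat H$, such that for every quasimonic Hamiltonian $H=\widehat H+h$ of degree $n+1$ with principal homogeneous part $\widehat H$ (i.e. $\deg h\le n$), with set of critical values $\Sigma=\Sigma(H)\subset\mathbb{C}$ and effective nonhomogeneity $\varkappa(H)$, the following implications hold: $$\varkappa(H)\ge 1\implies \Sigma\cap\{|t|>\alpha\}\neq\varnothing,$$ $$\Sigma\subseteq\{|t|\le 1\}\implies \varkappa(H)\le\beta .$$
   Context: The norm $\|\cdot\|$ of a polynomial is the sum of absolute values of its coefficients. A pair of homogeneous polynomials $a,b\in\mathbb{C}[x,y]$ of degree $n$ is normalized if every homogeneous polynomial $f$ of degree $2n-1$ can be written as $f=au+bv$ with $u,v$ homogeneous of degree $n-1$ and $\|u\|+\|v\|\le\|f\|$. A homogeneous polynomial $\widehat H$ of degree $n+1$ is normalized if the pair $(\widehat H_x,\widehat H_y)$ is normalized; a polynomial $H$ of degree $n+1$ is quasimonic if its principal homogeneous part $\widehat H$ (sum of the terms of degree $n+1$) is normalized. The effective nonhomogeneity of a quasimonic polynomial $H$ is $$\varkappa(H)=\inf_{T}\|H\circ T-\widehat H\|,$$ the infimum being over all translations $T:\mathbb{C}^2\to\mathbb{C}^2$. *)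

theory Defs
  imports "HOL-Analysis.Analysis" "HOL-Computational_Algebra.Polynomial"
begin

text \<open>
  A polynomial in \<open>\<complex>[x, y]\<close> is an element of \<open>\<complex>[x][y]\<close>: the inner variable is \<open>x\<close>, the outer
  one is \<open>y\<close>.
\<close>

type_synonym bipoly = "complex poly poly"

definition bcoeff :: "bipoly \<Rightarrow> nat \<Rightarrow> nat \<Rightarrow> complex" where
  "bcoeff H i j = coeff (coeff H j) i"

lemma finite_bcoeff_nonzero: "finite {(i, j). bcoeff H i j \<noteq> 0}"
proof (rule finite_subset)
  show "{(i, j). bcoeff H i j \<noteq> 0} \<subseteq> (\<Union>j\<le>degree H. {..degree (coeff H j)} \<times> {j})"
  proof (clarify)
    fix i j assume "bcoeff H i j \<noteq> 0"
    then have "coeff H j \<noteq> 0" and "coeff (coeff H j) i \<noteq> 0"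
      by (auto simp: bcoeff_def)
    then show "(i, j) \<in> (\<Union>j\<le>degree H. {..degree (coeff H j)} \<times> {j})"
      by (auto intro: le_degree)
  qed
qed auto

definition beval :: "bipoly \<Rightarrow> complex \<Rightarrow> complex \<Rightarrow> complex" where
  "beval H x y = poly (poly H [:y:]) x"

definition pnorm :: "bipoly \<Rightarrow> real" where
  "pnorm H = (\<Sum>(i, j) \<in> {(i, j). bcoeff H i j \<noteq> 0}. cmod (bcoeff H i j))"

text \<open>
  Degrees are integers, so that \<open>2 * n - 1\<close> and \<open>n - 1\<close> below are not truncated. The zero
  polynomial is homogeneous of every degree.
\<close>

definition homogeneous :: "int \<Rightarrow> bipoly \<Rightarrow> bool" where
  "homogeneous d f \<longleftrightarrow> (\<forall>i j. bcoeff f i j \<noteq> 0 \<longrightarrow> int i + int j = d)"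

definition total_degree :: "bipoly \<Rightarrow> nat" where
  "total_degree H = Max (insert 0 {i + j |i j. bcoeff H i j \<noteq> 0})"

definition principal_part :: "bipoly \<Rightarrow> bipoly" where
  "principal_part H =
     (\<Sum>j\<le>total_degree H.
        monom (monom (bcoeff H (total_degree H - j) j) (total_degree H - j)) j)"

lemma bcoeff_principal_part:
  "bcoeff (principal_part H) i j = (if i + j = total_degree H then bcoeff H i j else 0)"
proof -
  let ?d = "total_degree H"
  have "bcoeff (principal_part H) i j =
      (\<Sum>k\<le>?d. if k = j then (if ?d - j = i then bcoeff H (?d - j) j else 0) else 0)"
    unfolding principal_part_def bcoeff_def coeff_sum
    by (intro sum.cong refl) simp
  also have "\<dots> = (if j \<le> ?d then (if ?d - j = i then bcoeff H (?d - j) j else 0) else 0)"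
    by (simp only: sum.delta finite_atMost atMost_iff)
  also have "\<dots> = (if i + j = ?d then bcoeff H i j else 0)"
    by (cases "j \<le> ?d"; cases "?d - j = i") auto
  finally show ?thesis .
qed

definition dx :: "bipoly \<Rightarrow> bipoly" where
  "dx H = map_poly pderiv H"

definition dy :: "bipoly \<Rightarrow> bipoly" where
  "dy H = pderiv H"

definition normalized_pair :: "nat \<Rightarrow> bipoly \<Rightarrow> bipoly \<Rightarrow> bool" where
  "normalized_pair n a b \<longleftrightarrow>
     homogeneous (int n) a \<and> homogeneous (int n) b \<and>
     (\<forall>f. homogeneous (2 * int n - 1) f \<longrightarrow>
        (\<exists>u v. homogeneous (int n - 1) u \<and> homogeneous (int n - 1) v \<and>
               f = a * u + b * v \<and> pnorm u + pnorm v \<le> pnorm f))"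

text \<open>In the next two definitions \<open>n + 1\<close> is the degree of the polynomial.\<close>

definition normalized :: "nat \<Rightarrow> bipoly \<Rightarrow> bool" where
  "normalized n Hh \<longleftrightarrow> homogeneous (int n + 1) Hh \<and> normalized_pair n (dx Hh) (dy Hh)"

definition quasimonic :: "nat \<Rightarrow> bipoly \<Rightarrow> bool" where
  "quasimonic n H \<longleftrightarrow> total_degree H = n + 1 \<and> normalized n (principal_part H)"

text \<open>The composition of \<open>H\<close> with the translation \<open>(x, y) \<mapsto> (x + s, y + t)\<close>.\<close>

definition translate :: "complex \<Rightarrow> complex \<Rightarrow> bipoly \<Rightarrow> bipoly" where
  "translate s t H = pcompose (map_poly (\<lambda>p. pcompose p [:s, 1:]) H) [:[:t:], 1:]"

lemma beval_translate: "beval (translate s t H) x y = beval H (x + s) (y + t)"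
proof -
  have "poly (poly (map_poly (\<lambda>p. pcompose p [:s, 1:]) H) [:c:]) x = poly (poly H [:c:]) (x + s)"
    for c
  proof (induction H)
    case (pCons a H)
    then show ?case
      by (simp add: map_poly_pCons poly_pcompose add.commute[of s x])
  qed simp
  from this[of "y + t"] show ?thesis
    by (simp add: beval_def translate_def poly_pcompose add.commute[of t y])
qed

definition effective_nonhomogeneity :: "bipoly \<Rightarrow> real" where
  "effective_nonhomogeneity H = (INF (s, t). pnorm (translate s t H - principal_part H))"

definition critical_values :: "bipoly \<Rightarrow> complex set" where
  "critical_values H = {beval H x y |x y. beval (dx H) x y = 0 \<and> beval (dy H) x y = 0}"

end

theory Submission
  imports Defs "HOL-Complex_Analysis.Complex_Analysis"
    "HOL-Computational_Algebra.Computational_Algebra" "Jordan_Normal_Form.Determinant"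
begin

text \<open>
  Rescaling \<open>(x, y) \<mapsto> (s x, s y)\<close> multiplies the critical values by a power of \<open>s\<close> and shrinks
  the lower order terms. Both implications therefore follow, by compactness, once a polynomial
  with principal part \<open>Hh\<close> whose only critical value is \<open>0\<close> is known to be a translate of \<open>Hh\<close>.

  To see this let \<open>d = n + 1\<close> and restrict \<open>H\<close> to a polar curve \<open>H\<^sub>y = l H\<^sub>x\<close> with generic \<open>l\<close>, on
  which \<open>dH = H\<^sub>x d\<xi>\<close> for \<open>\<xi> = x + l y\<close>. Since \<open>H\<close> vanishes wherever \<open>H\<^sub>x\<close> does, \<open>H / H\<^sub>x\<close> is the
  inverse of a logarithmic derivative without zeros and is bounded near the finite points of the
  curve; by Euler's identity \<open>H / H\<^sub>x - \<xi> / d\<close> is bounded at infinity. By Liouville the latter takes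
  finitely many values and is constant along branches, so that \<open>H\<close> is a multiple of \<open>(\<xi> - \<xi>\<^sub>0)\<^sup>d\<close>
  along a branch and the branch meets a critical point \<open>(a, b)\<close> with \<open>\<xi>\<^sub>0 = a + l b\<close>. Hence
  \<open>d H = (x - a) H\<^sub>x + (y - b) H\<^sub>y\<close> there. There are finitely many critical points while \<open>l\<close> is
  arbitrary, so this identity holds everywhere for one of them, and \<open>H\<close> is homogeneous about it.
\<close>

section \<open>Bivariate polynomials as functions\<close>

text \<open>The branches of a polar curve ramify and cannot be labelled globally. Every argument on
  them is therefore phrased through symmetric functions: norms, which are determinants and hence
  polynomials, and products over those branches that satisfy a locally constant condition.
  Liouville's theorem on the curve thereby becomes a comparison of two polynomials in one variable.
  The compactness argument meets two obstacles. Translations form a noncompact group, so a sequence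
  is rescaled until a translate lies in the unit ball around \<open>Hh\<close> while all translates
  keep distance at least \<open>(1/2)^(n+1)\<close>. And critical values of a limit must be limits
  of critical values, although critical points might escape to infinity: this is excluded because
  the norm of \<open>H_x\<close> on a polar curve has degree n^2 and a leading coefficient
  determined by \<open>Hh\<close> and the slope. Normalization enters through the gradient of
  \<open>Hh\<close>, which vanishes at the origin alone.\<close>

lemma beval_pCons: "beval (pCons p H) x y = poly p x + y * beval H x y"
  by (simp add: beval_def)

lemma beval_0 [simp]: "beval 0 x y = 0"
  and beval_1 [simp]: "beval 1 x y = 1"
  and beval_add [simp]: "beval (F + G) x y = beval F x y + beval G x y"
  and beval_diff [simp]: "beval (F - G) x y = beval F x y - beval G x y"
  and beval_minus [simp]: "beval (- F) x y = - beval F x y"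
  and beval_mult [simp]: "beval (F * G) x y = beval F x y * beval G x y"
  and beval_power [simp]: "beval (F ^ k) x y = beval F x y ^ k"
  by (simp_all add: beval_def)

lemma beval_sum [simp]: "beval (sum f A) x y = (\<Sum>a\<in>A. beval (f a) x y)"
  by (induction A rule: infinite_finite_induct) auto

lemma beval_prod [simp]: "beval (prod f A) x y = (\<Prod>a\<in>A. beval (f a) x y)"
  by (induction A rule: infinite_finite_induct) auto

definition bconst :: "complex \<Rightarrow> bipoly" where
  "bconst c = [:[:c:]:]"

definition bX :: bipoly where
  "bX = [:[:0, 1:]:]"

definition bY :: bipoly where
  "bY = [:0, 1:]"

lemma beval_bconst [simp]: "beval (bconst c) x y = c"
  and beval_bX [simp]: "beval bX x y = x"
  and beval_bY [simp]: "beval bY x y = y"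
  by (simp_all add: beval_def bconst_def bX_def bY_def)

lemma beval_monom [simp]: "beval (monom (monom c i) j) x y = c * x ^ i * y ^ j"
  by (simp add: beval_def poly_monom)

lemma beval_eqI:
  assumes "\<And>x y. beval F x y = beval G x y"
  shows "F = G"
proof (rule ccontr)
  assume "F \<noteq> G"
  then have "F - G \<noteq> 0" by simp
  then have "finite {p. poly (F - G) p = 0}"
    by (rule poly_roots_finite)
  moreover have "range (\<lambda>y. [:y:]) \<subseteq> {p. poly (F - G) p = 0}"
  proof (clarify)
    fix y :: complex
    have "poly (poly F [:y:]) = poly (poly G [:y:])"
      using assms[of _ y] by (simp add: beval_def fun_eq_iff)
    then show "poly (F - G) [:y:] = 0"
      by (simp add: poly_eq_poly_eq_iff)
  qed
  ultimately have "finite (range (\<lambda>y::complex. [:y:]))"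
    by (rule rev_finite_subset)
  moreover have "inj (\<lambda>y::complex. [:y:])"
    by (simp add: inj_def)
  ultimately have "finite (UNIV :: complex set)"
    by (simp add: finite_image_iff)
  then show False
    using infinite_UNIV_char_0 by blast
qed

lemma bcoeff_eqI: "(\<And>i j. bcoeff F i j = bcoeff G i j) \<Longrightarrow> F = G"
  by (simp add: bcoeff_def poly_eq_iff)

lemma bcoeff_0 [simp]: "bcoeff 0 i j = 0"
  and bcoeff_add [simp]: "bcoeff (F + G) i j = bcoeff F i j + bcoeff G i j"
  and bcoeff_diff [simp]: "bcoeff (F - G) i j = bcoeff F i j - bcoeff G i j"
  and bcoeff_sum [simp]: "bcoeff (sum f A) i j = (\<Sum>a\<in>A. bcoeff (f a) i j)"
  and bcoeff_bconst_mult [simp]: "bcoeff (bconst c * F) i j = c * bcoeff F i j"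
  by (simp_all add: bcoeff_def bconst_def coeff_sum)

lemma bcoeff_monom: "bcoeff (monom (monom c i) j) k l = (if k = i \<and> l = j then c else 0)"
  by (simp add: bcoeff_def)

lemma bcoeff_dx [simp]: "bcoeff (dx H) i j = of_nat (i + 1) * bcoeff H (i + 1) j"
  by (simp add: bcoeff_def dx_def coeff_map_poly coeff_pderiv)

lemma bcoeff_dy [simp]: "bcoeff (dy H) i j = of_nat (j + 1) * bcoeff H i (j + 1)"
  by (simp add: bcoeff_def dy_def coeff_pderiv of_nat_poly)

lemma bipoly_expand:
  assumes "\<And>i j. bcoeff H i j \<noteq> 0 \<Longrightarrow> i \<le> k \<and> j \<le> l"
  shows "H = (\<Sum>i\<le>k. \<Sum>j\<le>l. monom (monom (bcoeff H i j) i) j)"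
proof (rule bcoeff_eqI)
  fix a b
  have "bcoeff (\<Sum>i\<le>k. \<Sum>j\<le>l. monom (monom (bcoeff H i j) i) j) a b
      = (\<Sum>i\<le>k. \<Sum>j\<le>l. if j = b then (if i = a then bcoeff H i j else 0) else 0)"
    by (simp add: bcoeff_monom) (intro sum.cong refl; auto)
  also have "\<dots> = (if b \<le> l then (if a \<le> k then bcoeff H a b else 0) else 0)"
    by (simp add: sum.delta)
  also have "\<dots> = bcoeff H a b"
    using assms[of a b] by auto
  finally show "bcoeff H a b = bcoeff (\<Sum>i\<le>k. \<Sum>j\<le>l. monom (monom (bcoeff H i j) i) j) a b"
    by simp
qed

lemma beval_expand:
  assumes "\<And>i j. bcoeff H i j \<noteq> 0 \<Longrightarrow> i \<le> k \<and> j \<le> l"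
  shows "beval H x y = (\<Sum>i\<le>k. \<Sum>j\<le>l. bcoeff H i j * x ^ i * y ^ j)"
  by (subst bipoly_expand[OF assms]) auto

definition xslice :: "bipoly \<Rightarrow> complex \<Rightarrow> complex poly" where
  "xslice H x = map_poly (\<lambda>p. poly p x) H"

lemma coeff_xslice [simp]: "coeff (xslice H x) j = poly (coeff H j) x"
  by (simp add: xslice_def coeff_map_poly)

lemma poly_xslice [simp]: "poly (xslice H x) y = beval H x y"
  by (induction H) (simp_all add: xslice_def map_poly_pCons beval_pCons)

lemma beval_has_derivative:
  "((\<lambda>z. beval H (fst z) (snd z)) has_derivative
     (\<lambda>h. beval (dx H) a b * fst h + beval (dy H) a b * snd h)) (at (a, b))"
proof (induction H)
  case 0
  then show ?case by (simp add: dx_def dy_def)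
next
  case (pCons p H)
  have p: "((\<lambda>z. poly p (fst z)) has_derivative (\<lambda>h. poly (pderiv p) a * fst h)) (at (a, b))"
  proof -
    have "(poly p has_derivative (\<lambda>t. poly (pderiv p) a * t)) (at (fst (a, b)))"
      using poly_DERIV[of p a] by (simp add: has_field_derivative_def)
    from has_derivative_compose[OF has_derivative_fst[OF has_derivative_ident] this]
    show ?thesis by simp
  qed
  have "dx (pCons p H) = pCons (pderiv p) (dx H)"
    by (simp add: dx_def map_poly_pCons)
  moreover have "dy (pCons p H) = H + bY * dy H"
    by (simp add: dy_def pderiv_pCons bY_def)
  ultimately show ?case
    unfolding beval_pCons
    by (auto intro!: derivative_eq_intros p pCons.IH simp: beval_pCons algebra_simps)
qed

lemma tendsto_beval [tendsto_intros]:
  assumes "(f \<longlongrightarrow> a) F" "(g \<longlongrightarrow> b) F"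
  shows "((\<lambda>t. beval H (f t) (g t)) \<longlongrightarrow> beval H a b) F"
proof -
  have "isCont (\<lambda>z. beval H (fst z) (snd z)) (a, b)"
    using beval_has_derivative has_derivative_continuous by blast
  from isCont_tendsto_compose[OF this tendsto_Pair[OF assms]] show ?thesis
    by simp
qed

lemma continuous_on_beval [continuous_intros]:
  assumes "continuous_on S f" "continuous_on S g"
  shows "continuous_on S (\<lambda>t. beval H (f t) (g t))"
  using assms unfolding continuous_on_def by (auto intro: tendsto_beval)

lemma beval_deriv_compose:
  assumes "(f has_field_derivative f') (at t)" "(g has_field_derivative g') (at t)"
  shows "((\<lambda>t. beval H (f t) (g t)) has_field_derivative
    beval (dx H) (f t) (g t) * f' + beval (dy H) (f t) (g t) * g') (at t)"
proof -
  have "((\<lambda>t. (f t, g t)) has_derivative (\<lambda>h. (f' * h, g' * h))) (at t)"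
    using assms by (auto intro!: has_derivative_Pair simp: has_field_derivative_def)
  from has_derivative_compose[OF this beval_has_derivative[of H "f t" "g t"]]
  have "((\<lambda>t. beval H (f t) (g t)) has_derivative
      (\<lambda>h. beval (dx H) (f t) (g t) * (f' * h) + beval (dy H) (f t) (g t) * (g' * h))) (at t)"
    by simp
  then show ?thesis
    unfolding has_field_derivative_def
    by (rule has_derivative_eq_rhs) (simp add: algebra_simps fun_eq_iff)
qed

section \<open>Forms and degree bounds\<close>

text \<open>A bound on the total degree instead of the degree itself: it holds for 0 with every
  \<open>m\<close>, is additive under products and survives coefficientwise limits.\<close>

definition tdeg_le :: "nat \<Rightarrow> bipoly \<Rightarrow> bool" where
  "tdeg_le m F \<longleftrightarrow> (\<forall>i j. bcoeff F i j \<noteq> 0 \<longrightarrow> i + j \<le> m)"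

lemma tdeg_leD: "tdeg_le m F \<Longrightarrow> bcoeff F i j \<noteq> 0 \<Longrightarrow> i \<le> m \<and> j \<le> m"
  unfolding tdeg_le_def by (metis add_leE)

lemma beval_homogeneous:
  assumes "homogeneous (int m) F"
  shows "beval F (s * x) (s * y) = s ^ m * beval F x y"
proof -
  have ij: "i + j = m" if "bcoeff F i j \<noteq> 0" for i j
    using assms that unfolding homogeneous_def by fastforce
  then have ex: "beval F x y = (\<Sum>i\<le>m. \<Sum>j\<le>m. bcoeff F i j * x ^ i * y ^ j)" for x y
    by (intro beval_expand) fastforce
  show ?thesis
    unfolding ex sum_distrib_left
  proof (intro sum.cong refl)
    fix i j
    show "bcoeff F i j * (s * x) ^ i * (s * y) ^ j = s ^ m * (bcoeff F i j * x ^ i * y ^ j)"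
      using ij[of i j] by (cases "bcoeff F i j = 0") (auto simp: power_mult_distrib power_add)
  qed
qed

lemma beval_growth:
  assumes "tdeg_le m F"
  shows "\<exists>C>0. \<forall>x y. cmod (beval F x y) \<le> C * (1 + cmod x + cmod y) ^ m"
proof (intro exI conjI allI)
  define C where "C = (\<Sum>i\<le>m. \<Sum>j\<le>m. cmod (bcoeff F i j))"
  \<comment> \<open>The summand 1 keeps the constant positive when \<open>F\<close> is 0.\<close>
  show "0 < C + 1"
    unfolding C_def by (intro add_nonneg_pos sum_nonneg) auto
  fix x y
  let ?r = "1 + cmod x + cmod y"
  have ex: "beval F x y = (\<Sum>i\<le>m. \<Sum>j\<le>m. bcoeff F i j * x ^ i * y ^ j)"
    using assms by (intro beval_expand) (rule tdeg_leD)
  have "cmod (beval F x y) \<le> (\<Sum>i\<le>m. \<Sum>j\<le>m. cmod (bcoeff F i j) * ?r ^ m)"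
    unfolding ex
  proof (intro order_trans[OF norm_sum] sum_mono)
    fix i j
    show "cmod (bcoeff F i j * x ^ i * y ^ j) \<le> cmod (bcoeff F i j) * ?r ^ m"
    proof (cases "bcoeff F i j = 0")
      case False
      then have "i + j \<le> m" using assms by (simp add: tdeg_le_def)
      have "cmod x ^ i * cmod y ^ j \<le> ?r ^ i * ?r ^ j"
        by (intro mult_mono power_mono) auto
      also have "\<dots> \<le> ?r ^ m"
        using \<open>i + j \<le> m\<close> by (simp add: power_add[symmetric] power_increasing)
      finally show ?thesis
        by (simp add: norm_mult norm_power mult_left_mono mult.assoc)
    qed simp
  qed
  also have "\<dots> = C * ?r ^ m"
    by (simp add: C_def sum_distrib_right)
  also have "\<dots> \<le> (C + 1) * ?r ^ m"
    by (intro mult_right_mono) auto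
  finally show "cmod (beval F x y) \<le> (C + 1) * ?r ^ m" .
qed

section \<open>Roots of complex polynomials\<close>

text \<open>The modulus of the value at \<open>x\<close> is that of the leading coefficient times
  the distances to all roots, and the nearest root minimises each factor. As the bound involves the
  leading coefficient and the degree alone, it gives continuity of roots uniformly in
  families.\<close>

lemma complex_poly_root_near:
  fixes q :: "complex poly"
  assumes "degree q > 0"
  shows "\<exists>r. poly q r = 0 \<and> cmod (lead_coeff q) * cmod (x - r) ^ degree q \<le> cmod (poly q x)"
  using assms
proof (induction "degree q" arbitrary: q)
  case (Suc m)
  obtain r where r: "poly q r = 0"
    using Fundamental_Theorem_Algebra.fundamental_theorem_of_algebra[of q] Suc.prems
    by (auto simp: constant_degree)
  then obtain q1 where q1: "q = [:- r, 1:] * q1"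
    by (auto simp: poly_eq_0_iff_dvd elim: dvdE)
  have "q1 \<noteq> 0" using Suc.prems q1 by auto
  then have deg: "degree q = Suc (degree q1)"
    unfolding q1 by (subst degree_mult_eq) auto
  have lc: "lead_coeff q = lead_coeff q1"
    unfolding q1 by (subst lead_coeff_mult) simp
  have val: "cmod (poly q x) = cmod (x - r) * cmod (poly q1 x)"
    unfolding q1 by (simp add: norm_mult[symmetric] algebra_simps)
  show ?case
  proof (cases "degree q1 = 0")
    case True
    then obtain a where "q1 = [:a:]" by (rule degree_eq_zeroE)
    then show ?thesis
      using r deg lc val by (intro exI[of _ r]) (simp add: mult.commute)
  next
    case False
    with Suc.hyps deg obtain r1 where r1: "poly q1 r1 = 0"
        "cmod (lead_coeff q1) * cmod (x - r1) ^ degree q1 \<le> cmod (poly q1 x)"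
      by (metis neq0_conv old.nat.inject)
    define s where "s = (if cmod (x - r) \<le> cmod (x - r1) then r else r1)"
    have "cmod (lead_coeff q) * cmod (x - s) ^ degree q
        = cmod (x - s) * (cmod (lead_coeff q1) * cmod (x - s) ^ degree q1)"
      unfolding lc by (simp add: deg)
    also have "\<dots> \<le> cmod (x - r) * (cmod (lead_coeff q1) * cmod (x - r1) ^ degree q1)"
      by (intro mult_mono mult_left_mono power_mono) (auto simp: s_def)
    also have "\<dots> \<le> cmod (poly q x)"
      unfolding val using r1(2) by (intro mult_left_mono) auto
    finally show ?thesis
      using r r1(1) by (intro exI[of _ s]) (auto simp: s_def q1)
  qed
qed simp

text \<open>Coprimality is expressed by the absence of common zeros: a root of \<open>p\<close> must
  then be a root of \<open>a\<close>, and one linear factor at a time is cancelled from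
  both.\<close>

lemma complex_poly_dvd_mult_cancel:
  fixes p a g :: "complex poly"
  assumes "p \<noteq> 0" "\<And>x. poly p x = 0 \<Longrightarrow> poly g x \<noteq> 0" "p dvd a * g"
  shows "p dvd a"
  using assms
proof (induction "degree p" arbitrary: p a)
  case 0
  then show ?case by (metis is_unit_iff_degree unit_imp_dvd)
next
  case (Suc m)
  obtain r where r: "poly p r = 0"
    using Fundamental_Theorem_Algebra.fundamental_theorem_of_algebra[of p] Suc.hyps(2)
    by (auto simp: constant_degree)
  then obtain p1 where p1: "p = [:- r, 1:] * p1"
    by (auto simp: poly_eq_0_iff_dvd elim: dvdE)
  obtain b where b: "a * g = p * b"
    using Suc.prems(3) by (auto elim: dvdE)
  have "p1 \<noteq> 0" using Suc.prems(1) p1 by auto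
  then have deg: "degree p = Suc (degree p1)"
    unfolding p1 by (subst degree_mult_eq) auto
  have "poly a r * poly g r = 0"
    using b r by (metis mult_zero_left poly_mult)
  then have "poly a r = 0" using Suc.prems(2)[OF r] by simp
  then obtain a1 where a1: "a = [:- r, 1:] * a1"
    by (auto simp: poly_eq_0_iff_dvd elim: dvdE)
  have "[:- r, 1:] * (a1 * g) = [:- r, 1:] * (p1 * b)"
    using b by (simp only: a1 p1 mult.assoc)
  then have "a1 * g = p1 * b"
    by (subst (asm) mult_cancel_left) simp
  then have "p1 dvd a1 * g" by simp
  moreover have "m = degree p1" using Suc.hyps(2) deg by simp
  moreover have "poly g x \<noteq> 0" if "poly p1 x = 0" for x
    using Suc.prems(2)[of x] that by (simp add: p1 del: mult_pCons_left)
  ultimately have "p1 dvd a1"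
    using Suc.hyps(1)[of p1 a1] \<open>p1 \<noteq> 0\<close> by blast
  then show ?case unfolding a1 p1 by (rule mult_dvd_mono[OF dvd_refl])
qed

lemma poly_eq_prod_roots:
  fixes p :: "complex poly"
  assumes "p \<noteq> 0" "card {x. poly p x = 0} = degree p"
  shows "poly p y = lead_coeff p * (\<Prod>x | poly p x = 0. (y - x))"
proof -
  let ?S = "{x. poly p x = 0}"
  let ?q = "Polynomial.smult (lead_coeff p) (\<Prod>x\<in>?S. [:- x, 1:])"
  have fin: "finite ?S" using assms(1) by (rule poly_roots_finite)
  have deg: "degree (\<Prod>x\<in>?S. [:- x, 1:]) = degree p"
    using assms(2) by (subst degree_prod_eq_sum_degree) auto
  have mon: "lead_coeff (\<Prod>x\<in>?S. [:- x, 1:]) = 1"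
    by (simp add: lead_coeff_prod)
  have "p = ?q"
  proof (rule poly_eqI_degree_lead_coeff[where n = "degree p" and A = ?S])
    show "coeff p (degree p) = coeff ?q (degree p)"
      using mon deg by simp
    show "degree ?q \<le> degree p" using deg degree_smult_le[of "lead_coeff p"] by metis
    show "poly p z = poly ?q z" if "z \<in> ?S" for z
    proof -
      have "(\<Prod>x\<in>?S. z - x) = 0"
        using fin that by (intro prod_zero bexI[of _ z]) auto
      then show ?thesis using that by (simp add: poly_prod)
    qed
  qed (use assms(2) in auto)
  then have "poly p y = poly ?q y" by simp
  then show ?thesis by (simp add: poly_prod)
qed

lemma card_roots_eq_degree:
  fixes p :: "complex poly"
  assumes "p \<noteq> 0" "\<And>x. poly p x = 0 \<Longrightarrow> poly (pderiv p) x \<noteq> 0"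
  shows "card {x. poly p x = 0} = degree p"
proof -
  have "rsquarefree p"
    using assms(2) by (auto simp: rsquarefree_roots)
  then have "p = Polynomial.smult (lead_coeff p) (\<Prod>x | poly p x = 0. [:- x, 1:])"
    by (simp add: complex_poly_decompose_rsquarefree)
  then have "degree p = degree (\<Prod>x | poly p x = 0. [:- x, 1:])"
    using assms(1) by (metis degree_smult_eq leading_coeff_0_iff)
  then show ?thesis
    by (subst (asm) degree_prod_eq_sum_degree) auto
qed

lemma poly_pderiv_root_neq_0:
  fixes p :: "complex poly"
  assumes "p \<noteq> 0" "card {x. poly p x = 0} = degree p" "poly p y = 0"
  shows "poly (pderiv p) y \<noteq> 0"
proof -
  let ?S = "{x. poly p x = 0}"
  have fin: "finite ?S" using assms(1) by (rule poly_roots_finite)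
  define q where "q = Polynomial.smult (lead_coeff p) (\<Prod>x\<in>?S - {y}. [:- x, 1:])"
  have "poly p z = poly ([:- y, 1:] * q) z" for z
    using assms(3) fin unfolding q_def poly_eq_prod_roots[OF assms(1,2), of z]
    by (subst prod.remove[of _ y]) (auto simp: poly_prod algebra_simps)
  then have "p = [:- y, 1:] * q"
    by (intro poly_eq_poly_eq_iff[THEN iffD1] ext)
  then have "poly (pderiv p) y = poly q y"
    by (simp del: mult_pCons_left add: pderiv_mult pderiv_pCons)
  moreover have "poly q y \<noteq> 0"
    using assms(1) fin by (simp add: q_def poly_prod)
  ultimately show ?thesis by simp
qed

section \<open>The norm along a curve\<close>

text \<open>Pseudo-division multiplies \<open>F\<close> by a power of the leading coefficient of
  \<open>p\<close>; that coefficient being a nonzero constant, the power can be divided out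
  again.\<close>

lemma bipoly_division:
  fixes p F :: bipoly
  assumes "lead_coeff p = [:c:]" "c \<noteq> 0" "degree p > 0"
  obtains q r where "F = p * q + r" "degree r < degree p"
proof -
  have "p \<noteq> 0" using assms(3) by auto
  obtain q r where qr: "pseudo_divmod F p = (q, r)" by force
  define k where "k = Suc (degree F) - degree p"
  define a where "a = [:inverse (c ^ k):]"
  have "Polynomial.smult ([:c:] ^ k) F = p * q + r"
    using pseudo_divmod(1)[OF \<open>p \<noteq> 0\<close> qr] assms(1) by (simp add: k_def)
  then have "Polynomial.smult a (Polynomial.smult ([:c:] ^ k) F) = Polynomial.smult a (p * q + r)"
    by simp
  moreover have "a * [:c:] ^ k = 1"
    using assms(2) by (simp add: a_def poly_const_pow)
  ultimately have "F = p * Polynomial.smult a q + Polynomial.smult a r"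
    by (simp add: smult_add_right)
  moreover have "degree (Polynomial.smult a r) < degree p"
    using pseudo_divmod(2)[OF \<open>p \<noteq> 0\<close> qr] assms(3) degree_smult_le[of a r] by auto
  ultimately show ?thesis by (rule that)
qed

lemma poly_as_sum_lt:
  fixes p :: "'a :: comm_semiring_1 poly"
  shows "degree p < n \<Longrightarrow> poly p x = (\<Sum>j<n. coeff p j * x ^ j)"
  unfolding Polynomial.poly_altdef
  by (rule sum.mono_neutral_left) (auto simp: coeff_eq_0)

lemma degree_xslice_le: "degree (xslice p x) \<le> degree p"
  by (rule degree_le) (simp add: coeff_eq_0)

lemma beval_as_sum_lt:
  assumes "degree r < n"
  shows "beval r x y = (\<Sum>j<n. poly (coeff r j) x * y ^ j)"
proof -
  have "degree (xslice r x) \<le> degree r"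
    by (rule degree_xslice_le)
  then have "poly (xslice r x) y = (\<Sum>j<n. coeff (xslice r x) j * y ^ j)"
    using assms by (intro poly_as_sum_lt) simp
  then show ?thesis by simp
qed

text \<open>
  The matrix of multiplication by \<open>z F - G\<close> on \<open>\<complex>[x, y] / (p)\<close>, a free \<open>\<complex>[x]\<close>-module with
  basis \<open>1, y, \<dots>, y\<^sup>n\<^sup>-\<^sup>1\<close>. Its eigenvalues over \<open>x\<close> are the values at the points of the curve.
\<close>

lemma mult_matrix_exists:
  fixes p F :: bipoly
  assumes "lead_coeff p = [:c:]" "c \<noteq> 0" "degree p = n" "n > 0"
  obtains m q where
    "\<And>i x y. y ^ i * beval F x y = (\<Sum>j<n. poly (m i j) x * y ^ j) + beval p x y * beval (q i) x y"
proof -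
  have "\<exists>q r. bY ^ i * F = p * q + r \<and> degree r < n" for i
    using bipoly_division[of p c "bY ^ i * F"] assms by metis
  then obtain q r where qr: "\<And>i. bY ^ i * F = p * q i + r i" "\<And>i. degree (r i) < n"
    by metis
  show ?thesis
  proof (rule that[of "\<lambda>i j. coeff (r i) j" q])
    fix i x y
    have "y ^ i * beval F x y = beval (bY ^ i * F) x y" by simp
    also have "\<dots> = beval p x y * beval (q i) x y + beval (r i) x y"
      unfolding qr(1) by simp
    finally show "y ^ i * beval F x y =
        (\<Sum>j<n. poly (coeff (r i) j) x * y ^ j) + beval p x y * beval (q i) x y"
      using beval_as_sum_lt[OF qr(2)[of i], of x y] by simp
  qed
qed

text \<open>A null vector of the transpose lists the coefficients of a nonzero polynomial of degree
  below \<open>n\<close> with the \<open>n\<close> distinct roots \<open>f k\<close>.\<close>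

lemma vandermonde_det_neq_0:
  fixes f :: "nat \<Rightarrow> 'a :: field"
  assumes "inj_on f {..<n}"
  shows "Determinant.det (Matrix.mat n n (\<lambda>(j, k). f k ^ j)) \<noteq> 0"
proof
  let ?V = "Matrix.mat n n (\<lambda>(j, k). f k ^ j)"
  assume "Determinant.det ?V = 0"
  then have "Determinant.det (transpose_mat ?V) = 0"
    by (subst Determinant.det_transpose) auto
  then obtain v where v: "v \<in> carrier_vec n" "v \<noteq> 0\<^sub>v n" "transpose_mat ?V *\<^sub>v v = 0\<^sub>v n"
    using Determinant.det_0_iff_vec_prod_zero[of "transpose_mat ?V" n] by auto
  define a where "a = (\<Sum>j<n. monom (vec_index v j) j)"
  have coeff_a: "coeff a j = (if j < n then vec_index v j else 0)" for j
    unfolding a_def by (simp add: coeff_sum)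
  have "poly a (f k) = 0" if "k < n" for k
  proof -
    have "poly a (f k) = (\<Sum>j<n. vec_index v j * f k ^ j)"
      by (simp add: a_def poly_sum poly_monom)
    also have "\<dots> = vec_index (transpose_mat ?V *\<^sub>v v) k"
      using that v(1) by (auto simp: scalar_prod_def atLeast0LessThan mult.commute intro!: sum.cong)
    finally show ?thesis using v(3) that by simp
  qed
  then have sub: "f ` {..<n} \<subseteq> {x. poly a x = 0}" by auto
  have "a \<noteq> 0"
  proof
    assume "a = 0"
    then have "vec_index v j = 0" if "j < n" for j
      using coeff_a[of j] that by simp
    then have "v = 0\<^sub>v n" using v(1) by (intro eq_vecI) auto
    then show False using v(2) by simp
  qed
  have "degree a < n"
  proof -
    have "n > 0" using v(1,2) by (cases n) auto
    then show ?thesis using coeff_a by (intro degree_lessI) auto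
  qed
  have "card (f ` {..<n}) \<le> card {x. poly a x = 0}"
    using \<open>a \<noteq> 0\<close> sub by (intro card_mono poly_roots_finite)
  also have "\<dots> \<le> degree a"
    using \<open>a \<noteq> 0\<close> by (rule card_poly_roots_bound)
  finally have "card (f ` {..<n}) \<le> degree a" .
  then show False
    using \<open>degree a < n\<close> assms by (simp add: card_image)
qed

text \<open>\<open>Q\<close> is the norm of \<open>z F - G\<close> from the curve
  \<open>p = 0\<close> down to the x-axis. The product formula comes from diagonalising the
  multiplication matrix and needs \<open>n\<close> distinct roots over \<open>x\<close>; the
  description of the zeros is proved separately because it must also hold over ramified
  \<open>x\<close>.\<close>

lemma bipoly_norm_exists:
  fixes p F G :: bipoly
  assumes lc: "lead_coeff p = [:c:]" "c \<noteq> 0" and deg: "degree p = n" "n > 0"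
  obtains Q :: bipoly where
    "\<And>x z. card {y. beval p x y = 0} = n \<Longrightarrow>
       beval Q x z = (\<Prod>y | beval p x y = 0. (z * beval F x y - beval G x y))"
    "\<And>x z. beval Q x z = 0 \<longleftrightarrow> (\<exists>y. beval p x y = 0 \<and> z * beval F x y = beval G x y)"
proof -
  obtain mF qF where F: "\<And>i x y. y ^ i * beval F x y =
      (\<Sum>j<n. poly (mF i j) x * y ^ j) + beval p x y * beval (qF i) x y"
    by (rule mult_matrix_exists[OF lc deg, of F]) (rule that)
  obtain mG qG where G: "\<And>i x y. y ^ i * beval G x y =
      (\<Sum>j<n. poly (mG i j) x * y ^ j) + beval p x y * beval (qG i) x y"
    by (rule mult_matrix_exists[OF lc deg, of G]) (rule that)
  \<comment> \<open>The outer variable of an entry plays the role of \<open>z\<close>.\<close>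
  define M :: "bipoly Matrix.mat" where "M = Matrix.mat n n (\<lambda>(i, j). [: - mG i j, mF i j :])"
  define Q where "Q = Determinant.det M"
  define A where "A x z = Matrix.mat n n (\<lambda>(i, j). z * poly (mF i j) x - poly (mG i j) x)" for x z
  define f where "f x z y = z * beval F x y - beval G x y" for x z y
  have carr: "A x z \<in> carrier_mat n n" for x z by (simp add: A_def)
  have detA: "beval Q x z = Determinant.det (A x z)" for x z
  proof -
    interpret h: comm_ring_hom "\<lambda>Q. beval Q x z"
      by unfold_locales auto
    have "map_mat (\<lambda>Q. beval Q x z) M = A x z"
      by (rule eq_matI) (auto simp: M_def A_def beval_pCons)
    then show ?thesis unfolding Q_def by (metis h.hom_det)
  qed
  have row: "(\<Sum>j<n. A x z $$ (i, j) * y ^ j)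
      = y ^ i * f x z y - beval p x y * (z * beval (qF i) x y - beval (qG i) x y)"
    if "i < n" for x z y i
  proof -
    have "(\<Sum>j<n. A x z $$ (i, j) * y ^ j)
        = z * (\<Sum>j<n. poly (mF i j) x * y ^ j) - (\<Sum>j<n. poly (mG i j) x * y ^ j)"
      using that by (simp add: A_def sum_distrib_left sum_subtractf[symmetric] algebra_simps)
    also have "\<dots> = z * (y ^ i * beval F x y - beval p x y * beval (qF i) x y)
        - (y ^ i * beval G x y - beval p x y * beval (qG i) x y)"
      using F[of y i x] G[of y i x] by simp
    finally show ?thesis by (simp add: f_def algebra_simps)
  qed
  have degx: "degree (xslice p x) = n" and px0: "xslice p x \<noteq> 0" for x
  proof -
    have "coeff (xslice p x) n = c" using lc deg by simp
    moreover have "degree (xslice p x) \<le> n"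
      using degree_xslice_le[of p x] deg by simp
    ultimately show "degree (xslice p x) = n" using lc(2) by (metis le_antisym le_degree)
    then show "xslice p x \<noteq> 0" using deg by auto
  qed
  show ?thesis
  proof (rule that)
    fix x z
    let ?S = "{y. beval p x y = 0}"
    assume card: "card ?S = n"
    have "finite ?S" using card deg card_ge_0_finite by force
    then obtain h where h: "bij_betw h {..<n} ?S"
      using ex_bij_betw_nat_finite[of ?S] card by (auto simp: atLeast0LessThan)
    define V where "V = Matrix.mat n n (\<lambda>(j, k). h k ^ j)"
    define E where "E = Matrix.mat n n (\<lambda>(j, k). if j = k then f x z (h k) else 0)"
    have hroot: "beval p x (h k) = 0" if "k < n" for k
      using h that by (auto dest: bij_betwE)
    \<comment> \<open>Each column of \<open>V\<close> lists the powers of one root and is an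
      eigenvector of \<open>A x z\<close>, because the multiple of \<open>p\<close> in
      \<open>row\<close> vanishes at a root.\<close>
    have "A x z * V = V * E"
    proof (rule eq_matI)
      fix i k assume "i < dim_row (V * E)" "k < dim_col (V * E)"
      then have ik: "i < n" "k < n" by (auto simp: V_def E_def)
      have "(A x z * V) $$ (i, k) = (\<Sum>j<n. A x z $$ (i, j) * h k ^ j)"
        using ik carr[of x z] by (auto simp: V_def scalar_prod_def atLeast0LessThan intro!:
            sum.cong)
      also have "\<dots> = h k ^ i * f x z (h k)"
        using row[OF ik(1)] hroot[OF ik(2)] by simp
      also have "\<dots> = (\<Sum>j<n. h j ^ i * (if j = k then f x z (h k) else 0))"
        using ik by (simp add: if_distrib[of "\<lambda>t. _ * t"] cong: if_cong)
      also have "\<dots> = (V * E) $$ (i, k)"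
        using ik by (simp add: V_def E_def scalar_prod_def atLeast0LessThan)
      finally show "(A x z * V) $$ (i, k) = (V * E) $$ (i, k)" .
    qed (use carr[of x z] in \<open>auto simp: V_def E_def\<close>)
    then have "Determinant.det (A x z * V) = Determinant.det (V * E)"
      by simp
    moreover have VE: "V \<in> carrier_mat n n" "E \<in> carrier_mat n n"
      by (simp_all add: V_def E_def)
    ultimately have "Determinant.det (A x z) * Determinant.det V =
        Determinant.det V * Determinant.det E"
      using Determinant.det_mult[OF carr[of x z] VE(1)] Determinant.det_mult[OF VE] by simp
    moreover have "Determinant.det V \<noteq> 0"
      unfolding V_def using h by (intro vandermonde_det_neq_0) (simp add: bij_betw_def)
    ultimately have "Determinant.det (A x z) = Determinant.det E" by simp
    also have "\<dots> = prod_list (diag_mat E)"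
      by (rule Determinant.det_upper_triangular[where n =
          n]) (auto simp: E_def upper_triangular_def)
    also have "\<dots> = (\<Prod>k<n. f x z (h k))"
      by (auto simp: diag_mat_def E_def prod.distinct_set_conv_list[symmetric] atLeast0LessThan
          intro!: prod.cong)
    also have "\<dots> = (\<Prod>y\<in>?S. f x z y)"
      using h by (rule prod.reindex_bij_betw)
    finally show "beval Q x z = (\<Prod>y\<in>?S. (z * beval F x y - beval G x y))"
      by (simp add: detA f_def)
  next
    fix x z
    show "beval Q x z = 0 \<longleftrightarrow> (\<exists>y. beval p x y = 0 \<and> z * beval F x y = beval G x y)"
    proof
      assume "\<exists>y. beval p x y = 0 \<and> z * beval F x y = beval G x y"
      then obtain y where y: "beval p x y = 0" "f x z y = 0" by (auto simp: f_def)
      define v where "v = Matrix.vec n (\<lambda>j. y ^ j)"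
      have "vec_index v 0 = 1" using deg by (simp add: v_def)
      then have "v \<noteq> 0\<^sub>v n" using deg by auto
      moreover have "A x z *\<^sub>v v = 0\<^sub>v n"
      proof (rule eq_vecI)
        fix i assume "i < dim_vec (0\<^sub>v n :: complex Matrix.vec)"
        then have i: "i < n" by simp
        have "vec_index (A x z *\<^sub>v v) i = (\<Sum>j<n. A x z $$ (i, j) * y ^ j)"
          using i carr[of x z] by (auto simp: v_def scalar_prod_def atLeast0LessThan intro!:
              sum.cong)
        then show "vec_index (A x z *\<^sub>v v) i = vec_index (0\<^sub>v n) i"
          using row[OF i] y i by simp
      qed (use carr[of x z] in auto)
      moreover have "v \<in> carrier_vec n" by (simp add: v_def)
      ultimately show "beval Q x z = 0"
        using Determinant.det_0_iff_vec_prod_zero[OF carr[of x z]] detA by auto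
    next
      assume "beval Q x z = 0"
      then have "Determinant.det (transpose_mat (A x z)) = 0"
        using detA carr[of x z] by (subst Determinant.det_transpose) auto
      then obtain v where v: "v \<in> carrier_vec n" "v \<noteq> 0\<^sub>v n"
          "transpose_mat (A x z) *\<^sub>v v = 0\<^sub>v n"
        using Determinant.det_0_iff_vec_prod_zero[of "transpose_mat (A x z)" n] carr[of x z] by auto
      \<comment> \<open>A null vector on the left is the coefficient list of a nonzero
        \<open>a\<close> of degree below \<open>n\<close> whose product with \<open>z F - G\<close>
        is divisible by \<open>p\<close>. Without a common zero \<open>p\<close> would divide
        \<open>a\<close> itself.\<close>
      define a where "a = (\<Sum>i<n. monom (vec_index v i) i)"
      have coeff_a: "coeff a i = (if i < n then vec_index v i else 0)" for i
        unfolding a_def by (simp add: coeff_sum)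
      have col: "(\<Sum>i<n. vec_index v i * A x z $$ (i, j)) = 0" if j: "j < n" for j
      proof -
        have "(\<Sum>i<n. vec_index v i * A x z $$ (i, j)) = vec_index (transpose_mat (A x z) *\<^sub>v v) j"
          using j v(1) carr[of x z]
          by (auto simp: scalar_prod_def atLeast0LessThan mult.commute intro!: sum.cong)
        then show ?thesis using v(3) j by simp
      qed
      define g where "g = Polynomial.smult z (xslice F x) - xslice G x"
      define b where "b = (\<Sum>i<n. Polynomial.smult (vec_index v i)
        (Polynomial.smult z (xslice (qF i) x) - xslice (qG i) x))"
      have poly_g: "poly g y = f x z y" for y
        by (simp add: g_def f_def)
      have "a * g = xslice p x * b"
      proof (rule poly_eq_poly_eq_iff[THEN iffD1], rule ext)
        fix y
        have "poly (a * g) y = (\<Sum>i<n. vec_index v i * (y ^ i * f x z y))"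
          by (simp add: a_def poly_sum poly_monom poly_g sum_distrib_right mult.assoc)
        also have "\<dots> = (\<Sum>i<n. vec_index v i * (\<Sum>j<n. A x z $$ (i, j) * y ^ j))
            + (\<Sum>i<n. vec_index v i * (beval p x y * (z * beval (qF i) x y - beval (qG i) x y)))"
          unfolding sum.distrib[symmetric]
          by (intro sum.cong refl) (simp add: row ring_distribs[symmetric])
        also have "(\<Sum>i<n. vec_index v i * (\<Sum>j<n. A x z $$ (i, j) * y ^ j))
            = (\<Sum>j<n. (\<Sum>i<n. vec_index v i * A x z $$ (i, j)) * y ^ j)"
          unfolding sum_distrib_left sum_distrib_right
          by (subst sum.swap) (simp add: mult.assoc)
        also have "\<dots> = 0" using col by simp
        also have "0 + (\<Sum>i<n. vec_index v i * (beval p x y *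
            (z * beval (qF i) x y - beval (qG i) x y))) = poly (xslice p x * b) y"
          by (simp add: b_def poly_sum sum_distrib_left mult_ac)
        finally show "poly (a * g) y = poly (xslice p x * b) y" .
      qed
      then have dvd: "xslice p x dvd a * g" by simp
      show "\<exists>y. beval p x y = 0 \<and> z * beval F x y = beval G x y"
      proof (rule ccontr)
        assume neg: "\<not> ?thesis"
        have "xslice p x dvd a"
          using neg by (intro complex_poly_dvd_mult_cancel[OF px0 _ dvd]) (auto simp: poly_g f_def)
        moreover have "a \<noteq> 0"
        proof
          assume "a = 0"
          then have "vec_index v i = 0" if "i < n" for i
            using coeff_a[of i] that by simp
          then have "v = 0\<^sub>v n" using v(1) by (intro eq_vecI) auto
          then show False using v(2) by simp
        qed
        ultimately have "n \<le> degree a"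
          using dvd_imp_degree_le[of "xslice p x" a] degx by simp
        moreover have "degree a < n"
          using coeff_a deg by (intro degree_lessI) auto
        ultimately show False by simp
      qed
    qed
  qed
qed

section \<open>Branches of the polar curve\<close>

lemma xslice_dy: "xslice (dy p) x = pderiv (xslice p x)"
  by (rule poly_eqI) (simp add: dy_def coeff_pderiv of_nat_poly)

text \<open>Division by \<open>x - a\<close> is carried out in each coefficient with respect to
  \<open>y\<close>. It provides Lipschitz bounds in \<open>x\<close> and, when \<open>F\<close>
  vanishes on the line \<open>x = a\<close>, the removal of that line.\<close>

lemma beval_x_difference:
  "\<exists>D. \<forall>x y. beval F x y - beval F a y = (x - a) * beval D x y"
proof (intro exI allI)
  fix x y
  show "beval F x y - beval F a y = (x - a) * beval (map_poly (\<lambda>q. synthetic_div q a) F) x y"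
  proof (induction F)
    case (pCons q F)
    have q: "poly q x = poly q a + (x - a) * poly (synthetic_div q a) x"
      using arg_cong[OF synthetic_div_correct'[of a q], of "\<lambda>p. poly p x"]
      by (simp add: algebra_simps)
    have F: "beval F x y = beval F a y + (x - a) * beval (map_poly (\<lambda>q. synthetic_div q a) F) x y"
      using pCons.IH by (simp add: algebra_simps)
    show ?case
      by (simp add: map_poly_pCons beval_pCons q F) (simp add: algebra_simps)
  qed simp
qed

lemma beval_bounded_compact:
  assumes "compact A" "compact B"
  shows "\<exists>M>0. \<forall>x\<in>A. \<forall>y\<in>B. cmod (beval F x y) \<le> M"
proof -
  have "compact ((\<lambda>z. beval F (fst z) (snd z)) ` (A \<times> B))"
    using assms by (intro compact_continuous_image compact_Times continuous_intros)
  then obtain M where "M > 0" "\<forall>z\<in>(\<lambda>z. beval F (fst z) (snd z)) ` (A \<times> B). cmod z \<le> M"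
    using compact_imp_bounded bounded_pos by metis
  then show ?thesis by force
qed

lemma finite_separated:
  fixes S :: "'a :: metric_space set"
  assumes "finite S"
  shows "\<exists>s>0. \<forall>a\<in>S. \<forall>b\<in>S. a \<noteq> b \<longrightarrow> s \<le> dist a b"
proof (intro exI conjI ballI impI)
  \<comment> \<open>The element 1 covers sets with fewer than two points.\<close>
  let ?D = "insert 1 ((\<lambda>(a, b). dist a b) ` {(a, b). a \<in> S \<and> b \<in> S \<and> a \<noteq> b})"
  have "finite {(a, b). a \<in> S \<and> b \<in> S \<and> a \<noteq> b}"
    by (rule finite_subset[of _ "S \<times> S"]) (use assms in auto)
  then have fin: "finite ?D" by simp
  then show "Min ?D > 0" by (auto simp: Min_gr_iff)
  fix a b assume "a \<in> S" "b \<in> S" "a \<noteq> b"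
  then have "dist a b \<in> ?D" by force
  with fin show "Min ?D \<le> dist a b" by (rule Min_le)
qed

text \<open>\<open>K\<close> stands for a sheared Hamiltonian and \<open>x\<close> for the linear
  form onto which the curve \<open>dy K = 0\<close> is projected. The leading coefficient in
  \<open>y\<close> is constant, so the projection is finite: over bounded \<open>x\<close> the roots
  stay bounded.\<close>

locale polar_curve =
  fixes K :: bipoly and n :: nat and c :: complex
  assumes n_pos: "n > 0"
    and degree_dy: "degree (dy K) = n"
    and lead_coeff_dy: "lead_coeff (dy K) = [:c:]"
    and c_nonzero: "c \<noteq> 0"
begin

definition roots :: "complex \<Rightarrow> complex set" where
  "roots x = {y. beval (dy K) x y = 0}"

lemma degree_slice: "degree (xslice (dy K) x) = n"
  and lead_coeff_slice: "lead_coeff (xslice (dy K) x) = c"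
  and slice_nonzero: "xslice (dy K) x \<noteq> 0"
proof -
  have cn: "coeff (xslice (dy K) x) n = c"
    using lead_coeff_dy degree_dy by simp
  moreover have "degree (xslice (dy K) x) \<le> n"
    using degree_xslice_le[of "dy K" x] degree_dy by simp
  ultimately show deg: "degree (xslice (dy K) x) = n"
    using c_nonzero by (metis le_antisym le_degree)
  show "lead_coeff (xslice (dy K) x) = c" using cn deg by simp
  show "xslice (dy K) x \<noteq> 0" using deg n_pos by auto
qed

lemma roots_eq: "roots x = {y. poly (xslice (dy K) x) y = 0}"
  by (simp add: roots_def)

lemma finite_roots: "finite (roots x)"
  unfolding roots_eq by (rule poly_roots_finite[OF slice_nonzero])

lemma card_roots_le: "card (roots x) \<le> n"
  using card_poly_roots_bound[OF slice_nonzero, of x] unfolding roots_eq degree_slice .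

lemma root_near: "\<exists>r\<in>roots x. cmod c * cmod (y - r) ^ n \<le> cmod (beval (dy K) x y)"
proof -
  have "\<exists>r. poly (xslice (dy K) x) r = 0 \<and>
      cmod c * cmod (y - r) ^ n \<le> cmod (poly (xslice (dy K) x) y)"
    using complex_poly_root_near[of "xslice (dy K) x" y]
    unfolding lead_coeff_slice unfolding degree_slice using n_pos by blast
  then show ?thesis by (auto simp: roots_def)
qed

lemma roots_nonempty: "roots x \<noteq> {}"
  using root_near[of x 0] by blast

text \<open>Cauchy's bound: for \<open>cmod y \<ge> 1\<close> the lower terms of the equation are at
  most their coefficient sum times \<open>cmod y ^ (n - 1)\<close>. Explicit constants are kept
  because the bound is applied to a whole sequence of curves with the same \<open>c\<close>.\<close>

lemma root_bound:
  assumes y: "y \<in> roots x" and m: "\<And>j. j < n \<Longrightarrow> cmod (poly (coeff (dy K) j) x) \<le> m j"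
  shows "cmod y \<le> 1 + (\<Sum>j<n. m j) / cmod c"
proof -
  define S where "S = (\<Sum>j<n. m j)"
  have m0: "m j \<ge> 0" if "j < n" for j
    using m[OF that] norm_ge_zero order_trans by blast
  have S0: "S \<ge> 0" unfolding S_def using m0 by (intro sum_nonneg) auto
  have "cmod y \<le> 1 + S / cmod c"
  proof (cases "cmod y \<le> 1")
    case True
    then show ?thesis using S0 by (simp add: add_increasing2)
  next
    case False
    then have y1: "1 \<le> cmod y" by simp
    have "0 = (\<Sum>j\<le>n. coeff (xslice (dy K) x) j * y ^ j)"
      using y unfolding roots_eq Polynomial.poly_altdef degree_slice by simp
    also have "\<dots> = c * y ^ n + (\<Sum>j<n. poly (coeff (dy K) j) x * y ^ j)"
      using lead_coeff_slice[of x] unfolding degree_slice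
      by (simp add: lessThan_Suc_atMost[symmetric])
    finally have "c * y ^ n = - (\<Sum>j<n. poly (coeff (dy K) j) x * y ^ j)"
      by (simp add: eq_neg_iff_add_eq_0)
    then have "cmod c * cmod y ^ n = cmod (\<Sum>j<n. poly (coeff (dy K) j) x * y ^ j)"
      by (metis norm_minus_cancel norm_mult norm_power)
    also have "\<dots> \<le> (\<Sum>j<n. m j * cmod y ^ (n - 1))"
      using m y1 m0
      by (intro order_trans[OF norm_sum] sum_mono)
         (auto simp: norm_mult norm_power intro!: mult_mono power_increasing)
    also have "\<dots> = S * cmod y ^ (n - 1)"
      by (simp add: S_def sum_distrib_right)
    finally have "(cmod c * cmod y) * cmod y ^ (n - 1) \<le> S * cmod y ^ (n - 1)"
      using n_pos by (cases n) (simp_all add: mult_ac)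
    moreover have "cmod y ^ (n - 1) > 0"
      using y1 by (intro zero_less_power) linarith
    ultimately have "cmod c * cmod y \<le> S"
      by (rule mult_right_le_imp_le)
    then have "cmod y \<le> S / cmod c"
      using c_nonzero by (simp add: field_simps)
    then show ?thesis by simp
  qed
  then show ?thesis by (simp add: S_def)
qed

lemma roots_bounded: "\<exists>M>0. \<forall>x y. cmod x \<le> B \<longrightarrow> y \<in> roots x \<longrightarrow> cmod y \<le> M"
proof -
  have "\<exists>m\<ge>0. \<forall>x. cmod x \<le> B \<longrightarrow> cmod (poly (coeff (dy K) j) x) \<le> m" for j
  proof -
    have "compact ((\<lambda>x. poly (coeff (dy K) j) x) ` cball 0 B)"
      by (intro compact_continuous_image continuous_intros) auto
    then obtain m where "m > 0" "\<forall>z\<in>(\<lambda>x. poly (coeff (dy K) j) x) ` cball 0 B. cmod z \<le> m"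
      using compact_imp_bounded bounded_pos by metis
    then show ?thesis by (intro exI[of _ m]) auto
  qed
  then obtain m where m: "\<And>j. m j \<ge> 0" "\<And>j x. cmod x \<le> B \<Longrightarrow> cmod (poly (coeff (dy K) j) x) \<le> m j"
    by metis
  have "0 < 1 + (\<Sum>j<n. m j) / cmod c"
    using m(1) by (intro add_pos_nonneg divide_nonneg_nonneg sum_nonneg) auto
  then show ?thesis using root_bound m(2) by blast
qed

lemma roots_limit:
  assumes "X \<longlonglongrightarrow> x0" "\<And>k. Y k \<in> roots (X k)"
  obtains r y0 where "strict_mono (r :: nat \<Rightarrow> nat)" "(Y \<circ> r) \<longlonglongrightarrow> y0" "y0 \<in> roots x0"
proof -
  obtain B where "\<And>k. cmod (X k) \<le> B"
    using convergent_imp_Bseq[of X] assms(1) by (metis Bseq_def convergentI)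
  then obtain M where "\<And>k. cmod (Y k) \<le> M"
    using roots_bounded[of B] assms(2) by metis
  then have "\<forall>k. Y k \<in> cball 0 M" by simp
  then obtain y0 r where r: "strict_mono (r :: nat \<Rightarrow> nat)" "(Y \<circ> r) \<longlonglongrightarrow> y0"
    using compact_cball[of "0 :: complex" M] unfolding compact_def by meson
  have "(\<lambda>k. beval (dy K) ((X \<circ> r) k) ((Y \<circ> r) k)) \<longlonglongrightarrow> beval (dy K) x0 y0"
    using LIMSEQ_subseq_LIMSEQ[OF assms(1) r(1)] r(2) by (intro tendsto_beval)
  moreover have "beval (dy K) ((X \<circ> r) k) ((Y \<circ> r) k) = 0" for k
    using assms(2)[of "r k"] by (simp add: roots_def)
  ultimately have "y0 \<in> roots x0"
    by (simp add: roots_def LIMSEQ_const_iff)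
  with r show ?thesis by (rule that)
qed

text \<open>This plays the part of the implicit function theorem over an unramified
  \<open>x1\<close>. Each root over \<open>x1\<close> attracts a root over \<open>x\<close>; the
  separation \<open>s\<close> makes these distinct, and being \<open>n\<close> in number they are
  all the roots. When \<open>dy K\<close> over \<open>x1\<close> is factorised and evaluated at
  \<open>Y r x\<close>, the other \<open>n - 1\<close> factors are at least \<open>s / 3\<close>,
  which makes the remaining one linear in \<open>x - x1\<close>.\<close>

lemma roots_matching:
  assumes card: "card (roots x1) = n"
  obtains Y L \<delta> where "\<delta> > 0" "L \<ge> 0"
    "\<And>x. x \<in> ball x1 \<delta> \<Longrightarrow> bij_betw (\<lambda>r. Y r x) (roots x1) (roots x)"
    "\<And>x r. x \<in> ball x1 \<delta> \<Longrightarrow> r \<in> roots x1 \<Longrightarrow> cmod (Y r x - r) \<le> L * cmod (x - x1)"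
proof -
  let ?p = "dy K"
  obtain s where s: "s > 0" "\<And>a b. a \<in> roots x1 \<Longrightarrow> b \<in> roots x1 \<Longrightarrow> a \<noteq> b \<Longrightarrow> s \<le> cmod (a - b)"
    using finite_separated[OF finite_roots[of x1]] by (auto simp: dist_norm)
  obtain M where M: "M > 0" "\<And>x y. cmod x \<le> cmod x1 + 1 \<Longrightarrow> y \<in> roots x \<Longrightarrow> cmod y \<le> M"
    using roots_bounded by metis
  obtain D where D: "\<And>x y. beval ?p x y - beval ?p x1 y = (x - x1) * beval D x y"
    using beval_x_difference by metis
  obtain C where C: "C > 0" "\<And>x y. x \<in> cball x1 1 \<Longrightarrow> y \<in> cball 0 M \<Longrightarrow> cmod (beval D x y) \<le> C"
    using beval_bounded_compact[of "cball x1 1" "cball 0 M" D] by auto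
  have lip: "cmod (beval ?p x y - beval ?p x1 y) \<le> C * cmod (x - x1)"
    if "cmod (x - x1) \<le> 1" "cmod y \<le> M" for x y
  proof -
    have "cmod (beval D x y) \<le> C"
      using C(2)[of x y] that by (simp add: dist_norm norm_minus_commute)
    then have "cmod (x - x1) * cmod (beval D x y) \<le> cmod (x - x1) * C"
      by (rule mult_left_mono) simp
    then show ?thesis by (simp add: D norm_mult mult.commute)
  qed
  \<comment> \<open>Chosen so that \<open>root_near\<close> puts a root over \<open>x\<close> within
    \<open>s / 3\<close> of each root over \<open>x1\<close>; the cap 1 keeps \<open>x\<close> where
    the bounds \<open>M\<close> and \<open>C\<close> are valid.\<close>
  define \<delta> where "\<delta> = min 1 (cmod c * (s / 3) ^ n / C)"
  have \<delta>: "\<delta> > 0" "\<delta> \<le> 1" "C * \<delta> \<le> cmod c * (s / 3) ^ n"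
    using s(1) C(1) c_nonzero by (auto simp: \<delta>_def min_def field_simps)
  have x_le: "cmod x \<le> cmod x1 + 1" if "x \<in> ball x1 \<delta>" for x
    using that \<delta>(2) norm_triangle_ineq[of x1 "x - x1"]
    by (auto simp: dist_norm norm_minus_commute)
  have "\<exists>y\<in>roots x. cmod (y - r) < s / 3" if x: "x \<in> ball x1 \<delta>" and r: "r \<in> roots x1" for x r
  proof -
    obtain y where y: "y \<in> roots x" "cmod c * cmod (r - y) ^ n \<le> cmod (beval ?p x r)"
      using root_near by blast
    have "cmod (beval ?p x r) \<le> C * cmod (x - x1)"
      using lip[of x r] M(2)[of x1 r] r x \<delta>(2)
      by (auto simp: roots_def dist_norm norm_minus_commute)
    also have "\<dots> < C * \<delta>"
      using x C(1) by (simp add: dist_norm norm_minus_commute)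
    finally have "cmod c * cmod (r - y) ^ n < cmod c * (s / 3) ^ n"
      using y(2) \<delta>(3) by linarith
    then have "cmod (r - y) ^ n < (s / 3) ^ n"
      using c_nonzero by simp
    then have "cmod (r - y) < s / 3"
      by (rule power_less_imp_less_base) (use s(1) in auto)
    then show ?thesis using y(1) by (auto simp: norm_minus_commute)
  qed
  then have ex: "\<exists>y. y \<in> roots x \<and> cmod (y - r) < s / 3" if "x \<in> ball x1 \<delta>" "r \<in> roots x1" for x r
    using that by blast
  define Y where "Y r x = (SOME y. y \<in> roots x \<and> cmod (y - r) < s / 3)" for r x
  have Y: "Y r x \<in> roots x" "cmod (Y r x - r) < s / 3" if "x \<in> ball x1 \<delta>" "r \<in> roots x1" for x r
    using someI_ex[OF ex[OF that]] unfolding Y_def by blast+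
  define L where "L = C / (cmod c * (s / 3) ^ (n - 1))"
  show ?thesis
  proof (rule that[of \<delta> L Y])
    show "\<delta> > 0" by (fact \<delta>(1))
    show "L \<ge> 0" using C(1) s(1) by (simp add: L_def)
  next
    fix x assume x: "x \<in> ball x1 \<delta>"
    have "inj_on (\<lambda>r. Y r x) (roots x1)"
    proof (rule inj_onI, rule ccontr)
      fix a b assume ab: "a \<in> roots x1" "b \<in> roots x1" "Y a x = Y b x" "a \<noteq> b"
      have "cmod (a - b) \<le> cmod (Y a x - a) + cmod (Y b x - b)"
        using ab(3) norm_triangle_ineq4[of "Y b x - b" "Y a x - a"] by (simp add: algebra_simps)
      then show False
        using Y(2)[OF x ab(1)] Y(2)[OF x ab(2)] s(2)[OF ab(1,2,4)] s(1) by linarith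
    qed
    moreover have "(\<lambda>r. Y r x) ` roots x1 = roots x"
      using calculation Y(1)[OF x] card card_roots_le[of x] finite_roots[of x]
      by (intro card_seteq) (auto simp: card_image)
    ultimately show "bij_betw (\<lambda>r. Y r x) (roots x1) (roots x)"
      by (simp add: bij_betw_def)
  next
    fix x r assume x: "x \<in> ball x1 \<delta>" and r: "r \<in> roots x1"
    let ?y = "Y r x"
    have "cmod c * (cmod (?y - r) * (s / 3) ^ (n - 1)) \<le> cmod c * (\<Prod>b\<in>roots x1. cmod (?y - b))"
    proof (intro mult_left_mono)
      have "(s / 3) ^ (n - 1) = (\<Prod>b\<in>roots x1 - {r}. s / 3)"
        using card r by simp
      also have "\<dots> \<le> (\<Prod>b\<in>roots x1 - {r}. cmod (?y - b))"
      proof (intro prod_mono conjI)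
        fix b assume b: "b \<in> roots x1 - {r}"
        have "cmod (r - b) \<le> cmod (?y - b) + cmod (?y - r)"
          using norm_triangle_ineq4[of "?y - b" "?y - r"] by simp
        moreover have "s \<le> cmod (r - b)"
          using s(2)[of r b] b r by auto
        ultimately show "s / 3 \<le> cmod (?y - b)"
          using Y(2)[OF x r] s(1) by linarith
      qed (use s(1) in auto)
      finally show "cmod (?y - r) * (s / 3) ^ (n - 1) \<le> (\<Prod>b\<in>roots x1. cmod (?y - b))"
        using prod.remove[OF finite_roots r, of "\<lambda>b. cmod (?y - b)"] by (simp add: mult_left_mono)
    qed simp
    also have "\<dots> = cmod (beval ?p x1 ?y)"
      using poly_eq_prod_roots[OF slice_nonzero, of x1 ?y] card
      by (simp add: roots_eq degree_slice lead_coeff_dy[unfolded degree_dy] norm_mult prod_norm)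
    also have "\<dots> = cmod (beval ?p x ?y - beval ?p x1 ?y)"
      using Y(1)[OF x r] by (simp add: roots_def)
    also have "\<dots> \<le> C * cmod (x - x1)"
      using lip[of x ?y] M(2)[OF x_le[OF x] Y(1)[OF x r]] x \<delta>(2)
      by (auto simp: dist_norm norm_minus_commute)
    finally have "cmod (?y - r) * (cmod c * (s / 3) ^ (n - 1)) \<le> C * cmod (x - x1)"
      by (simp add: mult_ac)
    then show "cmod (?y - r) \<le> L * cmod (x - x1)"
      using c_nonzero s(1) by (simp add: L_def field_simps)
  qed
qed

text \<open>
  The derivative of \<open>K\<close> along a branch needs no derivative of the branch because \<open>K\<^sub>y\<close> vanishes there.
\<close>

lemma branch_has_derivative:
  assumes "\<delta> > 0" "L \<ge> 0" "\<And>x. x \<in> ball x1 \<delta> \<Longrightarrow> cmod (y x - r) \<le> L * cmod (x - x1)" "r \<in> roots x1"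
  shows "((\<lambda>x. beval K x (y x)) has_field_derivative beval (dx K) x1 r) (at x1)"
  unfolding has_field_derivative_def has_derivative_at_alt
proof (intro conjI allI impI)
  show "bounded_linear ((*) (beval (dx K) x1 r))" by (rule bounded_linear_mult_right)
  fix e :: real assume "e > 0"
  define e' where "e' = e / (1 + L)"
  have e': "e' > 0" "e' * (1 + L) = e" using \<open>e > 0\<close> assms(2) by (auto simp: e'_def)
  have yr: "y x1 = r" using assms(3)[of x1] assms(1) by simp
  from beval_has_derivative[of K x1 r, unfolded has_derivative_at_alt] e'(1)
  obtain d where d: "d > 0" "\<And>z. norm (z - (x1, r)) < d \<Longrightarrow>
      norm (beval K (fst z) (snd z) - beval K x1 r -
        (beval (dx K) x1 r * fst (z - (x1, r)) + beval (dy K) x1 r * snd (z - (x1, r))))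
      \<le> e' * norm (z - (x1, r))"
    by auto
  have nle: "norm ((x, y x) - (x1, r)) \<le> (1 + L) * cmod (x - x1)" if "x \<in> ball x1 \<delta>" for x
    using norm_Pair_le[of "x - x1" "y x - r"] assms(3)[OF that] by (simp add: algebra_simps)
  show "\<exists>d>0. \<forall>x. norm (x - x1) < d \<longrightarrow>
      norm (beval K x (y x) - beval K x1 (y x1) - beval (dx K) x1 r * (x - x1)) \<le> e * norm (x - x1)"
  proof (intro exI conjI allI impI)
    show "min \<delta> (d / (1 + L)) > 0" using assms(1,2) d(1) by simp
    fix x assume x: "norm (x - x1) < min \<delta> (d / (1 + L))"
    then have xb: "x \<in> ball x1 \<delta>" by (simp add: dist_norm norm_minus_commute)
    have "(1 + L) * cmod (x - x1) < d"
      using x assms(2) by (simp add: field_simps)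
    then have "norm ((x, y x) - (x1, r)) < d" using nle[OF xb] by linarith
    from d(2)[OF this] have "norm (beval K x (y x) - beval K x1 r - beval (dx K) x1 r * (x - x1))
        \<le> e' * norm ((x, y x) - (x1, r))"
      using assms(4) by (simp add: roots_def)
    also have "\<dots> \<le> e' * ((1 + L) * cmod (x - x1))"
      using nle[OF xb] e'(1) by (intro mult_left_mono) auto
    also have "\<dots> = e * norm (x - x1)"
      using e'(2) by (simp add: mult.assoc[symmetric])
    finally show "norm (beval K x (y x) - beval K x1 (y x1) - beval (dx K) x1 r * (x - x1))
        \<le> e * norm (x - x1)"
      by (simp add: yr)
  qed
qed

text \<open>The set of branches picked by \<open>sel\<close> is locally constant, so the product
  over it is single-valued even where monodromy permutes the branches. Its logarithmic derivative is
  the sum of \<open>K_x / K\<close> over the chosen branches, since \<open>K_y\<close> vanishes on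
  them.\<close>

lemma selection_product:
  assumes card: "card (roots x1) = n"
    and loc: "\<And>r. r \<in> roots x1 \<Longrightarrow>
      \<exists>e>0. \<forall>x y. cmod (x - x1) < e \<longrightarrow> cmod (y - r) < e \<longrightarrow> y \<in> roots x \<longrightarrow> sel x y = sel x1 r"
    and nz: "\<And>r. r \<in> roots x1 \<Longrightarrow> sel x1 r \<Longrightarrow> beval K x1 r \<noteq> 0"
  shows "((\<lambda>x. \<Prod>y | y \<in> roots x \<and> sel x y. beval K x y) has_field_derivative
      (\<Prod>y | y \<in> roots x1 \<and> sel x1 y. beval K x1 y) *
      (\<Sum>y | y \<in> roots x1 \<and> sel x1 y. beval (dx K) x1 y / beval K x1 y)) (at x1)" (is ?D)
    and "\<exists>\<epsilon>>0. \<forall>x\<in>ball x1 \<epsilon>. card {y. y \<in> roots x \<and> sel x y} = card {y. y \<in> roots x1 \<and> sel x1 y}"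
      (is ?C)
proof -
  obtain Y L \<delta> where Y: "\<delta> > 0" "L \<ge> 0"
    "\<And>x. x \<in> ball x1 \<delta> \<Longrightarrow> bij_betw (\<lambda>r. Y r x) (roots x1) (roots x)"
    "\<And>x r. x \<in> ball x1 \<delta> \<Longrightarrow> r \<in> roots x1 \<Longrightarrow> cmod (Y r x - r) \<le> L * cmod (x - x1)"
    by (rule roots_matching[OF card], rule that)
  obtain e where e: "\<And>r. r \<in> roots x1 \<Longrightarrow> e r > 0" "\<And>r x y. r \<in> roots x1 \<Longrightarrow>
      cmod (x - x1) < e r \<Longrightarrow> cmod (y - r) < e r \<Longrightarrow> y \<in> roots x \<Longrightarrow> sel x y = sel x1 r"
    using loc by metis
  define e0 where "e0 = Min (e ` roots x1)"
  have e0: "e0 > 0" "\<And>r. r \<in> roots x1 \<Longrightarrow> e0 \<le> e r"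
    unfolding e0_def using e(1) finite_roots[of x1] roots_nonempty[of x1] by auto
  define \<epsilon> where "\<epsilon> = min \<delta> (min e0 (e0 / (1 + L)))"
  have \<epsilon>: "\<epsilon> > 0" "\<epsilon> \<le> \<delta>" "\<epsilon> \<le> e0" "(1 + L) * \<epsilon> \<le> e0"
  proof -
    show "\<epsilon> > 0" using Y(1,2) e0(1) by (simp add: \<epsilon>_def)
    show "\<epsilon> \<le> \<delta>" "\<epsilon> \<le> e0" by (simp_all add: \<epsilon>_def)
    have "\<epsilon> \<le> e0 / (1 + L)" by (simp add: \<epsilon>_def)
    then show "(1 + L) * \<epsilon> \<le> e0" using Y(2) by (simp add: field_simps)
  qed
  let ?A = "{y. y \<in> roots x1 \<and> sel x1 y}"
  have sel: "sel x (Y r x) = sel x1 r" if "x \<in> ball x1 \<epsilon>" "r \<in> roots x1" for x r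
  proof -
    have x: "x \<in> ball x1 \<delta>" "cmod (x - x1) < \<epsilon>"
      using that(1) \<epsilon>(2) by (auto simp: dist_norm norm_minus_commute)
    have "cmod (Y r x - r) \<le> L * cmod (x - x1)" by (rule Y(4)[OF x(1) that(2)])
    also have "\<dots> \<le> L * \<epsilon>" using x(2) Y(2) by (intro mult_left_mono) auto
    also have "\<dots> < (1 + L) * \<epsilon>" using \<epsilon>(1) by (simp add: algebra_simps)
    finally have "cmod (Y r x - r) < e r" using \<epsilon>(4) e0(2)[OF that(2)] by linarith
    moreover have "cmod (x - x1) < e r" using x(2) \<epsilon>(3) e0(2)[OF that(2)] by linarith
    moreover have "Y r x \<in> roots x" using Y(3)[OF x(1)] that(2) by (auto dest: bij_betwE)
    ultimately show ?thesis using e(2)[OF that(2)] by blast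
  qed
  have bij: "bij_betw (\<lambda>r. Y r x) ?A {y. y \<in> roots x \<and> sel x y}" if "x \<in> ball x1 \<epsilon>" for x
  proof -
    have b: "bij_betw (\<lambda>r. Y r x) (roots x1) (roots x)"
      using Y(3)[of x] that \<epsilon>(2) by auto
    have im: "roots x = (\<lambda>r. Y r x) ` roots x1" using b by (simp add: bij_betw_def)
    have "(\<lambda>r. Y r x) ` ?A = {y. y \<in> roots x \<and> sel x y}"
      unfolding im using sel[OF that] by auto
    then show ?thesis using b by (auto simp: bij_betw_def inj_on_def)
  qed
  then have "card {y. y \<in> roots x \<and> sel x y} = card ?A" if "x \<in> ball x1 \<epsilon>" for x
    using bij_betw_same_card that by fastforce
  then show ?C using \<epsilon>(1) by blast
  have Yx1: "Y r x1 = r" if "r \<in> roots x1" for r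
    using Y(4)[of x1 r] that Y(1) by simp
  have "((\<lambda>x. \<Prod>r\<in>?A. beval K x (Y r x)) has_field_derivative
      (\<Prod>r\<in>?A. beval K x1 (Y r x1)) * (\<Sum>r\<in>?A. beval (dx K) x1 r / beval K x1 (Y r x1))) (at x1)"
    using nz Yx1 by (intro has_field_derivative_prod' branch_has_derivative[OF Y(1,2)])
      (auto intro: Y(4))
  moreover have "(\<Prod>r\<in>?A. beval K x1 (Y r x1)) = (\<Prod>y\<in>?A. beval K x1 y)"
    "(\<Sum>r\<in>?A. beval (dx K) x1 r / beval K x1 (Y r x1)) = (\<Sum>y\<in>?A. beval (dx K) x1 y / beval K x1 y)"
    by (auto intro!: prod.cong sum.cong simp: Yx1)
  ultimately have "((\<lambda>x. \<Prod>r\<in>?A. beval K x (Y r x)) has_field_derivative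
      (\<Prod>y\<in>?A. beval K x1 y) * (\<Sum>y\<in>?A. beval (dx K) x1 y / beval K x1 y)) (at x1)"
    by simp
  then show ?D
  proof (rule has_field_derivative_transform_within_open)
    show "open (ball x1 \<epsilon>)" "x1 \<in> ball x1 \<epsilon>" using \<epsilon>(1) by auto
    fix x assume "x \<in> ball x1 \<epsilon>"
    then show "(\<Prod>r\<in>?A. beval K x (Y r x)) = (\<Prod>y | y \<in> roots x \<and> sel x y. beval K x y)"
      using prod.reindex_bij_betw[OF bij, of x "\<lambda>y. beval K x y"] by simp
  qed
qed

end

section \<open>Logarithmic derivatives near a puncture\<close>

text \<open>A bounded logarithmic derivative \<open>g\<close> extends holomorphically over the
  puncture and has a primitive \<open>\<psi>\<close> on the disc, so \<open>f\<close> is a nonzero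
  constant times \<open>exp \<psi>\<close>.\<close>

lemma log_deriv_bounded_imp_bounded_below:
  fixes f g :: "complex \<Rightarrow> complex"
  assumes "r > 0"
    and deriv: "\<And>x. x \<in> ball a r - {a} \<Longrightarrow> (f has_field_derivative f x * g x) (at x)"
    and nz: "\<And>x. x \<in> ball a r - {a} \<Longrightarrow> f x \<noteq> 0"
    and bound: "\<And>x. x \<in> ball a r - {a} \<Longrightarrow> cmod (g x) \<le> B"
  shows "\<exists>m>0. \<forall>x\<in>cball a (r / 2) - {a}. m \<le> cmod (f x)"
proof -
  let ?U = "ball a r - {a}"
  have U: "open ?U" "connected ?U"
    by (auto intro: connected_punctured_ball)
  have f_hol: "f holomorphic_on ?U"
    using deriv U(1) unfolding holomorphic_on_open[OF U(1)] by blast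
  have "(\<lambda>x. deriv f x / f x) holomorphic_on ?U"
    using f_hol U(1) nz by (intro holomorphic_intros holomorphic_deriv) auto
  moreover have "deriv f x / f x = g x" if "x \<in> ?U" for x
    using DERIV_imp_deriv[OF deriv[OF that]] nz[OF that] by simp
  ultimately have g_hol: "g holomorphic_on ?U"
    using holomorphic_transform by blast
  have "\<forall>\<^sub>F x in at a. x \<in> ?U"
    using eventually_at_in_open[of "ball a r" a] \<open>r > 0\<close> by auto
  then have "\<forall>\<^sub>F x in at a. cmod (g x) \<le> B"
    by eventually_elim (rule bound)
  then obtain h where h: "h holomorphic_on ball a r" "\<And>x. x \<in> ?U \<Longrightarrow> h x = g x"
    using holomorphic_on_extend_bounded[OF g_hol] \<open>r > 0\<close> by auto
  obtain \<psi> where "\<And>x. x \<in> ball a r \<Longrightarrow> (\<psi> has_field_derivative h x) (at x within ball a r)"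
    using holomorphic_convex_primitive'[OF convex_ball open_ball h(1)] by metis
  then have \<psi>: "(\<psi> has_field_derivative h x) (at x)" if "x \<in> ball a r" for x
    using that by (metis at_within_open open_ball)
  have "((\<lambda>x. f x * exp (- \<psi> x)) has_field_derivative 0) (at x)" if x: "x \<in> ?U" for x
    by (rule derivative_eq_intros deriv[OF x] \<psi> refl)+ (use x h(2)[OF x] in auto)
  then have deriv0: "\<forall>x\<in>?U - {}. DERIV (\<lambda>x. f x * exp (- \<psi> x)) x :> 0" by blast
  have "continuous_on ?U (\<lambda>x. f x * exp (- \<psi> x))"
    using deriv0 by (intro continuous_at_imp_continuous_on) (auto intro: DERIV_isCont)
  from DERIV_zero_connected_constant[OF U(2,1) finite.emptyI this deriv0]
  obtain C where C: "\<And>x. x \<in> ?U \<Longrightarrow> f x * exp (- \<psi> x) = C" by blast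
  have "a + of_real (r / 2) \<in> ?U" using \<open>r > 0\<close> by (auto simp: dist_norm)
  then have "C \<noteq> 0" using C nz by (metis exp_not_eq_zero mult_eq_0_iff)
  have "continuous_on (cball a (r / 2)) \<psi>"
    using \<open>r > 0\<close> by (intro continuous_at_imp_continuous_on ballI DERIV_isCont[OF \<psi>]) auto
  then have "compact (\<psi> ` cball a (r / 2))"
    by (intro compact_continuous_image) auto
  then obtain M where M: "\<And>x. x \<in> cball a (r / 2) \<Longrightarrow> cmod (\<psi> x) \<le> M"
    using compact_imp_bounded[of "\<psi> ` cball a (r / 2)"] unfolding bounded_iff by blast
  show ?thesis
  proof (intro exI conjI ballI)
    show "cmod C * exp (- M) > 0" using \<open>C \<noteq> 0\<close> by simp
    fix x assume x: "x \<in> cball a (r / 2) - {a}"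
    then have "x \<in> ?U" using \<open>r > 0\<close> by auto
    then have "f x = C * exp (\<psi> x)"
      using C[of x] by (auto simp: exp_minus field_simps)
    then have "cmod (f x) = cmod C * exp (Re (\<psi> x))"
      by (simp add: norm_mult)
    moreover have "- M \<le> Re (\<psi> x)"
      using M[of x] abs_Re_le_cmod[of "\<psi> x"] x by auto
    ultimately show "cmod C * exp (- M) \<le> cmod (f x)"
      by (simp add: mult_left_mono)
  qed
qed

text \<open>Splits off the line \<open>x = a\<close> from the zero set, so that the rest meets this
  line in finitely many points. The induction runs on the degree in \<open>x\<close> along a level
  \<open>z0\<close> on which \<open>Q\<close> is not identically zero.\<close>

lemma extract_linear_power:
  fixes Q :: bipoly
  assumes "Q \<noteq> 0"
  obtains m Q' where "\<And>x z. beval Q x z = (x - a) ^ m * beval Q' x z" "xslice Q' a \<noteq> 0"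
proof -
  have "\<exists>x z. beval Q x z \<noteq> 0"
    using assms beval_eqI[of Q 0] by auto
  then obtain z0 where "poly Q [:z0:] \<noteq> 0"
    unfolding beval_def by (metis poly_0)
  then have "\<exists>m Q'. (\<forall>x z. beval Q x z = (x - a) ^ m * beval Q' x z) \<and> xslice Q' a \<noteq> 0"
  proof (induction "degree (poly Q [:z0:])" arbitrary: Q rule: less_induct)
    case less
    show ?case
    proof (cases "xslice Q a = 0")
      case False
      then show ?thesis by (intro exI[of _ 0] exI[of _ Q]) simp
    next
      case True
      then have Qa: "beval Q a z = 0" for z
        by (metis poly_0 poly_xslice)
      obtain E where "\<And>x z. beval Q x z - beval Q a z = (x - a) * beval E x z"
        using beval_x_difference by metis
      then have E: "beval Q x z = (x - a) * beval E x z" for x z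
        using Qa by simp
      have "poly (poly Q [:z0:]) x = poly ([:- a, 1:] * poly E [:z0:]) x" for x
        using E[of x z0] by (simp add: beval_def algebra_simps)
      then have fac: "poly Q [:z0:] = [:- a, 1:] * poly E [:z0:]"
        by (intro poly_eq_poly_eq_iff[THEN iffD1] ext)
      with less.prems have "poly E [:z0:] \<noteq> 0" by auto
      moreover from this have "degree (poly E [:z0:]) < degree (poly Q [:z0:])"
        unfolding fac by (subst degree_mult_eq) auto
      ultimately obtain m Q' where
        "\<And>x z. beval E x z = (x - a) ^ m * beval Q' x z" "xslice Q' a \<noteq> 0"
        using less.hyps by metis
      then show ?thesis
        using E by (intro exI[of _ "Suc m"] exI[of _ Q']) (simp add: mult.assoc)
    qed
  qed
  then show ?thesis using that by blast
qed

text \<open>Algebraic form of Liouville's theorem: at a root of \<open>D\<close> continuity forces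
  \<open>A\<close> to vanish, so the poles cancel one by one, and a polynomial bounded off a finite
  set is constant.\<close>

lemma poly_bounded_quotient:
  fixes A D :: "complex poly"
  assumes "D \<noteq> 0" "finite X" "\<And>x. x \<notin> X \<Longrightarrow> cmod (poly A x) \<le> B * cmod (poly D x)"
  shows "\<exists>\<gamma>. A = Polynomial.smult \<gamma> D"
  using assms
proof (induction "degree D" arbitrary: A D X)
  case 0
  then obtain d where d: "D = [:d:]" "d \<noteq> 0" by (metis degree_eq_zeroE pCons_0_0)
  have "degree A = 0"
  proof (rule ccontr)
    assume "degree A \<noteq> 0"
    \<comment> \<open>This value exceeds the bound off \<open>X\<close> and every value on
      \<open>X\<close>, yet a nonconstant \<open>A\<close> would attain it.\<close>
    define w where "w = complex_of_real (\<bar>B\<bar> * cmod d + (\<Sum>x\<in>X. cmod (poly A x)) + 1)"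
    have nonneg: "\<bar>B\<bar> * cmod d \<ge> 0" "(\<Sum>x\<in>X. cmod (poly A x)) \<ge> 0"
      by (auto intro: sum_nonneg)
    then have w: "cmod w = \<bar>B\<bar> * cmod d + (\<Sum>x\<in>X. cmod (poly A x)) + 1"
      unfolding w_def norm_of_real by linarith
    have "degree (A - [:w:]) \<noteq> 0"
      using \<open>degree A \<noteq> 0\<close> by (subst diff_conv_add_uminus, subst degree_add_eq_left) auto
    then obtain x where "poly (A - [:w:]) x = 0"
      using Fundamental_Theorem_Algebra.fundamental_theorem_of_algebra[of "A - [:w:]"]
      by (auto simp: constant_degree)
    then have x: "poly A x = w" by simp
    show False
    proof (cases "x \<in> X")
      case True
      then have "cmod (poly A x) \<le> (\<Sum>x\<in>X. cmod (poly A x))"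
        using 0(3) by (intro member_le_sum) auto
      then show False using x w nonneg by simp
    next
      case False
      then have "cmod (poly A x) \<le> B * cmod d"
        using 0(4)[of x] d by simp
      also have "\<dots> \<le> \<bar>B\<bar> * cmod d" by (simp add: mult_right_mono)
      finally show False using x w nonneg by simp
    qed
  qed
  then obtain b where "A = [:b:]" by (rule degree_eq_zeroE)
  then show ?case using d by (intro exI[of _ "b / d"]) simp
next
  case (Suc m)
  obtain r where r: "poly D r = 0"
    using Fundamental_Theorem_Algebra.fundamental_theorem_of_algebra[of D] Suc.hyps(2)
    by (auto simp: constant_degree)
  have "open (- (X - {r}))"
    using Suc.prems(2) by (intro open_Compl finite_imp_closed finite_Diff)
  then have "\<forall>\<^sub>F x in at r. x \<in> - (X - {r}) - {r}"
    by (rule eventually_at_in_open) simp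
  then have "\<forall>\<^sub>F x in at r. cmod (poly A x) \<le> B * cmod (poly D x)"
    by eventually_elim (use Suc.prems(3) in auto)
  moreover have "((\<lambda>x. cmod (poly A x)) \<longlongrightarrow> cmod (poly A r)) (at r)"
    by (intro tendsto_intros)
  moreover have "((\<lambda>x. B * cmod (poly D x)) \<longlongrightarrow> B * cmod (poly D r)) (at r)"
    by (intro tendsto_intros)
  ultimately have "cmod (poly A r) \<le> B * cmod (poly D r)"
    by (intro tendsto_le[of "at r"]) auto
  then have "poly A r = 0" using r by simp
  then obtain A1 where A1: "A = [:- r, 1:] * A1"
    by (auto simp: poly_eq_0_iff_dvd elim: dvdE)
  obtain D1 where D1: "D = [:- r, 1:] * D1"
    using r by (auto simp: poly_eq_0_iff_dvd elim: dvdE)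
  have "D1 \<noteq> 0" using Suc.prems(1) D1 by auto
  then have "degree D = Suc (degree D1)"
    unfolding D1 by (subst degree_mult_eq) auto
  then have deg: "m = degree D1" using Suc.hyps(2) by simp
  have "cmod (poly A1 x) \<le> B * cmod (poly D1 x)" if "x \<notin> insert r X" for x
  proof -
    have "cmod (x - r) * cmod (poly A1 x) \<le> cmod (x - r) * (B * cmod (poly D1 x))"
      using Suc.prems(3)[of x] that
      by (simp only: A1 D1 poly_mult norm_mult) (simp add: mult_ac)
    then show ?thesis using that by (simp add: mult_le_cancel_left)
  qed
  then obtain \<gamma> where "A1 = Polynomial.smult \<gamma> D1"
    using Suc.hyps(1)[OF deg \<open>D1 \<noteq> 0\<close>, of "insert r X" A1] Suc.prems(2) by auto
  then have "A = Polynomial.smult \<gamma> D"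
    unfolding A1 D1 by (simp only: mult_smult_right)
  then show ?case ..
qed

section \<open>Polynomials all of whose critical points lie on one level\<close>

lemma tendsto_shrinking_balls:
  fixes X :: "nat \<Rightarrow> 'a :: metric_space"
  assumes "\<And>k. X k \<in> ball a (1 / Suc k)"
  shows "X \<longlonglongrightarrow> a"
proof (rule metric_LIMSEQ_I)
  fix r :: real assume "r > 0"
  then obtain N where N: "1 / real (Suc N) < r"
    using nat_approx_posE by metis
  have "dist (X k) a < r" if "k \<ge> N" for k
  proof -
    have "1 / real (Suc k) \<le> 1 / real (Suc N)"
      using that by (intro divide_left_mono) auto
    then show ?thesis using assms[of k] N by (simp add: dist_commute)
  qed
  then show "\<exists>N. \<forall>k\<ge>N. dist (X k) a < r" by blast
qed

lemma open_pair_nbhd: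
  fixes S :: "(complex \<times> complex) set"
  assumes "open S" "(a, b) \<in> S"
  shows "\<exists>e>0. \<forall>x y. cmod (x - a) < e \<longrightarrow> cmod (y - b) < e \<longrightarrow> (x, y) \<in> S"
proof -
  obtain e where e: "e > 0" "ball (a, b) e \<subseteq> S"
    using assms openE by blast
  have "(x, y) \<in> S" if "cmod (x - a) < e / 2" "cmod (y - b) < e / 2" for x y
  proof -
    have "norm ((x, y) - (a, b)) < e"
      using norm_Pair_le[of "x - a" "y - b"] that by simp
    then have "dist (a, b) (x, y) < e"
      by (subst dist_commute) (simp only: dist_norm)
    then show ?thesis using e(2) by auto
  qed
  then show ?thesis using e(1) by (intro exI[of _ "e / 2"]) auto
qed

section \<open>Norms from the polar curve and finiteness of the exceptional fibres\<close>

context polar_curve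
begin

lemma norm_exists:
  "\<exists>Q. \<forall>x z.
     (card (roots x) = n \<longrightarrow> beval Q x z = (\<Prod>y\<in>roots x. (z * beval F x y - beval G x y))) \<and>
     (beval Q x z = 0 \<longleftrightarrow> (\<exists>y\<in>roots x. z * beval F x y = beval G x y))"
proof (rule bipoly_norm_exists[OF lead_coeff_dy c_nonzero degree_dy n_pos, of F G])
  fix Q :: bipoly
  assume prod: "\<And>x z. card {y. beval (dy K) x y = 0} = n \<Longrightarrow>
      beval Q x z = (\<Prod>y | beval (dy K) x y = 0. (z * beval F x y - beval G x y))"
    and zero: "\<And>x z. beval Q x z = 0 \<longleftrightarrow>
      (\<exists>y. beval (dy K) x y = 0 \<and> z * beval F x y = beval G x y)"
  show ?thesis
    unfolding roots_def Bex_def mem_Collect_eq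
    by (intro exI[of _ Q] allI conjI impI zero prod)
qed

lemma norm_poly_exists:
  "\<exists>N :: complex poly. \<forall>x.
     (card (roots x) = n \<longrightarrow> poly N x = (\<Prod>y\<in>roots x. beval F x y)) \<and>
     (poly N x = 0 \<longleftrightarrow> (\<exists>y\<in>roots x. beval F x y = 0))"
proof -
  \<comment> \<open>With 0 in place of \<open>F\<close> and \<open>- F\<close> in place of
    \<open>G\<close> each factor \<open>z * 0 - (- F)\<close> is \<open>F\<close>, whatever
    \<open>z\<close>.\<close>
  obtain Q where Q: "\<And>x z. card (roots x) = n \<Longrightarrow>
      beval Q x z = (\<Prod>y\<in>roots x. (z * beval 0 x y - beval (- F) x y))"
    "\<And>x z. beval Q x z = 0 \<longleftrightarrow> (\<exists>y\<in>roots x. z * beval 0 x y = beval (- F) x y)"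
    using norm_exists[of 0 "- F"] by blast
  show ?thesis
    using Q[of _ 0] by (intro exI[of _ "poly Q [:0:]"]) (simp add: beval_def)
qed

definition exceptional :: "complex set" where
  "exceptional = {x. card (roots x) \<noteq> n \<or> (\<exists>y\<in>roots x. beval (dx K) x y = 0)}"

text \<open>The norm of \<open>K_yy\<close> plays the part of the discriminant: it vanishes over
  each \<open>x\<close> with a multiple root, and one unramified fibre shows that it is not
  identically zero.\<close>

lemma finite_card_roots_neq:
  assumes "card (roots a) = n"
  shows "finite {x. card (roots x) \<noteq> n}"
proof -
  obtain N where N: "\<And>x. poly N x = 0 \<longleftrightarrow> (\<exists>y\<in>roots x. beval (dy (dy K)) x y = 0)"
    using norm_poly_exists[of "dy (dy K)"] by blast
  have "beval (dy (dy K)) a y \<noteq> 0" if "y \<in> roots a" for y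
    using poly_pderiv_root_neq_0[OF slice_nonzero, of a y] assms that
    by (simp add: roots_eq degree_slice flip: xslice_dy)
  then have "poly N a \<noteq> 0" using N by blast
  then have "finite {x. poly N x = 0}" by (intro poly_roots_finite) auto
  moreover have "card (roots x) = n" if "poly N x \<noteq> 0" for x
  proof -
    have "poly (pderiv (xslice (dy K) x)) y \<noteq> 0" if "poly (xslice (dy K) x) y = 0" for y
      using N[of x] \<open>poly N x \<noteq> 0\<close> that by (auto simp: roots_def simp flip: xslice_dy)
    then show ?thesis
      using card_roots_eq_degree[OF slice_nonzero, of x] by (simp add: roots_eq degree_slice)
  qed
  then have "{x. card (roots x) \<noteq> n} \<subseteq> {x. poly N x = 0}" by blast
  ultimately show ?thesis by (rule rev_finite_subset)
qed

lemma finite_exceptional: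
  assumes "card (roots a) = n" "\<And>y. y \<in> roots b \<Longrightarrow> beval (dx K) b y \<noteq> 0"
  shows "finite exceptional"
proof -
  obtain N where N: "\<And>x. poly N x = 0 \<longleftrightarrow> (\<exists>y\<in>roots x. beval (dx K) x y = 0)"
    using norm_poly_exists[of "dx K"] by blast
  then have "poly N b \<noteq> 0" using assms(2) by blast
  then have "finite {x. poly N x = 0}" by (intro poly_roots_finite) auto
  then have "finite ({x. card (roots x) \<noteq> n} \<union> {x. poly N x = 0})"
    using finite_card_roots_neq[OF assms(1)] by simp
  then show ?thesis
    by (rule rev_finite_subset) (auto simp: exceptional_def N)
qed

end

text \<open>\<open>critical_level\<close> puts all critical points on the zero level.
  \<open>at_infinity\<close> says that \<open>(n + 1) K / K_x - x\<close> is bounded far out, which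
  is what remains of Euler's identity in the presence of lower terms.\<close>

locale nilpotent_polar_curve = polar_curve +
  assumes critical_level: "beval (dx K) x y = 0 \<Longrightarrow> beval (dy K) x y = 0 \<Longrightarrow> beval K x y = 0"
    and at_infinity: "\<exists>B R. \<forall>x y. R \<le> cmod x \<longrightarrow> y \<in> roots x \<longrightarrow> beval (dx K) x y \<noteq> 0 \<and>
      cmod (of_nat (n + 1) * beval K x y - x * beval (dx K) x y) \<le> B * cmod (beval (dx K) x y)"
    and generic_roots: "\<exists>x. card (roots x) = n"
begin

lemma finite_exc: "finite exceptional"
proof -
  obtain R where R: "\<And>x y. R \<le> cmod x \<Longrightarrow> y \<in> roots x \<Longrightarrow> beval (dx K) x y \<noteq> 0"
    using at_infinity by blast
  obtain a where "card (roots a) = n" using generic_roots ..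
  moreover have "beval (dx K) (of_real \<bar>R\<bar>) y \<noteq> 0" if "y \<in> roots (of_real \<bar>R\<bar>)" for y
    by (rule R[OF _ that]) simp
  ultimately show ?thesis by (rule finite_exceptional)
qed

lemma not_exceptionalD:
  "x \<notin> exceptional \<Longrightarrow> card (roots x) = n"
  "x \<notin> exceptional \<Longrightarrow> y \<in> roots x \<Longrightarrow> beval (dx K) x y \<noteq> 0"
  by (auto simp: exceptional_def)

lemma punctured_ball_avoiding_exceptional:
  "\<exists>e>0. ball a e - {a} \<subseteq> - exceptional"
proof -
  have "open (- (exceptional - {a}))"
    using finite_exc by (intro open_Compl finite_imp_closed finite_Diff)
  then obtain e where "e > 0" "ball a e \<subseteq> - (exceptional - {a})"
    by (metis ComplI Diff_iff insertI1 openE)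
  then show ?thesis by (intro exI[of _ e]) auto
qed

text \<open>
  Let \<open>P\<close> stand for \<open>K / K\<^sub>x\<close>. A branch on which \<open>P\<close> is unbounded would have \<open>|P| > R\<close> throughout,
  so the logarithmic derivative \<open>1 / P\<close> of \<open>K\<close> along it is bounded and \<open>K\<close> cannot tend to its value
  \<open>0\<close> at the critical point which such a branch must reach.
\<close>

lemma quotient_locally_bounded_punctured:
  "\<exists>B e. e > 0 \<and> (\<forall>x y. x \<in> ball a e - {a} \<longrightarrow> y \<in> roots x \<longrightarrow>
     cmod (beval K x y) \<le> B * cmod (beval (dx K) x y))"
proof (rule ccontr)
  assume "\<not> ?thesis"
  then have neg: "\<exists>x y. x \<in> ball a e - {a} \<and> y \<in> roots x \<and>
      B * cmod (beval (dx K) x y) < cmod (beval K x y)" if "e > 0" for B e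
    using that by (meson not_le)
  obtain e0 where e0: "e0 > 0" "ball a e0 - {a} \<subseteq> - exceptional"
    using punctured_ball_avoiding_exceptional by blast
  obtain Q where Q: "\<And>x z. beval Q x z = 0 \<longleftrightarrow> (\<exists>y\<in>roots x. z * beval (dx K) x y = beval K x y)"
    using norm_exists[of "dx K" K] by blast
  \<comment> \<open>Over one regular fibre the zeros \<open>z\<close> of \<open>Q\<close> are the
    finitely many values of \<open>K / K_x\<close>.\<close>
  have "Q \<noteq> 0"
  proof
    assume "Q = 0"
    define b where "b = a + of_real (e0 / 2)"
    have "b \<in> ball a e0 - {a}" using e0(1) by (auto simp: b_def dist_norm)
    then have b: "beval (dx K) b y \<noteq> 0" if "y \<in> roots b" for y
      using e0(2) not_exceptionalD(2) that by blast
    have "z \<in> (\<lambda>y. beval K b y / beval (dx K) b y) ` roots b" for z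
    proof -
      obtain y where "y \<in> roots b" "z * beval (dx K) b y = beval K b y"
        using Q[of b z] \<open>Q = 0\<close> by auto
      then show ?thesis using b[of y] by (intro image_eqI[of _ _ y]) (auto simp: field_simps)
    qed
    then have "finite (UNIV :: complex set)"
      using finite_roots[of b] by (metis finite_imageI finite_subset subsetI)
    then show False using infinite_UNIV_char_0 by blast
  qed
  then obtain m Q' where Q': "\<And>x z. beval Q x z = (x - a) ^ m * beval Q' x z" "xslice Q' a \<noteq> 0"
    using extract_linear_power by blast
  define Z where "Z = {z. poly (xslice Q' a) z = 0}"
  have finZ: "finite Z" unfolding Z_def using Q'(2) by (rule poly_roots_finite)
  \<comment> \<open>\<open>R\<close> exceeds the modulus of every zero of \<open>Q'\<close> over
    \<open>a\<close>. By compactness of the circle the zeros over nearby \<open>x\<close> avoid the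
    modulus \<open>R\<close> as well, so no branch can cross it and the choice of the branches with
    \<open>K / K_x\<close> beyond \<open>R\<close> is locally constant.\<close>
  define R where "R = 1 + (\<Sum>z\<in>Z. cmod z)"
  have R: "R > 0" unfolding R_def by (intro add_pos_nonneg sum_nonneg) auto
  have RZ: "beval Q' a z \<noteq> 0" if "cmod z = R" for z
  proof
    assume "beval Q' a z = 0"
    then have "cmod z \<le> (\<Sum>z\<in>Z. cmod z)"
      using finZ by (intro member_le_sum) (auto simp: Z_def)
    then show False using that by (simp add: R_def)
  qed
  have "\<exists>e>0. \<forall>x z. x \<in> ball a e \<longrightarrow> cmod z = R \<longrightarrow> beval Q' x z \<noteq> 0"
  proof (rule ccontr)
    assume "\<not> ?thesis"
    then have "\<exists>x z. x \<in> ball a (1 / Suc k) \<and> cmod z = R \<and> beval Q' x z = 0" for k :: nat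
      by (meson of_nat_0_less_iff zero_less_Suc zero_less_divide_1_iff)
    then obtain X V where XV: "\<And>k. X k \<in> ball a (1 / Suc k)" "\<And>k. V k \<in> sphere 0 R"
        "\<And>k. beval Q' (X k) (V k) = 0"
      by (simp add: sphere_def dist_norm) metis
    obtain z r where r: "z \<in> sphere 0 R" "strict_mono (r :: nat \<Rightarrow> nat)" "(V \<circ> r) \<longlonglongrightarrow> z"
      using compact_sphere[of "0 :: complex" R] XV(2) unfolding compact_def by meson
    have "(\<lambda>k. beval Q' ((X \<circ> r) k) ((V \<circ> r) k)) \<longlonglongrightarrow> beval Q' a z"
      using LIMSEQ_subseq_LIMSEQ[OF tendsto_shrinking_balls[OF XV(1)] r(2)] r(3)
      by (intro tendsto_beval)
    then have "beval Q' a z = 0" using XV(3) by (simp add: LIMSEQ_const_iff)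
    then show False using RZ[of z] r(1) by simp
  qed
  then obtain e1 where e1: "e1 > 0" "\<And>x z. x \<in> ball a e1 \<Longrightarrow> cmod z = R \<Longrightarrow> beval Q' x z \<noteq> 0"
    by blast
  define e where "e = min e0 e1"
  have e: "e > 0" using e0(1) e1(1) by (simp add: e_def)
  have regular: "card (roots x) = n" "y \<in> roots x \<Longrightarrow> beval (dx K) x y \<noteq> 0"
    if "x \<in> ball a e - {a}" for x y
    using that e0(2) not_exceptionalD by (auto simp: e_def subset_iff)
  have gap: "cmod (beval K x y) \<noteq> R * cmod (beval (dx K) x y)"
    if x: "x \<in> ball a e - {a}" and y: "y \<in> roots x" for x y
  proof
    assume eq: "cmod (beval K x y) = R * cmod (beval (dx K) x y)"
    define z where "z = beval K x y / beval (dx K) x y"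
    have "cmod z = R"
      using eq regular(2)[OF x y] by (simp add: z_def norm_divide)
    moreover have "z * beval (dx K) x y = beval K x y"
      using regular(2)[OF x y] by (simp add: z_def)
    then have "beval Q x z = 0" using Q y by blast
    then have "beval Q' x z = 0" using Q'(1) x by auto
    ultimately show False using e1(2)[of x z] x by (auto simp: e_def)
  qed
  define sel where "sel x y \<longleftrightarrow> R * cmod (beval (dx K) x y) < cmod (beval K x y)" for x y
  define \<Lambda> where "\<Lambda> x = (\<Prod>y | y \<in> roots x \<and> sel x y. beval K x y)" for x
  define g where "g x = (\<Sum>y | y \<in> roots x \<and> sel x y. beval (dx K) x y / beval K x y)" for x
  have K_nz: "beval K x y \<noteq> 0" if "sel x y" for x y
  proof
    assume "beval K x y = 0"
    then have "R * cmod (beval (dx K) x y) < 0" using that by (simp add: sel_def)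
    then show False using R by (simp add: mult_less_0_iff)
  qed
  have loc: "\<exists>e'>0. \<forall>x y. cmod (x - x1) < e' \<longrightarrow> cmod (y - r) < e' \<longrightarrow> y \<in> roots x \<longrightarrow> sel x y = sel x1 r"
    if x1: "x1 \<in> ball a e - {a}" and r: "r \<in> roots x1" for x1 r
  proof -
    let ?f = "\<lambda>z. R * cmod (beval (dx K) (fst z) (snd z))"
    let ?g = "\<lambda>z. cmod (beval K (fst z) (snd z))"
    have op: "open {z. ?f z < ?g z}" "open {z. ?g z < ?f z}"
      by (intro open_Collect_less continuous_intros)+
    consider "?f (x1, r) < ?g (x1, r)" | "?g (x1, r) < ?f (x1, r)"
      using gap[OF x1 r] by fastforce
    then show ?thesis
    proof cases
      case 1
      then show ?thesis
        using open_pair_nbhd[OF op(1), of x1 r] by (fastforce simp: sel_def)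
    next
      case 2
      then show ?thesis
        using open_pair_nbhd[OF op(2), of x1 r] by (fastforce simp: sel_def)
    qed
  qed
  have "\<exists>m>0. \<forall>x\<in>cball a (e / 2) - {a}. m \<le> cmod (\<Lambda> x)"
  proof (rule log_deriv_bounded_imp_bounded_below[OF e])
    fix x assume x: "x \<in> ball a e - {a}"
    show "(\<Lambda> has_field_derivative \<Lambda> x * g x) (at x)"
      unfolding \<Lambda>_def g_def
      by (rule selection_product(1)[OF regular(1)[OF x] loc[OF x] K_nz])
    show "\<Lambda> x \<noteq> 0"
      using finite_roots[of x] K_nz by (auto simp: \<Lambda>_def)
    have "cmod (g x) \<le> (\<Sum>y | y \<in> roots x \<and> sel x y. 1 / R)"
      unfolding g_def
    proof (intro order_trans[OF norm_sum] sum_mono)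
      fix y assume "y \<in> {y. y \<in> roots x \<and> sel x y}"
      then show "cmod (beval (dx K) x y / beval K x y) \<le> 1 / R"
        using K_nz[of x y] R by (auto simp: norm_divide divide_simps sel_def mult.commute)
    qed
    also have "\<dots> = of_nat (card {y. y \<in> roots x \<and> sel x y}) / R" by simp
    also have "\<dots> \<le> of_nat n / R"
      using R card_mono[OF finite_roots, of "{y. y \<in> roots x \<and> sel x y}" x] regular(1)[OF x]
      by (intro divide_right_mono) auto
    finally show "cmod (g x) \<le> of_nat n / R" .
  qed
  then obtain m0 where m0: "m0 > 0" "\<And>x. x \<in> cball a (e / 2) - {a} \<Longrightarrow> m0 \<le> cmod (\<Lambda> x)"
    by blast
  obtain M1 where M1: "M1 > 0" "\<And>x y. cmod x \<le> cmod a + e \<Longrightarrow> y \<in> roots x \<Longrightarrow> cmod y \<le> M1"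
    using roots_bounded by metis
  obtain M2 where M2: "M2 > 0" "\<And>x y. x \<in> cball a e \<Longrightarrow> y \<in> cball 0 M1 \<Longrightarrow> cmod (beval K x y) \<le> M2"
    using beval_bounded_compact[of "cball a e" "cball 0 M1" K] by auto
  define M where "M = max 1 M2"
  have KM: "cmod (beval K x y) \<le> M" if "x \<in> ball a e" "y \<in> roots x" for x y
  proof -
    have "cmod x \<le> cmod a + e"
      using that(1) norm_triangle_ineq2[of x a] by (simp add: dist_norm norm_minus_commute)
    then show ?thesis using M1(2)[of x y] M2(2)[of x y] that by (simp add: M_def)
  qed
  have low: "m0 \<le> cmod (beval K x y) * M ^ n"
    if x: "x \<in> ball a (e / 2) - {a}" and y: "y \<in> roots x" "sel x y" for x y
  proof -
    let ?A = "{y. y \<in> roots x \<and> sel x y}"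
    have xe: "x \<in> ball a e" using x e by auto
    have "m0 \<le> cmod (\<Lambda> x)" using x by (intro m0(2)) auto
    also have "\<dots> = cmod (beval K x y) * (\<Prod>b\<in>?A - {y}. cmod (beval K x b))"
      unfolding \<Lambda>_def prod_norm[symmetric] using y finite_roots[of x]
      by (subst prod.remove[of _ y]) auto
    also have "(\<Prod>b\<in>?A - {y}. cmod (beval K x b)) \<le> (\<Prod>b\<in>?A - {y}. M)"
      using KM[OF xe] by (intro prod_mono) auto
    also have "\<dots> = M ^ card (?A - {y})" by simp
    also have "\<dots> \<le> M ^ n"
    proof (rule power_increasing)
      have "card (?A - {y}) \<le> card (roots x)"
        by (intro card_mono finite_roots) auto
      then show "card (?A - {y}) \<le> n" using card_roots_le[of x] by simp
    qed (simp add: M_def)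
    finally show ?thesis by (simp add: mult_left_mono)
  qed
  \<comment> \<open>Along this sequence the quotients grow without bound while \<open>K\<close>
    stays bounded, so \<open>K_x\<close> tends to 0 and the limit is a critical point.\<close>
  have "\<exists>x y. x \<in> ball a (min (e / 2) (1 / Suc k)) - {a} \<and> y \<in> roots x \<and>
      (R + k) * cmod (beval (dx K) x y) < cmod (beval K x y)" for k :: nat
    by (rule neg) (use e in auto)
  then obtain X Y where XY: "\<And>k. X k \<in> ball a (min (e / 2) (1 / Suc k)) - {a}"
      "\<And>k. Y k \<in> roots (X k)"
      "\<And>k. (R + real k) * cmod (beval (dx K) (X k) (Y k)) < cmod (beval K (X k) (Y k))"
    by metis
  have Xa: "X \<longlonglongrightarrow> a"
    using XY(1) by (intro tendsto_shrinking_balls) auto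
  obtain r b where r: "strict_mono (r :: nat \<Rightarrow> nat)" "(Y \<circ> r) \<longlonglongrightarrow> b" "b \<in> roots a"
    using roots_limit[OF Xa XY(2)] .
  have lim: "(\<lambda>k. beval F ((X \<circ> r) k) ((Y \<circ> r) k)) \<longlonglongrightarrow> beval F a b" for F
    using LIMSEQ_subseq_LIMSEQ[OF Xa r(1)] r(2) by (intro tendsto_beval)
  have "(\<lambda>k. beval (dx K) ((X \<circ> r) k) ((Y \<circ> r) k)) \<longlonglongrightarrow> 0"
  proof (rule Lim_null_comparison)
    show "(\<lambda>k. M / real k) \<longlonglongrightarrow> 0" by (rule lim_const_over_n)
    show "\<forall>\<^sub>F k in sequentially. cmod (beval (dx K) ((X \<circ> r) k) ((Y \<circ> r) k)) \<le> M / real k"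
      using eventually_gt_at_top[of 0]
    proof eventually_elim
      case (elim k)
      let ?x = "X (r k)" and ?y = "Y (r k)"
      have "real k * cmod (beval (dx K) ?x ?y) \<le> (R + real (r k)) * cmod (beval (dx K) ?x ?y)"
        using R seq_suble[OF r(1), of k] by (intro mult_right_mono) auto
      also have "\<dots> \<le> cmod (beval K ?x ?y)" using XY(3)[of "r k"] by simp
      also have "\<dots> \<le> M" using XY(1)[of "r k"] e by (intro KM XY(2)) auto
      finally show ?case using elim by (simp add: field_simps)
    qed
  qed
  then have "beval (dx K) a b = 0" using lim LIMSEQ_unique by blast
  then have Kab: "beval K a b = 0" using r(3) by (intro critical_level) (auto simp: roots_def)
  have "m0 \<le> cmod (beval K ((X \<circ> r) k) ((Y \<circ> r) k)) * M ^ n" for k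
  proof -
    have "R * cmod (beval (dx K) (X (r k)) (Y (r k))) \<le>
        (R + real (r k)) * cmod (beval (dx K) (X (r k)) (Y (r k)))"
      by (intro mult_right_mono) auto
    then have "sel (X (r k)) (Y (r k))"
      unfolding sel_def using XY(3)[of "r k"] by linarith
    then show ?thesis using low[of "X (r k)" "Y (r k)"] XY(1)[of "r k"] XY(2)[of "r k"] by auto
  qed
  moreover have "(\<lambda>k. cmod (beval K ((X \<circ> r) k) ((Y \<circ> r) k)) * M ^ n) \<longlonglongrightarrow> cmod (beval K a b) * M ^ n"
    by (intro tendsto_intros lim)
  ultimately have "m0 \<le> cmod (beval K a b) * M ^ n"
    by (intro LIMSEQ_le_const) auto
  then show False using m0(1) Kab by simp
qed

end

lemma tendsto_from_power_bound:
  fixes u v :: "nat \<Rightarrow> complex"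
  assumes "C > 0" "n > 0" and bound: "\<And>k. C * cmod (u k - v k) ^ n \<le> cmod (g k)"
    and g: "g \<longlonglongrightarrow> (0 :: complex)" and u: "u \<longlonglongrightarrow> a"
  shows "v \<longlonglongrightarrow> a"
proof -
  have "(\<lambda>k. cmod (g k) / C) \<longlonglongrightarrow> cmod 0 / C"
    using assms(1) by (intro tendsto_intros g) simp
  then have lim: "(\<lambda>k. cmod (g k) / C) \<longlonglongrightarrow> 0" by simp
  have le: "norm (cmod (u k - v k) ^ n) \<le> cmod (g k) / C" for k
    using bound[of k] assms(1) by (simp add: field_simps)
  have "(\<lambda>k. cmod (u k - v k) ^ n) \<longlonglongrightarrow> 0"
    by (rule Lim_null_comparison[OF always_eventually[OF allI[OF le]] lim])
  then have "(\<lambda>k. u k - v k) \<longlonglongrightarrow> 0"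
    using assms(2) by (simp add: tendsto_norm_zero_iff)
  from tendsto_diff[OF u this] show ?thesis by simp
qed

text \<open>The projection to \<open>x\<close> is open. Identities on regular fibres therefore pass
  to points over exceptional ones.\<close>

lemma (in polar_curve) roots_approach:
  assumes "X \<longlonglongrightarrow> x0" "y0 \<in> roots x0"
  obtains Y where "\<And>k. Y k \<in> roots (X k)" "Y \<longlonglongrightarrow> y0"
proof -
  have "\<exists>r. r \<in> roots (X k) \<and> cmod c * cmod (y0 - r) ^ n \<le> cmod (beval (dy K) (X k) y0)" for k
    using root_near[of "X k" y0] by blast
  then obtain Y where Y: "\<And>k. Y k \<in> roots (X k)"
      "\<And>k. cmod c * cmod (y0 - Y k) ^ n \<le> cmod (beval (dy K) (X k) y0)"
    by metis
  have "(\<lambda>k. beval (dy K) (X k) y0) \<longlonglongrightarrow> beval (dy K) x0 y0"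
    using assms(1) by (intro tendsto_intros)
  then have "(\<lambda>k. beval (dy K) (X k) y0) \<longlonglongrightarrow> 0"
    using assms(2) by (simp add: roots_def)
  from tendsto_from_power_bound[OF _ n_pos Y(2) this tendsto_const] have "Y \<longlonglongrightarrow> y0"
    using c_nonzero by simp
  with Y(1) show ?thesis by (rule that)
qed

lemma ex_sequence_avoiding_finite:
  fixes a :: complex
  assumes "\<And>k :: nat. finite (S k)"
  obtains X where "X \<longlonglongrightarrow> a" "\<And>k. X k \<notin> S k"
proof -
  have "\<exists>x. x \<in> ball a (1 / Suc k) - S k" for k
  proof -
    have "\<not> finite (ball a (1 / Suc k))"
      using uncountable_ball[of "1 / Suc k" a] countable_finite by auto
    then have "\<not> ball a (1 / Suc k) \<subseteq> S k"
      using assms[of k] finite_subset by blast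
    then show ?thesis by blast
  qed
  then obtain X where "\<And>k. X k \<in> ball a (1 / Suc k) - S k" by metis
  then show ?thesis using tendsto_shrinking_balls[of X a] that by blast
qed

context nilpotent_polar_curve
begin

text \<open>On the curve \<open>E / K_x\<close> is \<open>n + 1\<close> times
  \<open>K / K_x - x / (n + 1)\<close>, the quantity to be shown constant along branches; without
  the denominator it is a polynomial.\<close>

definition E :: bipoly where
  "E = bconst (of_nat (n + 1)) * K - bX * dx K"

lemma beval_E: "beval E x y = of_nat (n + 1) * beval K x y - x * beval (dx K) x y"
  by (simp add: E_def)

text \<open>Points violating the bound with larger and larger factors would accumulate at a finite
  \<open>a\<close> by \<open>at_infinity\<close>. Near \<open>a\<close> the estimate of
  \<open>K / K_x\<close> applies over the punctured disc, and over \<open>a\<close> itself there are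
  finitely many values to dominate.\<close>

lemma level_bounded:
  "\<exists>B. \<forall>x y. x \<notin> exceptional \<longrightarrow> y \<in> roots x \<longrightarrow> cmod (beval E x y) \<le> B * cmod (beval (dx K) x y)"
proof (rule ccontr)
  assume "\<not> ?thesis"
  then have "\<exists>x y. x \<notin> exceptional \<and> y \<in> roots x \<and>
      real k * cmod (beval (dx K) x y) < cmod (beval E x y)" for k :: nat
    by (meson not_le)
  then obtain X Y where XY: "\<And>k. X k \<notin> exceptional" "\<And>k. Y k \<in> roots (X k)"
      "\<And>k. real k * cmod (beval (dx K) (X k) (Y k)) < cmod (beval E (X k) (Y k))"
    by metis
  have bad: False if "cmod (beval E (X k) (Y k)) \<le> B * cmod (beval (dx K) (X k) (Y k))" "B \<le>
      real k" for k B
  proof -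
    have "B * cmod (beval (dx K) (X k) (Y k)) \<le> real k * cmod (beval (dx K) (X k) (Y k))"
      using that(2) by (intro mult_right_mono) auto
    then show False using that(1) XY(3)[of k] by linarith
  qed
  obtain B0 R where R: "\<And>x y. R \<le> cmod x \<Longrightarrow> y \<in> roots x \<Longrightarrow>
      cmod (beval E x y) \<le> B0 * cmod (beval (dx K) x y)"
    using at_infinity unfolding beval_E by blast
  obtain k0 :: nat where k0: "B0 \<le> real k0" using real_arch_simple by blast
  have "X (k + k0) \<in> cball 0 R" for k
  proof (rule ccontr)
    assume "X (k + k0) \<notin> cball 0 R"
    then have "R \<le> cmod (X (k + k0))" by simp
    from R[OF this XY(2)] show False by (rule bad) (use k0 in simp)
  qed
  then obtain a r where r: "strict_mono (r :: nat \<Rightarrow> nat)" "((\<lambda>k. X (k + k0)) \<circ> r) \<longlonglongrightarrow> a"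
    using compact_cball[of "0 :: complex" R] unfolding compact_def by meson
  obtain B e where e: "e > 0" and B: "\<And>x y. x \<in> ball a e - {a} \<Longrightarrow> y \<in> roots x \<Longrightarrow>
     cmod (beval K x y) \<le> B * cmod (beval (dx K) x y)"
    using quotient_locally_bounded_punctured[of a] by blast
  define B1 where "B1 = of_nat (n + 1) * B + (cmod a + e)"
  have B1: "cmod (beval E x y) \<le> B1 * cmod (beval (dx K) x y)"
    if x: "x \<in> ball a e - {a}" and y: "y \<in> roots x" for x y
  proof -
    have "cmod (beval E x y) \<le> of_nat (n + 1) * cmod (beval K x y) + cmod x * cmod (beval (dx K) x
        y)"
      unfolding beval_E by (metis norm_mult norm_of_nat norm_triangle_ineq4)
    also have "\<dots> \<le> of_nat (n + 1) * (B * cmod (beval (dx K) x y)) + (cmod a + e) * cmod (beval (dx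
        K) x y)"
    proof (intro add_mono mult_left_mono mult_right_mono B x y)
      show "cmod x \<le> cmod a + e"
        using x norm_triangle_ineq2[of x a] by (simp add: dist_norm norm_minus_commute)
    qed auto
    finally show ?thesis by (simp add: B1_def algebra_simps)
  qed
  define B2 where "B2 = (\<Sum>y\<in>roots a. cmod (beval E a y) / cmod (beval (dx K) a y))"
  have B2: "cmod (beval E a y) \<le> B2 * cmod (beval (dx K) a y)" if "a \<notin> exceptional" "y \<in> roots a"
      for y
  proof -
    have "cmod (beval E a y) / cmod (beval (dx K) a y) \<le> B2"
      unfolding B2_def using that(2) finite_roots by (intro member_le_sum) auto
    then show ?thesis
      using not_exceptionalD(2)[OF that] by (simp add: field_simps)
  qed
  have "\<forall>\<^sub>F k in sequentially. X (r k + k0) \<in> ball a e"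
    using topological_tendstoD[OF r(2) open_ball, of a e] e by (simp add: o_def)
  moreover have "\<forall>\<^sub>F k in sequentially. max B1 B2 \<le> real k"
    using eventually_ge_at_top[of "nat \<lceil>max B1 B2\<rceil>"] by eventually_elim linarith
  ultimately have "\<forall>\<^sub>F k :: nat in sequentially. False"
  proof eventually_elim
    case (elim k)
    let ?k = "r k + k0"
    have k: "max B1 B2 \<le> real ?k" using elim(2) seq_suble[OF r(1), of k] by linarith
    show False
    proof (cases "X ?k = a")
      case True
      then show False
        using bad[of ?k B2] B2[of "Y ?k"] XY(1)[of ?k] XY(2)[of ?k] k by auto
    next
      case False
      then show False
        using bad[of ?k B1] B1[of "X ?k" "Y ?k"] XY(2)[of ?k] k elim(1) by auto
    qed
  qed
  then show False by simp
qed

text \<open>For fixed \<open>z\<close> the norm of \<open>z K_x - E\<close> is a polynomial in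
  \<open>x\<close> bounded by a multiple of the norm of \<open>K_x\<close>, hence a constant times
  it. If the level \<open>z\<close> occurs over \<open>x1\<close>, this constant is 0 and the level
  occurs everywhere.\<close>

lemma level_set_constant:
  assumes "x1 \<notin> exceptional" "x2 \<notin> exceptional"
    and "\<exists>y\<in>roots x1. beval E x1 y = z * beval (dx K) x1 y"
  shows "\<exists>y\<in>roots x2. beval E x2 y = z * beval (dx K) x2 y"
proof -
  obtain B where B: "\<And>x y. x \<notin> exceptional \<Longrightarrow> y \<in> roots x \<Longrightarrow>
      cmod (beval E x y) \<le> B * cmod (beval (dx K) x y)"
    using level_bounded by blast
  obtain Q where Q: "\<And>x z. card (roots x) = n \<Longrightarrow>
      beval Q x z = (\<Prod>y\<in>roots x. (z * beval (dx K) x y - beval E x y))"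
    "\<And>x z. beval Q x z = 0 \<longleftrightarrow> (\<exists>y\<in>roots x. z * beval (dx K) x y = beval E x y)"
    using norm_exists[of "dx K" E] by blast
  obtain N where N: "\<And>x. card (roots x) = n \<Longrightarrow> poly N x = (\<Prod>y\<in>roots x. beval (dx K) x y)"
    "\<And>x. poly N x = 0 \<longleftrightarrow> (\<exists>y\<in>roots x. beval (dx K) x y = 0)"
    using norm_poly_exists[of "dx K"] by blast
  have N_nz: "poly N x \<noteq> 0" if "x \<notin> exceptional" for x
    using N(2) not_exceptionalD(2)[OF that] by blast
  have "cmod (poly (poly Q [:z:]) x) \<le> (cmod z + B) ^ n * cmod (poly N x)" if x: "x \<notin> exceptional"
      for x
  proof -
    note card = not_exceptionalD(1)[OF x]
    have "cmod (poly (poly Q [:z:]) x) = (\<Prod>y\<in>roots x. cmod (z * beval (dx K) x y - beval E x y))"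
      using Q(1)[OF card, of z] by (simp add: beval_def prod_norm)
    also have "\<dots> \<le> (\<Prod>y\<in>roots x. (cmod z + B) * cmod (beval (dx K) x y))"
    proof (intro prod_mono conjI)
      fix y assume y: "y \<in> roots x"
      have "cmod (z * beval (dx K) x y - beval E x y) \<le>
          cmod z * cmod (beval (dx K) x y) + cmod (beval E x y)"
        by (metis norm_mult norm_triangle_ineq4)
      also have "\<dots> \<le> (cmod z + B) * cmod (beval (dx K) x y)"
        using B[OF x y] by (simp add: algebra_simps)
      finally show "cmod (z * beval (dx K) x y - beval E x y) \<le>
          (cmod z + B) * cmod (beval (dx K) x y)" .
    qed auto
    also have "\<dots> = (cmod z + B) ^ n * cmod (poly N x)"
      using N(1)[OF card] card by (simp add: prod.distrib prod_norm)
    finally show ?thesis .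
  qed
  moreover have "N \<noteq> 0" using N_nz[OF assms(1)] by auto
  ultimately obtain \<gamma> where \<gamma>: "poly Q [:z:] = Polynomial.smult \<gamma> N"
    using poly_bounded_quotient[of N exceptional] finite_exc by blast
  have eq: "beval Q x z = \<gamma> * poly N x" for x
    by (simp add: beval_def \<gamma>)
  have "beval Q x1 z = 0" using assms(3) Q(2) by metis
  then have "\<gamma> = 0" using N_nz[OF assms(1)] eq by simp
  then have "beval Q x2 z = 0" using eq by simp
  then show ?thesis using Q(2) by metis
qed

text \<open>
  Along the branches with \<open>E = z K\<^sub>x\<close> the function \<open>K\<close> is a constant multiple of \<open>(x + z)\<^sup>n\<^sup>+\<^sup>1\<close>, so
  these branches run into a critical point over \<open>x = - z\<close>.
\<close>

lemma level_critical_point: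
  assumes x1: "x1 \<notin> exceptional" and y1: "y1 \<in> roots x1"
    and z: "beval E x1 y1 = z * beval (dx K) x1 y1"
  shows "\<exists>b. beval (dx K) (- z) b = 0 \<and> beval (dy K) (- z) b = 0"
proof (rule ccontr)
  assume no_crit: "\<not> ?thesis"
  define a where "a = - z"
  obtain e where e: "e > 0" "ball a e - {a} \<subseteq> - exceptional"
    using punctured_ball_avoiding_exceptional by blast
  let ?U = "ball a e - {a}"
  have reg: "x \<notin> exceptional" if "x \<in> ?U" for x using e(2) that by blast
  define sel where "sel x y \<longleftrightarrow> beval E x y = z * beval (dx K) x y" for x y
  \<comment> \<open>By \<open>level_set_constant\<close> all values of \<open>E / K_x\<close> off
    \<open>exceptional\<close> lie in this finite set. A change of value would be a jump by at least
    \<open>s\<close>, so membership in the level \<open>z\<close> is locally constant.\<close>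
  define W where "W = (\<lambda>y. beval E x1 y / beval (dx K) x1 y) ` roots x1"
  have W: "beval E x y / beval (dx K) x y \<in> W" if x: "x \<notin> exceptional" and y: "y \<in> roots x" for x y
  proof -
    let ?w = "beval E x y / beval (dx K) x y"
    have "beval E x y = ?w * beval (dx K) x y" using not_exceptionalD(2)[OF x y] by simp
    then obtain y' where y': "y' \<in> roots x1" "beval E x1 y' = ?w * beval (dx K) x1 y'"
      using level_set_constant[OF x x1] y by blast
    then have "?w = beval E x1 y' / beval (dx K) x1 y'"
      using not_exceptionalD(2)[OF x1 y'(1)] by (simp add: field_simps)
    then show ?thesis unfolding W_def using y'(1) by (rule image_eqI)
  qed
  have "finite W" unfolding W_def by (intro finite_imageI finite_roots)
  then obtain s where s: "s > 0" "\<And>u v. u \<in> W \<Longrightarrow> v \<in> W \<Longrightarrow> u \<noteq> v \<Longrightarrow> s \<le> cmod (u - v)"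
    using finite_separated[of W] by (auto simp: dist_norm)
  have sel_iff: "sel x y \<longleftrightarrow> beval E x y / beval (dx K) x y = z"
    if "x \<notin> exceptional" "y \<in> roots x" for x y
    using not_exceptionalD(2)[OF that] by (auto simp: sel_def field_simps)
  have loc: "\<exists>e'>0. \<forall>x y. cmod (x - x') < e' \<longrightarrow> cmod (y - r) < e' \<longrightarrow> y \<in> roots x \<longrightarrow> sel x y = sel x' r"
    if x': "x' \<in> ?U" and r: "r \<in> roots x'" for x' r
  proof -
    define w where "w = beval E x' r / beval (dx K) x' r"
    let ?S = "{p. cmod (beval E (fst p) (snd p) - w * beval (dx K) (fst p) (snd p)) <
      s * cmod (beval (dx K) (fst p) (snd p))} \<inter> (?U \<times> UNIV)"
    have "open ?S"
      by (intro open_Int open_Collect_less continuous_intros open_Times) auto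
    moreover have "(x', r) \<in> ?S"
      using x' s(1) not_exceptionalD(2)[OF reg[OF x'] r] by (simp add: w_def)
    ultimately obtain e' where e': "e' > 0"
        "\<And>x y. cmod (x - x') < e' \<Longrightarrow> cmod (y - r) < e' \<Longrightarrow> (x, y) \<in> ?S"
      using open_pair_nbhd by blast
    have "sel x y = sel x' r" if "cmod (x - x') < e'" "cmod (y - r) < e'" and y: "y \<in> roots x"
        for x y
    proof -
      have S: "(x, y) \<in> ?S" using e'(2) that by blast
      then have x: "x \<notin> exceptional" using reg by auto
      note nz = not_exceptionalD(2)[OF x y]
      have "cmod (beval E x y / beval (dx K) x y - w) * cmod (beval (dx K) x y)
          = cmod (beval E x y - w * beval (dx K) x y)"
        using nz by (simp add: norm_mult[symmetric] left_diff_distrib)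
      also have "\<dots> < s * cmod (beval (dx K) x y)" using S by simp
      finally have "cmod (beval E x y / beval (dx K) x y - w) < s"
        using nz by simp
      then have "beval E x y / beval (dx K) x y = w"
        using s(2)[OF W[OF x y] W[OF reg[OF x'] r]] by (fastforce simp: w_def)
      then show ?thesis
        using sel_iff[OF x y] sel_iff[OF reg[OF x'] r] by (simp add: w_def)
    qed
    with e'(1) show ?thesis by blast
  qed
  have K_sel: "of_nat (n + 1) * beval K x y = (x - a) * beval (dx K) x y" if "sel x y" for x y
    using that by (simp add: sel_def beval_E a_def algebra_simps)
  have K_nz: "beval K x y \<noteq> 0" if "x \<in> ?U" "y \<in> roots x" "sel x y" for x y
  proof
    assume "beval K x y = 0"
    with K_sel[OF that(3)] have "(x - a) * beval (dx K) x y = 0" by simp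
    then show False using that(1) not_exceptionalD(2)[OF reg[OF that(1)] that(2)] by auto
  qed
  define A where "A x = {y. y \<in> roots x \<and> sel x y}" for x
  define \<Lambda> where "\<Lambda> x = (\<Prod>y\<in>A x. beval K x y)" for x
  have "(\<lambda>x. card (A x)) constant_on ?U"
  proof (rule locally_constant_imp_constant)
    show "connected ?U" by (intro connected_punctured_ball) simp
    fix x' assume x': "x' \<in> ?U"
    obtain \<epsilon> where \<epsilon>: "\<epsilon> > 0" "\<And>x. x \<in> ball x' \<epsilon> \<Longrightarrow> card (A x) = card (A x')"
      using selection_product(2)[OF not_exceptionalD(1)[OF reg[OF x']] loc[OF x'] K_nz[OF x']]
      unfolding A_def by blast
    have "openin (top_of_set ?U) (?U \<inter> ball x' \<epsilon>)"
      by (rule openin_open_Int) (rule open_ball)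
    moreover have "x' \<in> ?U \<inter> ball x' \<epsilon>" using \<epsilon>(1) x' by (intro IntI) auto
    ultimately show "\<exists>T. openin (top_of_set ?U) T \<and> x' \<in> T \<and> (\<forall>x\<in>T. card (A x) = card (A x'))"
      using \<epsilon>(2) by blast
  qed
  then obtain k where "\<forall>x\<in>?U. card (A x) = k"
    unfolding constant_on_def ..
  then have k: "\<And>x. x \<in> ?U \<Longrightarrow> card (A x) = k" by blast
  have x0: "a + of_real (e / 2) \<in> ?U" using e(1) by (auto simp: dist_norm)
  have "k > 0"
  proof -
    obtain y where "y \<in> A (a + of_real (e / 2))"
      using level_set_constant[OF x1 reg[OF x0], of z] y1 z unfolding A_def sel_def by blast
    moreover have "finite (A x)" for x unfolding A_def using finite_roots[of x] by simp
    ultimately show ?thesis using k[OF x0] card_gt_0_iff by blast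
  qed
  \<comment> \<open>On each of the \<open>k\<close> branches \<open>(n + 1) K = (x - a) K_x\<close>,
    which makes \<open>k (n + 1) / (x - a)\<close> the logarithmic derivative of the
    product.\<close>
  have deriv: "((\<lambda>x. \<Lambda> x / (x - a) ^ (k * (n + 1))) has_field_derivative 0) (at x)" if x: "x \<in> ?U"
      for x
  proof -
    have "(\<Sum>y\<in>A x. beval (dx K) x y / beval K x y) = (\<Sum>y\<in>A x. of_nat (n + 1) / (x - a))"
    proof (intro sum.cong refl)
      fix y assume "y \<in> A x"
      then show "beval (dx K) x y / beval K x y = of_nat (n + 1) / (x - a)"
        using K_sel[of x y] K_nz[OF x, of y] x by (simp add: A_def field_simps)
    qed
    also have "\<dots> = of_nat (k * (n + 1)) / (x - a)" using k[OF x] by (simp add: algebra_simps)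
    finally have sum: "(\<Sum>y\<in>A x. beval (dx K) x y / beval K x y) = of_nat (k * (n + 1)) / (x - a)" .
    define j where "j = k * (n + 1)"
    have "(\<Lambda> has_field_derivative \<Lambda> x * (\<Sum>y\<in>A x. beval (dx K) x y / beval K x y)) (at x)"
      unfolding A_def \<Lambda>_def
      by (rule selection_product(1)[OF not_exceptionalD(1)[OF reg[OF x]] loc[OF x] K_nz[OF x]])
    then have L: "(\<Lambda> has_field_derivative \<Lambda> x * (of_nat j / (x - a))) (at x)"
      unfolding sum j_def .
    have "j > 0" using \<open>k > 0\<close> by (simp add: j_def)
    then have j: "(x - a) ^ j = (x - a) * (x - a) ^ (j - 1)" by (cases j) auto
    have "x - a \<noteq> 0" using x by auto
    have "((\<lambda>x. (x - a) ^ j) has_field_derivative of_nat j * (x - a) ^ (j - 1)) (at x)"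
      by (auto intro!: derivative_eq_intros)
    from DERIV_divide[OF L this] \<open>x - a \<noteq> 0\<close>
    have "((\<lambda>x. \<Lambda> x / (x - a) ^ j) has_field_derivative
        (\<Lambda> x * (of_nat j / (x - a)) * (x - a) ^ j - \<Lambda> x * (of_nat j * (x - a) ^ (j - 1))) /
        ((x - a) ^ j * (x - a) ^ j)) (at x)" by simp
    moreover have "\<Lambda> x * (of_nat j / (x - a)) * (x - a) ^ j = \<Lambda> x * (of_nat j * (x - a) ^ (j - 1))"
      using \<open>x - a \<noteq> 0\<close> by (simp add: j)
    ultimately show ?thesis unfolding j_def by simp
  qed
  have cont: "continuous_on ?U (\<lambda>x. \<Lambda> x / (x - a) ^ (k * (n + 1)))"
    using deriv by (intro continuous_at_imp_continuous_on) (blast intro: DERIV_isCont)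
  have U: "connected ?U" "open ?U" by (auto intro: connected_punctured_ball)
  have deriv0: "\<forall>x\<in>?U - {}. DERIV (\<lambda>x. \<Lambda> x / (x - a) ^ (k * (n + 1))) x :> 0"
    using deriv by blast
  from DERIV_zero_connected_constant[OF U finite.emptyI cont deriv0]
  obtain C where C: "\<And>x. x \<in> ?U \<Longrightarrow> \<Lambda> x / (x - a) ^ (k * (n + 1)) = C" by blast
  have prod_dx: "(\<Prod>y\<in>A x. beval (dx K) x y) = of_nat (n + 1) ^ k * C * (x - a) ^ (k * n)"
    if x: "x \<in> ?U" for x
  proof -
    have nz: "x - a \<noteq> 0" using x by auto
    have "(x - a) ^ k * (\<Prod>y\<in>A x. beval (dx K) x y) = (\<Prod>y\<in>A x. (x - a) * beval (dx K) x y)"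
      using k[OF x] by (simp add: prod.distrib)
    also have "\<dots> = (\<Prod>y\<in>A x. of_nat (n + 1) * beval K x y)"
      using K_sel by (intro prod.cong refl) (auto simp: A_def)
    also have "\<dots> = of_nat (n + 1) ^ k * \<Lambda> x"
      using k[OF x] by (simp only: prod.distrib prod_constant \<Lambda>_def)
    also have "\<Lambda> x = C * (x - a) ^ (k * (n + 1))"
      using C[OF x] nz by (auto simp: field_simps)
    also have "(x - a) ^ (k * (n + 1)) = (x - a) ^ k * (x - a) ^ (k * n)"
      by (simp add: power_add[symmetric])
    finally have "(x - a) ^ k * (\<Prod>y\<in>A x. beval (dx K) x y) =
        (x - a) ^ k * (of_nat (n + 1) ^ k * C * (x - a) ^ (k * n))" by (simp add: mult_ac)
    then show ?thesis using nz by simp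
  qed
  \<comment> \<open>Without a critical point over \<open>a\<close> the values of \<open>K_x\<close>
    stay away from 0 nearby, whereas by \<open>prod_dx\<close> the product of \<open>k > 0\<close>
    of them is a multiple of \<open>(x - a)^(k n)\<close> and tends to 0.\<close>
  have "\<exists>m>0. \<exists>e'>0. \<forall>x\<in>ball a e' - {a}. \<forall>y\<in>roots x. m \<le> cmod (beval (dx K) x y)"
  proof (rule ccontr)
    assume "\<not> ?thesis"
    then have "\<exists>x y. x \<in> ball a (1 / Suc j) - {a} \<and> y \<in> roots x \<and>
        cmod (beval (dx K) x y) < 1 / Suc j" for j :: nat
      by (meson not_le of_nat_0_less_iff zero_less_Suc zero_less_divide_1_iff)
    then obtain X Y where XY: "\<And>j. X j \<in> ball a (1 / Suc j) - {a}" "\<And>j. Y j \<in> roots (X j)"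
        "\<And>j. cmod (beval (dx K) (X j) (Y j)) < 1 / Suc j"
      by metis
    have Xa: "X \<longlonglongrightarrow> a"
      using XY(1) by (intro tendsto_shrinking_balls) auto
    obtain r b where r: "strict_mono (r :: nat \<Rightarrow> nat)" "(Y \<circ> r) \<longlonglongrightarrow> b" "b \<in> roots a"
      using roots_limit[OF Xa XY(2)] .
    have "(\<lambda>j. beval (dx K) (X j) (Y j)) \<longlonglongrightarrow> 0"
      by (rule tendsto_shrinking_balls) (use XY(3) in auto)
    then have "(\<lambda>j. beval (dx K) ((X \<circ> r) j) ((Y \<circ> r) j)) \<longlonglongrightarrow> 0"
      using LIMSEQ_subseq_LIMSEQ[OF _ r(1)] by (fastforce simp: o_def)
    moreover have "(\<lambda>j. beval (dx K) ((X \<circ> r) j) ((Y \<circ> r) j)) \<longlonglongrightarrow> beval (dx K) a b"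
      using LIMSEQ_subseq_LIMSEQ[OF Xa r(1)] r(2) by (intro tendsto_beval)
    ultimately have "beval (dx K) a b = 0" using LIMSEQ_unique by blast
    then show False using no_crit r(3) by (auto simp: a_def roots_def)
  qed
  then obtain m e' where m: "m > 0" "e' > 0"
      "\<And>x y. x \<in> ball a e' - {a} \<Longrightarrow> y \<in> roots x \<Longrightarrow> m \<le> cmod (beval (dx K) x y)"
    by blast
  have "((\<lambda>x. cmod (of_nat (n + 1) ^ k * C * (x - a) ^ (k * n))) \<longlongrightarrow>
      cmod (of_nat (n + 1) ^ k * C * (a - a) ^ (k * n))) (at a)"
    by (intro tendsto_intros)
  then have "((\<lambda>x. cmod (of_nat (n + 1) ^ k * C * (x - a) ^ (k * n))) \<longlongrightarrow> 0) (at a)"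
    using \<open>k > 0\<close> n_pos by (simp add: zero_power)
  then have "\<forall>\<^sub>F x in at a. cmod (of_nat (n + 1) ^ k * C * (x - a) ^ (k * n)) < m ^ k"
    using m(1) by (intro order_tendstoD(2)[of _ 0]) auto
  moreover have "\<forall>\<^sub>F x in at a. x \<in> ball a (min e e') - {a}"
    by (rule eventually_at_in_open) (use e(1) m(2) in auto)
  ultimately have "\<forall>\<^sub>F x in at a. False"
  proof eventually_elim
    case (elim x)
    have xU: "x \<in> ?U" and xe': "x \<in> ball a e' - {a}" using elim(2) by auto
    have "m ^ k = (\<Prod>y\<in>A x. m)" using k[OF xU] by simp
    also have "\<dots> \<le> (\<Prod>y\<in>A x. cmod (beval (dx K) x y))"
      using m(1) m(3)[OF xe'] by (intro prod_mono) (auto simp: A_def)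
    also have "\<dots> = cmod (of_nat (n + 1) ^ k * C * (x - a) ^ (k * n))"
      using prod_dx[OF xU] by (simp add: prod_norm)
    finally show False using elim(1) by simp
  qed
  then show False by simp
qed

text \<open>The abscissa \<open>a\<close> that serves a point may vary from branch to branch. The
  product over all critical abscissas is a single polynomial vanishing over the regular fibres,
  hence by \<open>roots_approach\<close> on the whole curve.\<close>

theorem polar_point_critical_point:
  assumes "beval (dy K) x y = 0"
  shows "\<exists>a b. beval (dx K) a b = 0 \<and> beval (dy K) a b = 0 \<and>
    of_nat (n + 1) * beval K x y = (x - a) * beval (dx K) x y"
proof -
  define A where "A = {a. \<exists>b. beval (dx K) a b = 0 \<and> beval (dy K) a b = 0}"
  define F where "F = (\<Prod>a\<in>A. (bconst (of_nat (n + 1)) * K - (bX - bconst a) * dx K))"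
  have "A \<subseteq> exceptional"
    by (auto simp: A_def exceptional_def roots_def)
  then have finA: "finite A" using finite_exc finite_subset by blast
  have F0: "beval F u v = 0" if u: "u \<notin> exceptional" and v: "v \<in> roots u" for u v
  proof -
    define z where "z = beval E u v / beval (dx K) u v"
    have z: "beval E u v = z * beval (dx K) u v"
      using not_exceptionalD(2)[OF u v] by (simp add: z_def)
    then have "- z \<in> A" using level_critical_point[OF u v] by (simp add: A_def)
    moreover have "of_nat (n + 1) * beval K u v - (u - (- z)) * beval (dx K) u v = 0"
      using z by (simp add: beval_E algebra_simps)
    ultimately show ?thesis
      unfolding F_def beval_prod using finA by (intro prod_zero) (auto intro!: bexI[of _ "- z"])
  qed
  obtain X where X: "X \<longlonglongrightarrow> x" "\<And>k :: nat. X k \<notin> exceptional"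
    using ex_sequence_avoiding_finite[of "\<lambda>_. exceptional" x] finite_exc by blast
  obtain Y where Y: "\<And>k. Y k \<in> roots (X k)" "Y \<longlonglongrightarrow> y"
    using roots_approach[OF X(1), of y] assms by (auto simp: roots_def)
  have "(\<lambda>k. beval F (X k) (Y k)) \<longlonglongrightarrow> beval F x y"
    by (intro tendsto_beval X(1) Y(2))
  then have "beval F x y = 0"
    using F0[OF X(2) Y(1)] by (simp add: LIMSEQ_const_iff)
  then obtain a where "a \<in> A" "of_nat (n + 1) * beval K x y - (x - a) * beval (dx K) x y = 0"
    using finA by (auto simp: F_def prod_zero_iff)
  then show ?thesis by (auto simp: A_def)
qed

end

section \<open>Substitution and shears\<close>

lemma beval_altdef:
  "beval H x y = (\<Sum>j\<le>degree H. \<Sum>i\<le>degree (coeff H j). bcoeff H i j * x ^ i * y ^ j)"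
  unfolding beval_def Polynomial.poly_altdef[of H] poly_sum
  by (intro sum.cong refl)
    (simp add: Polynomial.poly_altdef[of "coeff H _"] bcoeff_def sum_distrib_right)

definition bsubst :: "bipoly \<Rightarrow> bipoly \<Rightarrow> bipoly \<Rightarrow> bipoly" where
  "bsubst U V H = (\<Sum>j\<le>degree H. \<Sum>i\<le>degree (coeff H j). bconst (bcoeff H i j) * U ^ i * V ^ j)"

lemma beval_bsubst [simp]: "beval (bsubst U V H) x y = beval H (beval U x y) (beval V x y)"
  by (simp add: bsubst_def beval_altdef[of H])

text \<open>\<open>H\<close> in the coordinates \<open>(x + l y, y)\<close>. The y-derivative
  becomes \<open>H_y - l H_x\<close>, so \<open>dy = 0\<close> is the polar curve of slope
  \<open>l\<close>.\<close>

definition shear :: "complex \<Rightarrow> bipoly \<Rightarrow> bipoly" where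
  "shear l = bsubst (bX - bconst l * bY) bY"

lemma beval_shear [simp]: "beval (shear l H) x y = beval H (x - l * y) y"
  by (simp add: shear_def)

lemma beval_dx: "((\<lambda>x. beval F x y) has_field_derivative beval (dx F) x y) (at x)"
  using beval_deriv_compose[of "\<lambda>x. x" 1 x "\<lambda>_. y" 0 F, OF DERIV_ident DERIV_const] by simp

lemma beval_dy: "((\<lambda>y. beval F x y) has_field_derivative beval (dy F) x y) (at y)"
  using beval_deriv_compose[of "\<lambda>_. x" 0 y "\<lambda>y. y" 1 F, OF DERIV_const DERIV_ident] by simp

lemma dx_eqI:
  assumes "\<And>x y. ((\<lambda>x. beval F x y) has_field_derivative beval G x y) (at x)"
  shows "dx F = G"
  using DERIV_unique[OF beval_dx assms] by (intro beval_eqI) blast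

lemma dy_eqI:
  assumes "\<And>x y. ((\<lambda>y. beval F x y) has_field_derivative beval G x y) (at y)"
  shows "dy F = G"
  using DERIV_unique[OF beval_dy assms] by (intro beval_eqI) blast

lemma dx_shear: "dx (shear l H) = shear l (dx H)"
proof (rule dx_eqI)
  fix x y
  have "((\<lambda>x. x - l * y) has_field_derivative 1) (at x)"
    by (auto intro!: derivative_eq_intros)
  from beval_deriv_compose[OF this DERIV_const, of H y]
  show "((\<lambda>x. beval (shear l H) x y) has_field_derivative beval (shear l (dx H)) x y) (at x)"
    by simp
qed

lemma dy_shear: "dy (shear l H) = shear l (dy H - bconst l * dx H)"
proof (rule dy_eqI)
  fix x y
  have "((\<lambda>y. x - l * y) has_field_derivative - l) (at y)"
    by (auto intro!: derivative_eq_intros)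
  from beval_deriv_compose[OF this DERIV_ident, of H]
  show "((\<lambda>y. beval (shear l H) x y) has_field_derivative
      beval (shear l (dy H - bconst l * dx H)) x y) (at y)"
    by (simp add: algebra_simps)
qed

lemma bcoeff_mult:
  "bcoeff (F * G) i j = (\<Sum>k\<le>j. \<Sum>l\<le>i. bcoeff F l k * bcoeff G (i - l) (j - k))"
  by (simp add: bcoeff_def coeff_mult coeff_sum)

lemma tdeg_le_mono: "tdeg_le a F \<Longrightarrow> a \<le> b \<Longrightarrow> tdeg_le b F"
  unfolding tdeg_le_def by (meson le_trans)

lemma tdeg_le_0: "tdeg_le m 0"
  and tdeg_le_add: "tdeg_le m F \<Longrightarrow> tdeg_le m G \<Longrightarrow> tdeg_le m (F + G)"
  and tdeg_le_diff: "tdeg_le m F \<Longrightarrow> tdeg_le m G \<Longrightarrow> tdeg_le m (F - G)"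
  unfolding tdeg_le_def by (auto, metis add.right_neutral, metis diff_zero)

lemma tdeg_le_sum: "(\<And>a. a \<in> A \<Longrightarrow> tdeg_le m (f a)) \<Longrightarrow> tdeg_le m (sum f A)"
  by (induction A rule: infinite_finite_induct) (auto intro: tdeg_le_add tdeg_le_0)

lemma tdeg_le_mult:
  assumes "tdeg_le a F" "tdeg_le b G"
  shows "tdeg_le (a + b) (F * G)"
  unfolding tdeg_le_def
proof (intro allI impI)
  fix i j assume "bcoeff (F * G) i j \<noteq> 0"
  then obtain k l where kl: "k \<le> j" "l \<le> i" "bcoeff F l k \<noteq> 0" "bcoeff G (i - l) (j - k) \<noteq> 0"
    unfolding bcoeff_mult by (auto elim!: sum.not_neutral_contains_not_neutral)
  then have "l + k \<le> a" "(i - l) + (j - k) \<le> b"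
    using assms unfolding tdeg_le_def by blast+
  then show "i + j \<le> a + b" using kl(1,2) by linarith
qed

lemma tdeg_le_bconst: "tdeg_le 0 (bconst c)"
  by (auto simp: tdeg_le_def bcoeff_def bconst_def coeff_pCons split: nat.splits)

lemma tdeg_le_bX: "tdeg_le 1 bX" and tdeg_le_bY: "tdeg_le 1 bY"
  by (auto simp: tdeg_le_def bcoeff_def bX_def bY_def coeff_pCons split: nat.splits)

lemma tdeg_le_power: "tdeg_le 1 F \<Longrightarrow> tdeg_le k (F ^ k)"
proof (induction k)
  case 0
  then show ?case using tdeg_le_bconst[of 1] by (simp add: bconst_def one_pCons)
next
  case (Suc k)
  then show ?case using tdeg_le_mult[of 1 F k "F ^ k"] by simp
qed

lemma tdeg_le_bsubst:
  assumes "tdeg_le 1 U" "tdeg_le 1 V" "tdeg_le m H"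
  shows "tdeg_le m (bsubst U V H)"
  unfolding bsubst_def
proof (intro tdeg_le_sum)
  fix i j
  show "tdeg_le m (bconst (bcoeff H i j) * U ^ i * V ^ j)"
  proof (cases "bcoeff H i j = 0")
    case True
    then show ?thesis using tdeg_le_0 by (simp add: bconst_def)
  next
    case False
    then have "0 + i + j \<le> m" using assms(3) by (auto simp: tdeg_le_def)
    with tdeg_le_mult[OF tdeg_le_mult[OF tdeg_le_bconst tdeg_le_power[OF assms(1)]]
        tdeg_le_power[OF assms(2)]]
    show ?thesis by (rule tdeg_le_mono)
  qed
qed

lemma tdeg_le_shear:
  assumes "tdeg_le m H"
  shows "tdeg_le m (shear l H)"
  unfolding shear_def
proof (rule tdeg_le_bsubst[OF _ tdeg_le_bY assms])
  have "tdeg_le (0 + 1) (bconst l * bY)"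
    by (intro tdeg_le_mult tdeg_le_bconst tdeg_le_bY)
  then show "tdeg_le 1 (bX - bconst l * bY)"
    by (intro tdeg_le_diff tdeg_le_bX) simp
qed

lemma tdeg_le_dx: "tdeg_le m H \<Longrightarrow> tdeg_le (m - 1) (dx H)"
  and tdeg_le_dy: "tdeg_le m H \<Longrightarrow> tdeg_le (m - 1) (dy H)"
  unfolding tdeg_le_def by force+

lemma homogeneous_imp_tdeg_le: "homogeneous (int m) F \<Longrightarrow> tdeg_le m F"
  unfolding homogeneous_def tdeg_le_def by force

lemma homogeneous_dx: "homogeneous (int (Suc m)) F \<Longrightarrow> homogeneous (int m) (dx F)"
  and homogeneous_dy: "homogeneous (int (Suc m)) F \<Longrightarrow> homogeneous (int m) (dy F)"
  unfolding homogeneous_def by force+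

lemma euler_identity:
  assumes "homogeneous (int m) F"
  shows "x * beval (dx F) x y + y * beval (dy F) x y = of_nat m * beval F x y"
proof -
  have "((\<lambda>t. t * x) has_field_derivative x) (at 1)" "((\<lambda>t. t * y) has_field_derivative y) (at 1)"
    by (auto intro!: derivative_eq_intros)
  from beval_deriv_compose[OF this, of F]
  have "((\<lambda>t. beval F (t * x) (t * y)) has_field_derivative
      beval (dx F) x y * x + beval (dy F) x y * y) (at 1)" by simp
  then have "((\<lambda>t. t ^ m * beval F x y) has_field_derivative
      beval (dx F) x y * x + beval (dy F) x y * y) (at 1)"
    unfolding beval_homogeneous[OF assms] .
  moreover have "((\<lambda>t. t ^ m * beval F x y) has_field_derivative of_nat m * beval F x y) (at 1)"
    by (auto intro!: derivative_eq_intros)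
  ultimately show ?thesis
    using DERIV_unique by (fastforce simp: mult.commute)
qed

section \<open>Forms with an isolated critical point\<close>

text \<open>The last assumption says that the partial derivatives have no common linear factor, the
  geometric content of normalization extracted in \<open>normalized_isolated_form\<close>. For
  \<open>n = 0\<close> they are constants and that case is treated directly.\<close>

locale isolated_form =
  fixes Hh :: bipoly and n :: nat
  assumes n_pos: "n > 0"
    and form: "homogeneous (int (Suc n)) Hh"
    and no_common_zero: "beval (dx Hh) x y = 0 \<Longrightarrow> beval (dy Hh) x y = 0 \<Longrightarrow> x = 0 \<and> y = 0"
begin

lemmas dx_form = homogeneous_dx[OF form] and dy_form = homogeneous_dy[OF form]

text \<open>
  The polar curve \<open>H\<^sub>y = l H\<^sub>x\<close> is to be finite of degree \<open>n\<close> over the coordinate \<open>x + l y\<close> and to have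
  \<open>n\<close> distinct points at infinity, represented here on the line \<open>x + l y = 1\<close>.
\<close>

definition good :: "complex \<Rightarrow> bool" where
  "good l \<longleftrightarrow> beval Hh (- l) 1 \<noteq> 0 \<and>
     card {y. beval (dy Hh - bconst l * dx Hh) (1 - l * y) y = 0} = n"

text \<open>The coefficient of \<open>y^(n+1)\<close> in \<open>H (x - l y, y)\<close> comes from
  the leading form alone and equals \<open>Hh (-l, 1)\<close>. Hence the constant \<open>c\<close>
  is the same for all lower terms.\<close>

lemma shear_polar_curve:
  assumes "tdeg_le n (H - Hh)" "beval Hh (- l) 1 \<noteq> 0"
  shows "polar_curve (shear l H) n (of_nat (Suc n) * beval Hh (- l) 1)"
proof -
  let ?K = "shear l H" and ?c = "of_nat (Suc n) * beval Hh (- l) 1"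
  have "tdeg_le (Suc n) (Hh + (H - Hh))"
    using homogeneous_imp_tdeg_le[OF form] tdeg_le_mono[OF assms(1)] by (intro tdeg_le_add) auto
  then have tK: "tdeg_le (Suc n) ?K" by (intro tdeg_le_shear) simp
  have "?K = shear l Hh + shear l (H - Hh)"
    by (rule beval_eqI) simp
  moreover have "bcoeff (shear l (H - Hh)) 0 (Suc n) = 0"
    using tdeg_le_shear[OF assms(1), of l] unfolding tdeg_le_def by fastforce
  moreover have "xslice (shear l Hh) 0 = monom (beval Hh (- l) 1) (Suc n)"
  proof (rule poly_eq_poly_eq_iff[THEN iffD1], rule ext)
    fix y
    show "poly (xslice (shear l Hh) 0) y = poly (monom (beval Hh (- l) 1) (Suc n)) y"
      using beval_homogeneous[OF form, of y "- l" 1] by (simp add: poly_monom mult.commute)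
  qed
  then have "coeff (xslice (shear l Hh) 0) (Suc n) = beval Hh (- l) 1" by simp
  then have "bcoeff (shear l Hh) 0 (Suc n) = beval Hh (- l) 1"
    by (simp add: bcoeff_def poly_0_coeff_0)
  ultimately have top: "bcoeff ?K 0 (Suc n) = beval Hh (- l) 1" by simp
  have cn: "coeff (dy ?K) n = [:?c:]"
  proof (rule poly_eqI)
    fix i
    have "coeff (coeff (dy ?K) n) i = of_nat (Suc n) * bcoeff ?K i (Suc n)"
      using bcoeff_dy[of ?K i n] by (simp add: bcoeff_def)
    moreover have "bcoeff ?K i (Suc n) = 0" if "i > 0"
      using tK that unfolding tdeg_le_def by fastforce
    ultimately show "coeff (coeff (dy ?K) n) i = coeff [:?c:] i"
      using top by (cases i) auto
  qed
  have "coeff (dy ?K) j = 0" if "j > n" for j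
  proof (rule poly_eqI)
    fix i
    have "coeff (coeff (dy ?K) j) i = of_nat (Suc j) * bcoeff ?K i (Suc j)"
      using bcoeff_dy[of ?K i j] by (simp add: bcoeff_def)
    moreover have "bcoeff ?K i (Suc j) = 0"
      using tK that unfolding tdeg_le_def by fastforce
    ultimately show "coeff (coeff (dy ?K) j) i = coeff 0 i" by simp
  qed
  then have "degree (dy ?K) \<le> n" by (intro degree_le) auto
  moreover have "?c \<noteq> 0" using assms(2) by (simp del: of_nat_Suc)
  then have "coeff (dy ?K) n \<noteq> 0" using cn by simp
  ultimately have "degree (dy ?K) = n" by (metis le_antisym le_degree)
  then show ?thesis
    using cn \<open>?c \<noteq> 0\<close> n_pos by unfold_locales auto
qed

text \<open>If \<open>Hh\<close> vanished on the whole line \<open>y = 1\<close>, then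
  \<open>Hh_x\<close> would vanish at \<open>(0, 1)\<close> and, by Euler's identity,
  \<open>Hh_y\<close> as well.\<close>

lemma finite_isotropic: "finite {l. beval Hh (- l) 1 = 0}"
proof -
  let ?p = "poly Hh [:1:]"
  have p: "poly ?p x = beval Hh x 1" for x by (simp add: beval_def)
  have "?p \<noteq> 0"
  proof
    assume "?p = 0"
    then have "beval Hh x 1 = 0" for x using p by (metis poly_0)
    then have Hh1: "(\<lambda>x. beval Hh x 1) = (\<lambda>x. 0)" by (rule ext)
    have "beval (dx Hh) 0 1 = 0"
      using beval_dx[of Hh 1 0] DERIV_unique[OF _ DERIV_const] unfolding Hh1 by blast
    moreover have "beval (dy Hh) 0 1 = 0"
      using euler_identity[OF form, of 0 1] fun_cong[OF Hh1, of 0] by simp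
    ultimately show False using no_common_zero[of 0 1] by simp
  qed
  then have "finite (uminus ` {x. poly ?p x = 0})" by (intro finite_imageI poly_roots_finite)
  moreover have "{l. beval Hh (- l) 1 = 0} \<subseteq> uminus ` {x. poly ?p x = 0}"
    using p by (auto intro!: image_eqI[of _ _ "- _"])
  ultimately show ?thesis by (rule rev_finite_subset)
qed

text \<open>As \<open>a\<close> and \<open>b\<close> have no common zero, \<open>a b' = a' b\<close>
  makes each of them divide its own derivative, so both are constant. The two forms are then
  multiples of \<open>x^n\<close> and share the zero \<open>(0, 1)\<close>.\<close>

lemma wronskian_nonzero:
  defines "a \<equiv> xslice (dx Hh) 1" and "b \<equiv> xslice (dy Hh) 1"
  shows "a * pderiv b - pderiv a * b \<noteq> 0"
proof
  assume W: "a * pderiv b - pderiv a * b = 0"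
  have ab: "poly a t \<noteq> 0 \<or> poly b t \<noteq> 0" for t
    using no_common_zero[of 1 t] by (auto simp: a_def b_def)
  have const: "pderiv p = 0" if "\<And>t. poly p t = 0 \<Longrightarrow> poly q t \<noteq> 0" "p * pderiv q = pderiv p * q"
      for p q :: "complex poly"
  proof (rule ccontr)
    assume nz: "pderiv p \<noteq> 0"
    then have "p \<noteq> 0" by auto
    have "p dvd pderiv p * q" using that(2) by (metis dvd_triv_left)
    then have "p dvd pderiv p"
      using complex_poly_dvd_mult_cancel[OF \<open>p \<noteq> 0\<close> that(1)] by blast
    then have "degree p \<le> degree (pderiv p)" using nz by (rule dvd_imp_degree_le)
    then have "degree p = 0" by (simp add: degree_pderiv)
    then show False using nz by (simp add: pderiv_eq_0_iff)
  qed
  have "pderiv a = 0" "pderiv b = 0"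
    using const[of a b] const[of b a] ab W by (auto simp: algebra_simps)
  then obtain \<alpha> \<beta> where const_ab: "a = [:\<alpha>:]" "b = [:\<beta>:]"
    by (metis degree_eq_zeroE pderiv_eq_0_iff)
  have zero: "beval F 0 1 = 0" if F: "homogeneous (int n) F" and "xslice F 1 = [:\<gamma>:]" for F \<gamma>
  proof -
    have "beval F x 1 = x ^ n * \<gamma>" if "x \<noteq> 0" for x
    proof -
      have "beval F 1 (1 / x) = \<gamma>"
        using \<open>xslice F 1 = [:\<gamma>:]\<close> by (metis poly_xslice poly_pCons poly_0 mult_zero_right
            add.right_neutral)
      then show ?thesis using beval_homogeneous[OF F, of x 1 "1 / x"] that by simp
    qed
    then have ev: "\<forall>\<^sub>F x in at 0. beval F x 1 = x ^ n * \<gamma>"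
      by (auto simp: eventually_at_filter)
    have "((\<lambda>x. beval F x 1) \<longlongrightarrow> beval F 0 1) (at 0)"
      by (intro tendsto_beval tendsto_intros)
    from Lim_transform_eventually[OF this ev]
    have "((\<lambda>x. x ^ n * \<gamma>) \<longlongrightarrow> beval F 0 1) (at 0)" .
    moreover have "((\<lambda>x. x ^ n * \<gamma>) \<longlongrightarrow> 0 ^ n * \<gamma>) (at 0)"
      by (intro tendsto_intros)
    ultimately have "beval F 0 1 = 0 ^ n * \<gamma>"
      by (rule LIM_unique)
    then show ?thesis using n_pos by (simp add: zero_power)
  qed
  show False
    using zero[OF dx_form] zero[OF dy_form] const_ab no_common_zero[of 0 1]
    by (auto simp: a_def b_def)
qed

text \<open>At a multiple direction of the form \<open>Hh_y - l Hh_x\<close>, in the affine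
  coordinate \<open>t = y / x\<close>, both \<open>b - l a\<close> and its derivative vanish, so
  \<open>t\<close> is a zero of the Wronskian and determines \<open>l\<close>. The direction
  \<open>(0, 1)\<close>, missed by this coordinate, excludes at most the slope
  \<open>?l0\<close>.\<close>

lemma finite_not_good: "finite {l. \<not> good l}"
proof -
  let ?a = "xslice (dx Hh) 1" and ?b = "xslice (dy Hh) 1"
  let ?W = "?a * pderiv ?b - pderiv ?a * ?b"
  let ?L = "(\<lambda>t. beval (dy Hh) 1 t / beval (dx Hh) 1 t) ` {t. poly ?W t = 0}"
  let ?l0 = "beval (dy Hh) 0 1 / beval (dx Hh) 0 1"
  have "good l" if l: "beval Hh (- l) 1 \<noteq> 0" "l \<notin> ?L" "l \<noteq> ?l0" for l
  proof -
    let ?F = "dy Hh - bconst l * dx Hh"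
    have form_F: "homogeneous (int n) ?F"
      using dx_form dy_form unfolding homogeneous_def
      by (metis bcoeff_bconst_mult bcoeff_diff diff_zero mult_zero_right)
    have tdeg0: "tdeg_le n (Hh - Hh)" by (simp add: tdeg_le_0)
    interpret polar_curve "shear l Hh" n "of_nat (Suc n) * beval Hh (- l) 1"
      by (rule shear_polar_curve[OF tdeg0 l(1)])
    let ?q = "xslice (dy (shear l Hh)) 1"
    have q: "poly ?q y = beval ?F (1 - l * y) y" for y
      by (simp add: dy_shear)
    have sqfree: "poly (pderiv ?q) y \<noteq> 0" if y: "poly ?q y = 0" for y
    proof
      assume "poly (pderiv ?q) y = 0"
      define u where "u = 1 - l * y"
      have F0: "beval ?F u y = 0" using y q by (simp add: u_def)
      have "beval (dy (dy (shear l Hh))) 1 y = 0"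
        using \<open>poly (pderiv ?q) y = 0\<close> by (simp flip: xslice_dy)
      then have d: "beval (dy ?F) u y = l * beval (dx ?F) u y"
        by (simp add: dy_shear u_def)
      have "u * beval (dx ?F) u y + y * beval (dy ?F) u y = 0"
        using euler_identity[OF form_F, of u y] F0 by simp
      then have "(u + l * y) * beval (dx ?F) u y = 0"
        unfolding d by (simp add: algebra_simps)
      then have Fx: "beval (dx ?F) u y = 0" by (simp add: u_def)
      then have Fy: "beval (dy ?F) u y = 0" using d by simp
      show False
      proof (cases "u = 0")
        case True
        then have "y \<noteq> 0" by (auto simp: u_def)
        then have "beval ?F 0 1 = 0"
          using beval_homogeneous[OF form_F, of y 0 1] F0 True by simp
        then have "beval (dy Hh) 0 1 = l * beval (dx Hh) 0 1" by simp
        moreover from this have "beval (dx Hh) 0 1 \<noteq> 0"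
          using no_common_zero[of 0 1] by auto
        ultimately show False using l(3) by simp
      next
        case False
        define t where "t = y / u"
        have y_eq: "y = u * t" using False by (simp add: t_def)
        have "homogeneous (int (Suc (n - 1))) ?F" using form_F n_pos by simp
        from beval_homogeneous[OF homogeneous_dy[OF this], of u 1 t] Fy False
        have Fy1: "beval (dy ?F) 1 t = 0" by (simp add: y_eq)
        have F1: "beval ?F 1 t = 0"
          using beval_homogeneous[OF form_F, of u 1 t] F0 False by (simp add: y_eq)
        have "poly (pderiv (xslice ?F 1)) t = 0"
          using Fy1 by (simp flip: xslice_dy)
        moreover have "xslice ?F 1 = ?b - Polynomial.smult l ?a"
          by (rule poly_eq_poly_eq_iff[THEN iffD1]) (simp add: fun_eq_iff)
        ultimately have b': "poly (pderiv ?b) t = l * poly (pderiv ?a) t"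
          by (simp add: pderiv_diff pderiv_smult)
        have b: "beval (dy Hh) 1 t = l * beval (dx Hh) 1 t" using F1 by simp
        then have "poly ?W t = 0" using b' by simp
        moreover have "beval (dx Hh) 1 t \<noteq> 0"
          using no_common_zero[of 1 t] b by auto
        then have "l = beval (dy Hh) 1 t / beval (dx Hh) 1 t" using b by simp
        ultimately show False using l(2) by blast
      qed
    qed
    have "card {y. poly ?q y = 0} = degree ?q"
      by (rule card_roots_eq_degree[OF slice_nonzero sqfree])
    then have "card {y. poly ?q y = 0} = n"
      unfolding degree_slice .
    then show ?thesis using l(1) unfolding good_def q by simp
  qed
  then have "{l. \<not> good l} \<subseteq> {l. beval Hh (- l) 1 = 0} \<union> ?L \<union> {?l0}" by blast
  moreover have "finite ({l. beval Hh (- l) 1 = 0} \<union> ?L \<union> {?l0})"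
    using finite_isotropic wronskian_nonzero by (intro finite_UnI finite_imageI poly_roots_finite)
        auto
  ultimately show ?thesis by (rule finite_subset)
qed

end

lemma beval_ray_limit:
  assumes form: "homogeneous (int m) F'" and m: "m > 0" and low: "tdeg_le (m - 1) (F - F')"
    and u: "(\<lambda>k. u k / of_nat (Suc k)) \<longlonglongrightarrow> u0" and v: "(\<lambda>k. v k / of_nat (Suc k)) \<longlonglongrightarrow> v0"
  shows "(\<lambda>k. beval F (u k) (v k) / of_nat (Suc k) ^ m) \<longlonglongrightarrow> beval F' u0 v0"
proof -
  let ?X = "\<lambda>k. of_nat (Suc k) :: complex"
  obtain C where C: "\<And>x y. cmod (beval (F - F') x y) \<le> C * (1 + cmod x + cmod y) ^ (m - 1)"
    using beval_growth[OF low] by blast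
  have X: "cmod (?X k) = real (Suc k)" "?X k \<noteq> 0" for k
    by (simp_all del: of_nat_Suc)
  have lim: "(\<lambda>k. beval F' (u k / ?X k) (v k / ?X k)) \<longlonglongrightarrow> beval F' u0 v0"
    by (intro tendsto_beval u v)
  have inv0: "(\<lambda>k. 1 / real (Suc k)) \<longlonglongrightarrow> 0"
    using LIMSEQ_inverse_real_of_nat by (simp add: inverse_eq_divide)
  have "(\<lambda>k. C * (1 / real (Suc k) + cmod (u k / ?X k) + cmod (v k / ?X k)) ^ (m - 1) * (1 / real
      (Suc k)))
      \<longlonglongrightarrow> C * (0 + cmod u0 + cmod v0) ^ (m - 1) * 0"
    by (intro tendsto_intros u v inv0)
  then have bound0: "(\<lambda>k. C * (1 / real (Suc k) + cmod (u k / ?X k) + cmod (v k / ?X k)) ^ (m - 1) *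
      (1 / real (Suc k))) \<longlonglongrightarrow> 0" by simp
  have le: "cmod (beval (F - F') (u k) (v k) / ?X k ^ m) \<le>
      C * (1 / real (Suc k) + cmod (u k / ?X k) + cmod (v k / ?X k)) ^ (m - 1) * (1 / real (Suc
          k))" for k
  proof -
    let ?x = "real (Suc k)"
    have x: "?x > 0" by simp
    have "cmod (beval (F - F') (u k) (v k)) \<le> C * (1 + cmod (u k) + cmod (v k)) ^ (m - 1)"
      by (rule C)
    also have "1 + cmod (u k) + cmod (v k) = ?x * (1 / ?x + cmod (u k / ?X k) + cmod (v k / ?X k))"
      using x by (simp add: norm_divide X distrib_left del: of_nat_Suc)
    finally have "cmod (beval (F - F') (u k) (v k)) / ?x ^ m \<le>
        C * (?x * (1 / ?x + cmod (u k / ?X k) + cmod (v k / ?X k))) ^ (m - 1) / ?x ^ m"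
      by (intro divide_right_mono) simp_all
    moreover have "cmod (beval (F - F') (u k) (v k) / ?X k ^ m) =
        cmod (beval (F - F') (u k) (v k)) / ?x ^ m"
      by (simp only: norm_divide norm_power X)
    ultimately show ?thesis
      using x m by (cases m) (simp_all add: power_mult_distrib mult_ac del: of_nat_Suc)
  qed
  have "(\<lambda>k. beval (F - F') (u k) (v k) / ?X k ^ m) \<longlonglongrightarrow> 0"
    by (rule Lim_null_comparison[OF always_eventually[OF allI[OF le]] bound0])
  from tendsto_add[OF lim this]
  have "(\<lambda>k. beval F' (u k / ?X k) (v k / ?X k) + beval (F - F') (u k) (v k) / ?X k ^ m)
      \<longlonglongrightarrow> beval F' u0 v0" by simp
  moreover have "beval F' (u k / ?X k) (v k / ?X k) + beval (F - F') (u k) (v k) / ?X k ^ m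
      = beval F (u k) (v k) / ?X k ^ m" for k
  proof -
    have "beval F' (u k) (v k) = ?X k ^ m * beval F' (u k / ?X k) (v k / ?X k)"
      using beval_homogeneous[OF form, of "?X k" "u k / ?X k" "v k / ?X k"] X(2)[of k]
      by (simp del: of_nat_Suc)
    then show ?thesis using X(2)[of k] by (simp add: field_simps del: of_nat_Suc)
  qed
  ultimately show ?thesis by simp
qed

lemma poly_degree_from_limit:
  fixes N :: "complex poly"
  assumes lim: "(\<lambda>k. poly N (of_nat (Suc k)) / of_nat (Suc k) ^ m) \<longlonglongrightarrow> L" and "L \<noteq> 0"
  shows "degree N = m" "lead_coeff N = L"
proof -
  let ?X = "\<lambda>k. of_nat (Suc k) :: complex"
  have "N \<noteq> 0"
    using assms by (auto simp: LIMSEQ_const_iff)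
  have X: "filterlim ?X at_infinity sequentially"
    by (rule filterlim_compose[OF tendsto_of_nat filterlim_Suc])
  have X0: "?X k \<noteq> 0" for k by (simp del: of_nat_Suc)
  have inv: "(\<lambda>k. inverse (?X k)) \<longlonglongrightarrow> 0"
    using filterlim_compose[OF tendsto_inverse_0 X] .
  have lc: "(\<lambda>k. poly N (?X k) / ?X k ^ degree N) \<longlonglongrightarrow> lead_coeff N"
    using filterlim_compose[OF poly_divide_tendsto_aux X] .
  have key: False
    if a: "(\<lambda>k. poly N (?X k) / ?X k ^ a) \<longlonglongrightarrow> A" and b: "(\<lambda>k. poly N (?X k) / ?X k ^ b) \<longlonglongrightarrow> B"
      and "B \<noteq> 0" "a < b" for a b A B
  proof -
    have "(\<lambda>k. poly N (?X k) / ?X k ^ a * inverse (?X k) ^ (b - a)) \<longlonglongrightarrow> A * 0 ^ (b - a)"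
      by (intro tendsto_intros a inv)
    moreover have "poly N (?X k) / ?X k ^ a * inverse (?X k) ^ (b - a) = poly N (?X k) / ?X k ^ b"
        for k
    proof -
      have "?X k ^ b = ?X k ^ a * ?X k ^ (b - a)"
        using \<open>a < b\<close> by (simp add: power_add[symmetric])
      then show ?thesis by (simp add: power_inverse divide_inverse)
    qed
    ultimately have "(\<lambda>k. poly N (?X k) / ?X k ^ b) \<longlonglongrightarrow> 0"
      using \<open>a < b\<close> by (simp add: zero_power)
    then show False using b \<open>B \<noteq> 0\<close> LIMSEQ_unique by blast
  qed
  show "degree N = m"
    using key[OF lim lc] key[OF lc lim] \<open>N \<noteq> 0\<close> \<open>L \<noteq> 0\<close>
    by (meson leading_coeff_0_iff linorder_neqE_nat)
  then show "lead_coeff N = L" using LIMSEQ_unique[OF lc] lim by simp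
qed

context isolated_form
begin

lemma form_lower_bound:
  "\<exists>m>0. \<forall>x y. m * (cmod x + cmod y) ^ n \<le> cmod (beval (dx Hh) x y) + cmod (beval (dy Hh) x y)"
proof -
  define f where "f z = cmod (beval (dx Hh) (fst z) (snd z)) + cmod (beval (dy Hh) (fst z) (snd
      z))" for z
  define S where "S = {z :: complex \<times> complex. cmod (fst z) + cmod (snd z) = 1}"
  have "closed S" unfolding S_def by (intro closed_Collect_eq continuous_intros)
  moreover have "S \<subseteq> cball 0 1 \<times> cball 0 1"
    by (auto simp: S_def) (metis add.commute add_increasing norm_ge_zero order_refl
      le_add_same_cancel1 le_add_same_cancel2)+
  then have "bounded S"
    by (rule bounded_subset[rotated]) (intro bounded_Times bounded_cball)
  ultimately have "compact S" by (simp add: compact_eq_bounded_closed)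
  moreover have "(1, 0) \<in> S" by (simp add: S_def)
  then have "S \<noteq> {}" by blast
  moreover have "continuous_on S f" unfolding f_def by (intro continuous_intros)
  ultimately obtain z0 where z0: "z0 \<in> S" "\<And>z. z \<in> S \<Longrightarrow> f z0 \<le> f z"
    using continuous_attains_inf by metis
  have "f z0 > 0"
  proof (rule ccontr)
    assume "\<not> f z0 > 0"
    then have "beval (dx Hh) (fst z0) (snd z0) = 0 \<and> beval (dy Hh) (fst z0) (snd z0) = 0"
      by (simp add: f_def add_nonneg_eq_0_iff not_less) (smt (verit) norm_ge_zero norm_le_zero_iff)
    then have "fst z0 = 0 \<and> snd z0 = 0" using no_common_zero by blast
    then show False using z0(1) by (simp add: S_def)
  qed
  moreover have "f z0 * (cmod x + cmod y) ^ n \<le> cmod (beval (dx Hh) x y) + cmod (beval (dy Hh) x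
      y)" for x y
  proof (cases "cmod x + cmod y = 0")
    case True
    then show ?thesis using n_pos by (simp add: zero_power)
  next
    case False
    define s where "s = cmod x + cmod y"
    have s: "s > 0" using False by (simp add: s_def order_less_le)
    let ?x = "x / of_real s" and ?y = "y / of_real s"
    have "(?x, ?y) \<in> S"
      using s by (simp add: S_def norm_divide add_divide_distrib[symmetric]) (simp add: s_def)
    then have "f z0 \<le> f (?x, ?y)" by (rule z0(2))
    then have "f z0 * s ^ n \<le> f (?x, ?y) * s ^ n" using s by (intro mult_right_mono) auto
    also have "\<dots> = cmod (beval (dx Hh) x y) + cmod (beval (dy Hh) x y)"
    proof -
      have "beval F x y = of_real s ^ n * beval F ?x ?y" if "homogeneous (int n) F" for F
        using beval_homogeneous[OF that, of "of_real s" ?x ?y] s by simp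
      then have "cmod (beval F x y) = s ^ n * cmod (beval F ?x ?y)" if "homogeneous (int n) F" for F
        using that s by (metis abs_of_pos norm_mult norm_of_real norm_power)
      then show ?thesis using dx_form dy_form by (simp add: f_def algebra_simps)
    qed
    finally show ?thesis by (simp add: s_def)
  qed
  ultimately show ?thesis by blast
qed

lemma dx_low: "tdeg_le n (H - Hh) \<Longrightarrow> tdeg_le (n - 1) (dx H - dx Hh)"
  and dy_low: "tdeg_le n (H - Hh) \<Longrightarrow> tdeg_le (n - 1) (dy H - dy Hh)"
proof -
  assume low: "tdeg_le n (H - Hh)"
  have "dx H - dx Hh = dx (H - Hh)" "dy H - dy Hh = dy (H - Hh)"
    by (rule bcoeff_eqI; simp add: algebra_simps)+
  then show "tdeg_le (n - 1) (dx H - dx Hh)" "tdeg_le (n - 1) (dy H - dy Hh)"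
    using tdeg_le_dx[OF low] tdeg_le_dy[OF low] by simp_all
qed

lemma gradient_lower_bound:
  assumes low: "tdeg_le n (H - Hh)"
  shows "\<exists>m>0. \<exists>R\<ge>1. \<forall>x y. R \<le> cmod x + cmod y \<longrightarrow>
    m * (cmod x + cmod y) ^ n \<le> cmod (beval (dx H) x y) + cmod (beval (dy H) x y)"
proof -
  obtain m where m: "m > 0" "\<And>x y. m * (cmod x + cmod y) ^ n \<le>
      cmod (beval (dx Hh) x y) + cmod (beval (dy Hh) x y)"
    using form_lower_bound by blast
  obtain C1 where C1: "C1 > 0" "\<And>x y. cmod (beval (dx H - dx Hh) x y) \<le>
      C1 * (1 + cmod x + cmod y) ^ (n - 1)"
    using beval_growth[OF dx_low[OF low]] by blast
  obtain C2 where C2: "C2 > 0" "\<And>x y. cmod (beval (dy H - dy Hh) x y) \<le>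
      C2 * (1 + cmod x + cmod y) ^ (n - 1)"
    using beval_growth[OF dy_low[OF low]] by blast
  define C where "C = (C1 + C2) * 2 ^ (n - 1)"
  have "C > 0" using C1(1) C2(1) by (simp add: C_def)
  \<comment> \<open>Beyond this radius the lower terms consume at most half of the bound for the
    form.\<close>
  define R where "R = max 1 (2 * C / m)"
  have "m / 2 * (cmod x + cmod y) ^ n \<le> cmod (beval (dx H) x y) + cmod (beval (dy H) x y)"
    if R: "R \<le> cmod x + cmod y" for x y
  proof -
    define s where "s = cmod x + cmod y"
    have s: "s \<ge> 1" "2 * C / m \<le> s" using R by (auto simp: R_def s_def)
    have "(1 + cmod x + cmod y) ^ (n - 1) \<le> (2 * s) ^ (n - 1)"
      using s(1) by (intro power_mono) (auto simp: s_def)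
    then have "(C1 + C2) * (1 + cmod x + cmod y) ^ (n - 1) \<le> C * s ^ (n - 1)"
      using C1(1) C2(1) by (simp add: C_def power_mult_distrib mult_left_mono mult.assoc)
    also have "\<dots> \<le> (m / 2 * s) * s ^ (n - 1)"
      using s m(1) by (intro mult_right_mono) (auto simp: field_simps)
    also have "\<dots> = m / 2 * s ^ n" using n_pos by (cases n) simp_all
    finally have err: "(C1 + C2) * (1 + cmod x + cmod y) ^ (n - 1) \<le> m / 2 * s ^ n" .
    have "cmod (beval (dx Hh) x y) \<le> cmod (beval (dx H) x y) + cmod (beval (dx H - dx Hh) x y)"
      "cmod (beval (dy Hh) x y) \<le> cmod (beval (dy H) x y) + cmod (beval (dy H - dy Hh) x y)"
      using norm_triangle_ineq4[of "beval (dx H) x y" "beval (dx H - dx Hh) x y"]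
        norm_triangle_ineq4[of "beval (dy H) x y" "beval (dy H - dy Hh) x y"] by simp_all
    with m(2)[of x y] C1(2)[of x y] C2(2)[of x y] err show ?thesis
      by (simp add: s_def algebra_simps)
  qed
  then show ?thesis using m(1) by (intro exI[of _ "m / 2"] conjI exI[of _ R]) (auto simp: R_def)
qed

text \<open>The points at infinity of the polar curve: on a branch far out \<open>y / x\<close> is
  close to an element of this set. It is the same for all lower terms of \<open>H\<close>.\<close>

definition directions :: "complex \<Rightarrow> complex set" where
  "directions l = {y. beval (dy Hh - bconst l * dx Hh) (1 - l * y) y = 0}"

lemma good_directions: "good l \<Longrightarrow> card (directions l) = n" "good l \<Longrightarrow> finite (directions l)"
  using n_pos by (auto simp: good_def directions_def intro: card_ge_0_finite)

lemma dx_directions_nonzero: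
  assumes "y \<in> directions l"
  shows "beval (dx Hh) (1 - l * y) y \<noteq> 0"
proof
  assume "beval (dx Hh) (1 - l * y) y = 0"
  moreover from this have "beval (dy Hh) (1 - l * y) y = 0"
    using assms by (simp add: directions_def)
  ultimately have "1 - l * y = 0 \<and> y = 0" by (rule no_common_zero)
  then show False by auto
qed

text \<open>\<open>root_near\<close> gives a root close to \<open>(k + 1) e\<close> for each
  direction \<open>e\<close>. As \<open>good l\<close> provides \<open>n\<close> distinct
  directions, these roots are eventually distinct and exhaust the fibre.\<close>

lemma asymptotic_branches:
  assumes low: "tdeg_le n (H - Hh)" and good: "good l"
  obtains Y where
    "\<And>e. e \<in> directions l \<Longrightarrow> (\<lambda>k. Y k e / of_nat (Suc k)) \<longlonglongrightarrow> e"
    "\<forall>\<^sub>F k in sequentially. bij_betw (Y k) (directions l)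
       {y. beval (dy (shear l H)) (of_nat (Suc k)) y = 0} \<and>
       card {y. beval (dy (shear l H)) (of_nat (Suc k)) y = 0} = n"
proof -
  define c where "c = of_nat (Suc n) * beval Hh (- l) 1"
  interpret polar_curve "shear l H" n c
    unfolding c_def using good by (intro shear_polar_curve[OF low]) (simp add: good_def)
  let ?X = "\<lambda>k. of_nat (Suc k) :: complex"
  let ?F = "dy H - bconst l * dx H" and ?F' = "dy Hh - bconst l * dx Hh"
  have form_F: "homogeneous (int n) ?F'"
    using dx_form dy_form unfolding homogeneous_def
    by (metis bcoeff_bconst_mult bcoeff_diff diff_zero mult_zero_right)
  have low_F: "tdeg_le (n - 1) (?F - ?F')"
  proof -
    have eq: "?F - ?F' = (dy H - dy Hh) - bconst l * (dx H - dx Hh)"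
      by (simp add: algebra_simps)
    have "tdeg_le (n - 1) (bconst l * (dx H - dx Hh))"
      using tdeg_le_mult[OF tdeg_le_bconst dx_low[OF low]] by simp
    then show ?thesis unfolding eq by (rule tdeg_le_diff[OF dy_low[OF low]])
  qed
  have X0: "?X k \<noteq> 0" for k by (simp del: of_nat_Suc)
  have "\<exists>r. r \<in> roots (?X k) \<and>
      cmod c * cmod (?X k * e - r) ^ n \<le> cmod (beval (dy (shear l H)) (?X k) (?X k * e))" for k e
    using root_near[of "?X k" "?X k * e"] by blast
  then obtain Y where Y: "\<And>k e. Y k e \<in> roots (?X k)"
      "\<And>k e. cmod c * cmod (?X k * e - Y k e) ^ n \<le> cmod (beval (dy (shear l H)) (?X k) (?X k * e))"
    by metis
  have lim: "(\<lambda>k. Y k e / ?X k) \<longlonglongrightarrow> e" if e: "e \<in> directions l" for e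
  proof -
    have "(\<lambda>k. (?X k - l * (?X k * e)) / ?X k) \<longlonglongrightarrow> 1 - l * e" "(\<lambda>k. (?X k * e) / ?X k) \<longlonglongrightarrow> e"
      using X0 by (simp_all add: diff_divide_distrib mult.left_commute[of l] del: of_nat_Suc)
    from beval_ray_limit[OF form_F n_pos low_F this]
    have lim0: "(\<lambda>k. beval (dy (shear l H)) (?X k) (?X k * e) / ?X k ^ n) \<longlonglongrightarrow> 0"
      using e by (simp add: dy_shear directions_def del: of_nat_Suc)
    have bound: "cmod c * cmod (e - Y k e / ?X k) ^ n \<le>
        cmod (beval (dy (shear l H)) (?X k) (?X k * e) / ?X k ^ n)" for k
    proof -
      have "e - Y k e / ?X k = (?X k * e - Y k e) / ?X k"
        using X0[of k] by (simp add: field_simps del: of_nat_Suc)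
      then have "cmod c * cmod (e - Y k e / ?X k) ^ n =
          cmod c * cmod (?X k * e - Y k e) ^ n / cmod (?X k) ^ n"
        by (simp add: norm_divide power_divide del: of_nat_Suc)
      also have "\<dots> \<le> cmod (beval (dy (shear l H)) (?X k) (?X k * e)) / cmod (?X k) ^ n"
        by (intro divide_right_mono Y(2)) simp
      finally show ?thesis by (simp add: norm_divide norm_power del: of_nat_Suc)
    qed
    show ?thesis
      by (rule tendsto_from_power_bound[OF _ n_pos bound lim0 tendsto_const]) (use c_nonzero in
          simp)
  qed
  have "\<forall>\<^sub>F k in sequentially. bij_betw (Y k) (directions l) (roots (?X k)) \<and> card (roots (?X k)) =
      n"
  proof -
    have "\<forall>\<^sub>F k in sequentially. \<forall>e\<in>directions l. \<forall>e'\<in>directions l. e \<noteq> e' \<longrightarrow> Y k e \<noteq> Y k e'"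
    proof (intro eventually_ball_finite good_directions(2)[OF good] ballI)
      fix e e' assume e: "e \<in> directions l" "e' \<in> directions l"
      show "\<forall>\<^sub>F k in sequentially. e \<noteq> e' \<longrightarrow> Y k e \<noteq> Y k e'"
      proof (cases "e = e'")
        case False
        have "(\<lambda>k. Y k e / ?X k - Y k e' / ?X k) \<longlonglongrightarrow> e - e'"
          by (intro tendsto_intros lim e)
        then have "\<forall>\<^sub>F k in sequentially. Y k e / ?X k - Y k e' / ?X k \<noteq> 0"
          using False by (intro tendsto_imp_eventually_ne) auto
        then show ?thesis by eventually_elim auto
      qed simp
    qed
    then show ?thesis
    proof eventually_elim
      case (elim k)
      then have inj: "inj_on (Y k) (directions l)" by (auto simp: inj_on_def)
      have sub: "Y k ` directions l \<subseteq> roots (?X k)" using Y(1) by blast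
      have "card (Y k ` directions l) = n" using inj good_directions(1)[OF good]
        by (simp add: card_image)
      then have "Y k ` directions l = roots (?X k)"
        using sub card_roots_le[of "?X k"] finite_roots[of "?X k"] by (intro card_seteq) auto
      then show ?case using inj \<open>card (Y k ` directions l) = n\<close> by (simp add: bij_betw_def)
    qed
  qed
  then show ?thesis using lim by (intro that[of Y]) (simp_all add: roots_def del: of_nat_Suc)
qed

text \<open>The roots of this norm are the abscissas of the critical points, n^2 in number as in
  Bezout's theorem. Each of the \<open>n\<close> factors grows like \<open>x^n\<close> times the
  nonzero value of \<open>Hh_x\<close> in its direction, so the lower terms of \<open>H\<close>
  affect neither the degree nor the leading coefficient.\<close>

lemma norm_poly_degree:
  assumes low: "tdeg_le n (H - Hh)" and good: "good l"
    and N: "\<And>x. card {y. beval (dy (shear l H)) x y = 0} = n \<Longrightarrow>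
      poly N x = (\<Prod>y | beval (dy (shear l H)) x y = 0. beval (dx (shear l H)) x y)"
  shows "degree N = n * n" "lead_coeff N = (\<Prod>e\<in>directions l. beval (dx Hh) (1 - l * e) e)"
proof -
  let ?X = "\<lambda>k. of_nat (Suc k) :: complex"
  have X0: "?X k \<noteq> 0" for k by (simp del: of_nat_Suc)
  let ?L = "\<Prod>e\<in>directions l. beval (dx Hh) (1 - l * e) e"
  obtain Y where Y: "\<And>e. e \<in> directions l \<Longrightarrow> (\<lambda>k. Y k e / ?X k) \<longlonglongrightarrow> e"
    "\<forall>\<^sub>F k in sequentially. bij_betw (Y k) (directions l)
       {y. beval (dy (shear l H)) (?X k) y = 0} \<and> card {y. beval (dy (shear l H)) (?X k) y = 0} = n"
    by (rule asymptotic_branches[OF low good], rule that)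
  have "(\<lambda>k. \<Prod>e\<in>directions l. beval (dx H) (?X k - l * Y k e) (Y k e) / ?X k ^ n) \<longlonglongrightarrow> ?L"
  proof (rule tendsto_prod)
    fix e assume e: "e \<in> directions l"
    have "(\<lambda>k. 1 - l * (Y k e / ?X k)) \<longlonglongrightarrow> 1 - l * e"
      by (intro tendsto_intros Y e)
    then have "(\<lambda>k. (?X k - l * Y k e) / ?X k) \<longlonglongrightarrow> 1 - l * e"
      using X0 by (simp add: diff_divide_distrib del: of_nat_Suc)
    then show "(\<lambda>k. beval (dx H) (?X k - l * Y k e) (Y k e) / ?X k ^ n) \<longlonglongrightarrow>
        beval (dx Hh) (1 - l * e) e"
      by (rule beval_ray_limit[OF dx_form n_pos dx_low[OF low] _ Y(1)[OF e]])
  qed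
  moreover have "\<forall>\<^sub>F k in sequentially.
      (\<Prod>e\<in>directions l. beval (dx H) (?X k - l * Y k e) (Y k e) / ?X k ^ n) =
          poly N (?X k) / ?X k ^ (n * n)"
    using Y(2)
  proof eventually_elim
    case (elim k)
    have "poly N (?X k) = (\<Prod>e\<in>directions l. beval (dx (shear l H)) (?X k) (Y k e))"
      using elim N[of "?X k"] prod.reindex_bij_betw[of "Y k"] by metis
    then show ?case
      using good_directions[OF good] by (simp add: dx_shear prod_dividef power_mult del: of_nat_Suc)
  qed
  ultimately have "(\<lambda>k. poly N (?X k) / ?X k ^ (n * n)) \<longlonglongrightarrow> ?L"
    by (rule Lim_transform_eventually)
  moreover have "?L \<noteq> 0"
    using dx_directions_nonzero good_directions(2)[OF good] by auto
  ultimately show "degree N = n * n" "lead_coeff N = ?L"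
    using poly_degree_from_limit by blast+
qed

end

section \<open>Translations and the Euler operator\<close>

lemma dx_translate: "dx (translate s t H) = translate s t (dx H)"
proof (rule dx_eqI)
  fix x y
  have "((\<lambda>x. x + s) has_field_derivative 1) (at x)"
    by (auto intro!: derivative_eq_intros)
  from beval_deriv_compose[of "\<lambda>x. x + s" 1 x "\<lambda>_. y + t" 0 H, OF this DERIV_const]
  show "((\<lambda>x. beval (translate s t H) x y) has_field_derivative beval (translate s t (dx H)) x y)
      (at x)"
    by (simp add: beval_translate)
qed

lemma dy_translate: "dy (translate s t H) = translate s t (dy H)"
proof (rule dy_eqI)
  fix x y
  have "((\<lambda>y. y + t) has_field_derivative 1) (at y)"
    by (auto intro!: derivative_eq_intros)
  from beval_deriv_compose[of "\<lambda>_. x + s" 0 y "\<lambda>y. y + t" 1 H, OF DERIV_const this]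
  show "((\<lambda>y. beval (translate s t H) x y) has_field_derivative beval (translate s t (dy H)) x y)
      (at y)"
    by (simp add: beval_translate)
qed

lemma bcoeff_bX_mult: "bcoeff (bX * F) i j = (if i = 0 then 0 else bcoeff F (i - 1) j)"
  by (simp add: bcoeff_def bX_def coeff_pCons split: nat.split)

lemma bcoeff_bY_mult: "bcoeff (bY * F) i j = (if j = 0 then 0 else bcoeff F i (j - 1))"
  by (simp add: bcoeff_def bY_def coeff_pCons split: nat.split)

text \<open>The Euler operator is diagonal on monomials, so this defect vanishes exactly for the
  forms of degree \<open>m\<close>.\<close>

lemma bcoeff_euler_defect:
  "bcoeff (bconst (of_nat m) * H - bX * dx H - bY * dy H) i j =
      (of_nat m - of_nat (i + j)) * bcoeff H i j"
  by (cases i; cases j; simp add: bcoeff_bX_mult bcoeff_bY_mult; simp add: algebra_simps)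

context isolated_form
begin

lemma ex_good_avoiding: "finite A \<Longrightarrow> \<exists>l. good l \<and> l \<notin> A"
proof -
  assume "finite A"
  then have "finite ({l. \<not> good l} \<union> A)" using finite_not_good by simp
  then obtain l where "l \<notin> {l. \<not> good l} \<union> A"
    using ex_new_if_finite[OF infinite_UNIV_char_0] by blast
  then show ?thesis by blast
qed

text \<open>On the curve \<open>H_y = l H_x\<close> the Euler defect \<open>G\<close> becomes
  \<open>(n + 1) H - x H_x\<close> with the sheared coordinate \<open>x\<close>. Its degree is at
  most \<open>n\<close> because the leading form cancels, while \<open>gradient_lower_bound\<close>
  makes \<open>H_x\<close> grow with the power \<open>n\<close>.\<close>

lemma polar_at_infinity:
  assumes low: "tdeg_le n (H - Hh)"
  shows "\<exists>B R. \<forall>x y. R \<le> cmod x \<longrightarrow> beval (dy (shear l H)) x y = 0 \<longrightarrow>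
    beval (dx (shear l H)) x y \<noteq> 0 \<and>
    cmod (of_nat (n + 1) * beval (shear l H) x y - x * beval (dx (shear l H)) x y)
      \<le> B * cmod (beval (dx (shear l H)) x y)"
proof -
  define G where "G = bconst (of_nat (n + 1)) * H - bX * dx H - bY * dy H"
  have "tdeg_le n G"
    unfolding tdeg_le_def
  proof (intro allI impI)
    fix i j assume "bcoeff G i j \<noteq> 0"
    then have "(of_nat (n + 1) - of_nat (i + j)) * bcoeff H i j \<noteq> 0"
      unfolding G_def bcoeff_euler_defect .
    then have nz: "i + j \<noteq> n + 1" "bcoeff H i j \<noteq> 0"
      by (metis diff_self mult_zero_left, metis mult_zero_right)
    show "i + j \<le> n"
    proof (rule ccontr)
      assume "\<not> i + j \<le> n"
      then have "bcoeff (H - Hh) i j = 0" using low unfolding tdeg_le_def by blast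
      then have "bcoeff Hh i j \<noteq> 0" using nz(2) by simp
      then show False using form nz(1) unfolding homogeneous_def by fastforce
    qed
  qed
  then obtain C where C: "C > 0" "\<And>x y. cmod (beval G x y) \<le> C * (1 + cmod x + cmod y) ^ n"
    using beval_growth by blast
  obtain m R where m: "m > 0" "R \<ge> 1" "\<And>x y. R \<le> cmod x + cmod y \<Longrightarrow>
      m * (cmod x + cmod y) ^ n \<le> cmod (beval (dx H) x y) + cmod (beval (dy H) x y)"
    using gradient_lower_bound[OF low] by blast
  \<comment> \<open>It serves twice: \<open>cmod x \<le> a * s\<close>, and on the curve the sum of
    the moduli of the partial derivatives is \<open>a\<close> times that of
    \<open>H_x\<close>.\<close>
  define a where "a = 1 + cmod l"
  have a: "a > 0" unfolding a_def by (simp add: add_pos_nonneg)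
  define B where "B = C * 2 ^ n * a / m"
  show ?thesis
  proof (intro exI allI impI)
    fix x y assume x: "a * R \<le> cmod x" and y: "beval (dy (shear l H)) x y = 0"
    define u where "u = x - l * y"
    define s where "s = cmod u + cmod y"
    have dy: "beval (dy H) u y = l * beval (dx H) u y"
      using y by (simp add: dy_shear u_def)
    have "cmod x \<le> cmod u + cmod l * cmod y"
      using norm_triangle_ineq[of u "l * y"] by (simp add: u_def norm_mult)
    also have "\<dots> \<le> a * s" by (simp add: a_def s_def algebra_simps)
    finally have "R \<le> s" using x a by (meson mult_le_cancel_left_pos order_trans)
    then have s: "s \<ge> 1" using m(2) by simp
    have "m * s ^ n \<le> a * cmod (beval (dx H) u y)"
      using m(3)[of u y] \<open>R \<le> s\<close> by (simp add: s_def a_def dy norm_mult algebra_simps)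
    moreover have "m * s ^ n > 0" using m(1) s by simp
    ultimately have "beval (dx H) u y \<noteq> 0" by auto
    have "of_nat (n + 1) * beval H u y - x * beval (dx H) u y = beval G u y"
    proof -
      have xu: "x = u + l * y" by (simp add: u_def)
      show ?thesis by (simp add: G_def dy xu algebra_simps)
    qed
    then have "cmod (of_nat (n + 1) * beval H u y - x * beval (dx H) u y) \<le>
        C * (1 + cmod u + cmod y) ^ n"
      using C(2) by simp
    also have "\<dots> \<le> C * (2 * s) ^ n"
      using C(1) s by (intro mult_left_mono power_mono) (auto simp: s_def)
    also have "\<dots> = (C * 2 ^ n / m) * (m * s ^ n)" using m(1) by (simp add: power_mult_distrib)
    also have "\<dots> \<le> (C * 2 ^ n / m) * (a * cmod (beval (dx H) u y))"
      using \<open>m * s ^ n \<le> a * cmod (beval (dx H) u y)\<close> C(1) m(1) by (intro mult_left_mono) auto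
    also have "\<dots> = B * cmod (beval (dx H) u y)" by (simp add: B_def)
    finally show "beval (dx (shear l H)) x y \<noteq> 0 \<and>
        cmod (of_nat (n + 1) * beval (shear l H) x y - x * beval (dx (shear l H)) x y)
        \<le> B * cmod (beval (dx (shear l H)) x y)"
      using \<open>beval (dx H) u y \<noteq> 0\<close> by (simp add: dx_shear u_def)
  qed
qed

lemma shear_finite_exceptional:
  assumes low: "tdeg_le n (H - Hh)" and good: "good l"
  shows "finite (polar_curve.exceptional (shear l H) n)"
    and "\<exists>x. card (polar_curve.roots (shear l H) x) = n"
proof -
  interpret polar_curve "shear l H" n "of_nat (Suc n) * beval Hh (- l) 1"
    using good by (intro shear_polar_curve[OF low]) (simp add: good_def)
  obtain Y where "\<And>e. e \<in> directions l \<Longrightarrow> (\<lambda>k. Y k e / of_nat (Suc k)) \<longlonglongrightarrow> e"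
    and Y: "\<forall>\<^sub>F k in sequentially. bij_betw (Y k) (directions l)
       {y. beval (dy (shear l H)) (of_nat (Suc k)) y = 0} \<and>
       card {y. beval (dy (shear l H)) (of_nat (Suc k)) y = 0} = n"
    by (rule asymptotic_branches[OF low good], rule that)
  obtain k where k: "card {y. beval (dy (shear l H)) (of_nat (Suc k)) y = 0} = n"
    using eventually_happens[OF Y] by auto
  then show "\<exists>x. card (roots x) = n" unfolding roots_def by blast
  obtain R where R: "\<And>x y. R \<le> cmod x \<Longrightarrow> beval (dy (shear l H)) x y = 0 \<Longrightarrow>
      beval (dx (shear l H)) x y \<noteq> 0"
    using polar_at_infinity[OF low] by blast
  show "finite exceptional"
  proof (rule finite_exceptional)
    show "card (roots (of_nat (Suc k))) = n" using k by (simp add: roots_def)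
    show "beval (dx (shear l H)) (of_real \<bar>R\<bar>) y \<noteq> 0" if "y \<in> roots (of_real \<bar>R\<bar>)" for y
      using that by (intro R) (auto simp: roots_def)
  qed
qed

lemma critical_points_subset:
  "{(a, b). beval (dx H) a b = 0 \<and> beval (dy H) a b = 0} \<subseteq>
    (\<lambda>(x, y). (x - l * y, y)) ` (SIGMA x:polar_curve.exceptional (shear l H) n. polar_curve.roots
        (shear l H) x)"
  if low: "tdeg_le n (H - Hh)" and good: "good l"
proof (clarify)
  fix a b assume ab: "beval (dx H) a b = 0" "beval (dy H) a b = 0"
  interpret polar_curve "shear l H" n "of_nat (Suc n) * beval Hh (- l) 1"
    using good by (intro shear_polar_curve[OF low]) (simp add: good_def)
  have "b \<in> roots (a + l * b)" "beval (dx (shear l H)) (a + l * b) b = 0"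
    using ab by (simp_all add: roots_def dy_shear dx_shear)
  then have "(a + l * b, b) \<in> (SIGMA x:exceptional. roots x)" by (auto simp: exceptional_def)
  then show "(a, b) \<in> (\<lambda>(x, y). (x - l * y, y)) ` (SIGMA x:exceptional. roots x)"
    by (intro image_eqI[of _ _ "(a + l * b, b)"]) auto
qed

lemma finite_critical_points:
  assumes low: "tdeg_le n (H - Hh)"
  shows "finite {(a, b). beval (dx H) a b = 0 \<and> beval (dy H) a b = 0}"
proof -
  obtain l where l: "good l" using ex_good_avoiding[of "{}"] by auto
  interpret polar_curve "shear l H" n "of_nat (Suc n) * beval Hh (- l) 1"
    using l by (intro shear_polar_curve[OF low]) (simp add: good_def)
  have "finite ((\<lambda>(x, y). (x - l * y, y)) ` (SIGMA x:exceptional. roots x))"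
    using shear_finite_exceptional(1)[OF low l] finite_roots
    by (intro finite_imageI finite_SigmaI) auto
  then show ?thesis by (rule finite_subset[OF critical_points_subset[OF low l]])
qed

text \<open>A regular fibre of the polar curve of another good slope \<open>g\<close> has points
  with \<open>H_x \<noteq> 0\<close>, and there \<open>H_y - l H_x\<close> equals
  \<open>(g - l) H_x\<close>.\<close>

lemma polar_forms_nonzero:
  assumes low: "tdeg_le n (H - Hh)"
  shows "dx H \<noteq> 0" and "dy H - bconst l * dx H \<noteq> 0"
proof -
  obtain g where g: "good g" "g \<noteq> l" using ex_good_avoiding[of "{l}"] by auto
  interpret polar_curve "shear g H" n "of_nat (Suc n) * beval Hh (- g) 1"
    using g by (intro shear_polar_curve[OF low]) (simp add: good_def)
  obtain x where x: "x \<notin> exceptional"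
    using ex_new_if_finite[OF infinite_UNIV_char_0 shear_finite_exceptional(1)[OF low g(1)]] by
        blast
  obtain y where y: "y \<in> roots x" using roots_nonempty by blast
  then have nz: "beval (dx H) (x - g * y) y \<noteq> 0"
    using x by (auto simp: exceptional_def dx_shear)
  then show "dx H \<noteq> 0" by auto
  have "beval (dy H) (x - g * y) y = g * beval (dx H) (x - g * y) y"
    using y by (simp add: roots_def dy_shear)
  then have "beval (dy H - bconst l * dx H) (x - g * y) y \<noteq> 0"
    using nz g(2) by simp
  then show "dy H - bconst l * dx H \<noteq> 0" by auto
qed

theorem homogeneous_about_critical_point:
  assumes low: "tdeg_le n (H - Hh)"
    and crit: "\<And>x y. beval (dx H) x y = 0 \<Longrightarrow> beval (dy H) x y = 0 \<Longrightarrow> beval H x y = 0"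
  shows "\<exists>a b. bconst (of_nat (n + 1)) * H = (bX - bconst a) * dx H + (bY - bconst b) * dy H"
proof -
  define S where "S = {(a, b). beval (dx H) a b = 0 \<and> beval (dy H) a b = 0}"
  have finS: "finite S" unfolding S_def by (rule finite_critical_points[OF low])
  define \<Phi> where "\<Phi> = (\<lambda>(a, b). bconst (of_nat (n + 1)) * H - ((bX - bconst a) * dx H + (bY -
      bconst b) * dy H))"
  have zero: "\<exists>p\<in>S. beval (\<Phi> p) x y = 0" if l: "good l" and xy: "beval (dy H) x y =
      l * beval (dx H) x y" for l x y
  proof -
    interpret polar_curve "shear l H" n "of_nat (Suc n) * beval Hh (- l) 1"
      using l by (intro shear_polar_curve[OF low]) (simp add: good_def)
    interpret nilpotent_polar_curve "shear l H" n "of_nat (Suc n) * beval Hh (- l) 1"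
    proof
      show "beval (shear l H) x y = 0"
        if "beval (dx (shear l H)) x y = 0" "beval (dy (shear l H)) x y = 0" for x y
        using that crit[of "x - l * y" y] by (simp add: dx_shear dy_shear)
      show "\<exists>x. card (roots x) = n" by (rule shear_finite_exceptional(2)[OF low l])
      show "\<exists>B R. \<forall>x y. R \<le> cmod x \<longrightarrow> y \<in> roots x \<longrightarrow> beval (dx (shear l H)) x y \<noteq> 0 \<and>
        cmod (of_nat (n + 1) * beval (shear l H) x y - x * beval (dx (shear l H)) x y)
          \<le> B * cmod (beval (dx (shear l H)) x y)"
        using polar_at_infinity[OF low] by (simp only: roots_def mem_Collect_eq)
    qed
    have "beval (dy (shear l H)) (x + l * y) y = 0" using xy by (simp add: dy_shear)
    from polar_point_critical_point[OF this] obtain a b where ab: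
        "beval (dx (shear l H)) a b = 0" "beval (dy (shear l H)) a b = 0"
        "of_nat (n + 1) * beval (shear l H) (x + l * y) y =
          (x + l * y - a) * beval (dx (shear l H)) (x + l * y) y"
      by blast
    have "(a - l * b, b) \<in> S" using ab(1,2) by (simp add: S_def dx_shear dy_shear)
    moreover have "beval (\<Phi> (a - l * b, b)) x y = 0"
      using ab(3) xy by (simp add: \<Phi>_def dx_shear algebra_simps)
    ultimately show ?thesis by blast
  qed
  \<comment> \<open>Every point is killed by some factor: \<open>H_x\<close> where this vanishes,
    otherwise some \<open>\<Phi> p\<close> if the slope \<open>H_y / H_x\<close> is good, and the
    last product at the finitely many bad slopes. In an integral domain one factor is 0, and
    \<open>polar_forms_nonzero\<close> leaves a \<open>\<Phi> p\<close>.\<close>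
  define Z where "Z = (\<Prod>p\<in>S. \<Phi> p) * dx H * (\<Prod>l\<in>{l. \<not> good l}. (dy H - bconst l * dx H))"
  have "Z = 0"
  proof (rule beval_eqI)
    fix x y
    show "beval Z x y = beval 0 x y"
    proof (cases "beval (dx H) x y = 0")
      case False
      define l where "l = beval (dy H) x y / beval (dx H) x y"
      have l: "beval (dy H) x y = l * beval (dx H) x y" using False by (simp add: l_def)
      show ?thesis
      proof (cases "good l")
        case True
        then have "(\<Prod>p\<in>S. beval (\<Phi> p) x y) = 0"
          using zero[OF True l] finS by (auto intro: prod_zero)
        then show ?thesis by (simp add: Z_def)
      next
        case False
        then have "(\<Prod>l\<in>{l. \<not> good l}. (beval (dy H) x y - l * beval (dx H) x y)) = 0"
          using l finite_not_good by (intro prod_zero) auto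
        then show ?thesis by (simp add: Z_def)
      qed
    qed (simp add: Z_def)
  qed
  then obtain p where "p \<in> S" "\<Phi> p = 0"
    using polar_forms_nonzero[OF low] finS finite_not_good by (auto simp: Z_def)
  then show ?thesis by (cases p) (auto simp: \<Phi>_def)
qed

text \<open>After moving the centre to the origin the Euler defect is 0, so the translate is
  homogeneous; the limits along rays through the origin identify it with \<open>Hh\<close>.\<close>

corollary translate_eq_form:
  assumes low: "tdeg_le n (H - Hh)"
    and crit: "\<And>x y. beval (dx H) x y = 0 \<Longrightarrow> beval (dy H) x y = 0 \<Longrightarrow> beval H x y = 0"
  shows "\<exists>a b. translate a b H = Hh"
proof -
  obtain a b where ab: "bconst (of_nat (n + 1)) * H =
      (bX - bconst a) * dx H + (bY - bconst b) * dy H"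
    using homogeneous_about_critical_point[OF assms] by blast
  define T where "T = translate a b H"
  have "bconst (of_nat (n + 1)) * T - bX * dx T - bY * dy T = 0"
  proof (rule beval_eqI)
    fix x y
    show "beval (bconst (of_nat (n + 1)) * T - bX * dx T - bY * dy T) x y = beval 0 x y"
      using arg_cong[OF ab, of "\<lambda>F. beval F (x + a) (y + b)"]
      by (simp add: T_def dx_translate dy_translate beval_translate)
  qed
  then have "(of_nat (n + 1) - of_nat (i + j)) * bcoeff T i j = 0" for i j
    using bcoeff_euler_defect[of "n + 1" T i j] by simp
  then have "n + 1 = i + j" if "bcoeff T i j \<noteq> 0" for i j
    using that by (metis mult_eq_0_iff of_nat_eq_iff right_minus_eq)
  then have formT: "homogeneous (int (Suc n)) T"
    unfolding homogeneous_def by (metis Suc_eq_plus1 of_nat_add)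
  have "T = Hh"
  proof (rule beval_eqI)
    fix x y
    let ?X = "\<lambda>k. of_nat (Suc k) :: complex"
    have X0: "?X k \<noteq> 0" for k by (simp del: of_nat_Suc)
    have inv: "(\<lambda>k. inverse (?X k)) \<longlonglongrightarrow> 0"
      using filterlim_compose[OF tendsto_inverse_0 filterlim_compose[OF tendsto_of_nat
          filterlim_Suc]] .
    have lim: "(\<lambda>k. (?X k * z + w) / ?X k) \<longlonglongrightarrow> z" for z w
    proof -
      have "(\<lambda>k. z + w * inverse (?X k)) \<longlonglongrightarrow> z + w * 0" by (intro tendsto_intros inv)
      moreover have "(?X k * z + w) / ?X k = z + w * inverse (?X k)" for k
        using X0[of k] by (simp add: field_simps del: of_nat_Suc)
      ultimately show ?thesis by simp
    qed
    have "(\<lambda>k. beval H (?X k * x + a) (?X k * y + b) / ?X k ^ Suc n) \<longlonglongrightarrow> beval Hh x y"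
      using low by (intro beval_ray_limit[OF form _ _ lim lim]) auto
    moreover have "beval H (?X k * x + a) (?X k * y + b) / ?X k ^ Suc n = beval T x y" for k
      using beval_homogeneous[OF formT, of "?X k" x y] X0[of k]
      by (simp add: T_def beval_translate del: of_nat_Suc power_Suc)
    ultimately show "beval T x y = beval Hh x y" by (simp add: LIMSEQ_const_iff)
  qed
  then show ?thesis by (auto simp: T_def)
qed

end

section \<open>Coefficientwise convergence\<close>

lemma ex_tdeg_le: "\<exists>m. tdeg_le m F"
proof -
  let ?S = "{(i, j). bcoeff F i j \<noteq> 0}"
  have "finite ((\<lambda>(i, j). i + j) ` ?S)" by (intro finite_imageI finite_bcoeff_nonzero)
  then obtain m where "\<forall>k\<in>(\<lambda>(i, j). i + j) ` ?S. k \<le> m"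
    using finite_nat_set_iff_bounded_le by blast
  then show ?thesis by (intro exI[of _ m]) (auto simp: tdeg_le_def)
qed

lemma pnorm_eq:
  assumes "tdeg_le m F"
  shows "pnorm F = (\<Sum>i\<le>m. \<Sum>j\<le>m. cmod (bcoeff F i j))"
proof -
  have "pnorm F = (\<Sum>(i, j)\<in>{..m} \<times> {..m}. cmod (bcoeff F i j))"
    unfolding pnorm_def using tdeg_leD[OF assms] by (intro sum.mono_neutral_left) auto
  then show ?thesis by (simp add: sum.cartesian_product)
qed

lemma pnorm_nonneg: "pnorm F \<ge> 0"
  by (auto simp: pnorm_def intro!: sum_nonneg)

lemma pnorm_0 [simp]: "pnorm 0 = 0"
  by (simp add: pnorm_def)

lemma bcoeff_le_pnorm: "cmod (bcoeff F i j) \<le> pnorm F"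
proof (cases "bcoeff F i j = 0")
  case False
  then have "cmod (case (i, j) of (i, j) \<Rightarrow> bcoeff F i j) \<le> pnorm F"
    unfolding pnorm_def
    by (intro order_trans[OF _ member_le_sum[of "(i, j)"]] finite_bcoeff_nonzero) auto
  then show ?thesis by simp
qed (simp add: pnorm_nonneg)

text \<open>Convergence in the finite-dimensional space of polynomials of degree at most
  \<open>m\<close>; the common degree bound makes evaluations and norms converge.\<close>

definition bconv :: "nat \<Rightarrow> (nat \<Rightarrow> bipoly) \<Rightarrow> bipoly \<Rightarrow> bool" where
  "bconv m Fk F \<longleftrightarrow> (\<forall>k. tdeg_le m (Fk k)) \<and> tdeg_le m F \<and>
     (\<forall>i j. (\<lambda>k. bcoeff (Fk k) i j) \<longlonglongrightarrow> bcoeff F i j)"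

lemma bconvD:
  assumes "bconv m Fk F"
  shows "tdeg_le m (Fk k)" "tdeg_le m F" "(\<lambda>k. bcoeff (Fk k) i j) \<longlonglongrightarrow> bcoeff F i j"
  using assms by (auto simp: bconv_def)

lemma beval_expand_tdeg:
  "tdeg_le m F \<Longrightarrow> beval F x y = (\<Sum>i\<le>m. \<Sum>j\<le>m. bcoeff F i j * x ^ i * y ^ j)"
  by (intro beval_expand) (rule tdeg_leD)

lemma bconv_beval:
  assumes "bconv m Fk F" "X \<longlonglongrightarrow> x" "Y \<longlonglongrightarrow> y"
  shows "(\<lambda>k. beval (Fk k) (X k) (Y k)) \<longlonglongrightarrow> beval F x y"
  unfolding beval_expand_tdeg[OF bconvD(1)[OF assms(1)]] beval_expand_tdeg[OF bconvD(2)[OF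
      assms(1)]]
  by (intro tendsto_intros bconvD(3)[OF assms(1)] assms(2,3))

lemma bconv_pnorm:
  assumes "bconv m Fk F"
  shows "(\<lambda>k. pnorm (Fk k)) \<longlonglongrightarrow> pnorm F"
  unfolding pnorm_eq[OF bconvD(1)[OF assms]] pnorm_eq[OF bconvD(2)[OF assms]]
  by (intro tendsto_intros bconvD(3)[OF assms])

lemma bconv_dx: "bconv m Fk F \<Longrightarrow> bconv (m - 1) (\<lambda>k. dx (Fk k)) (dx F)"
  and bconv_dy: "bconv m Fk F \<Longrightarrow> bconv (m - 1) (\<lambda>k. dy (Fk k)) (dy F)"
  unfolding bconv_def by (auto intro!: tdeg_le_dx tdeg_le_dy tendsto_intros simp del: One_nat_def)

lemma bconv_diff_const:
  "bconv m Fk F \<Longrightarrow> tdeg_le m G \<Longrightarrow> bconv m (\<lambda>k. Fk k - G) (F - G)"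
  unfolding bconv_def by (auto intro!: tdeg_le_diff tendsto_intros)

lemma bcoeff_bsubst:
  assumes "tdeg_le m H"
  shows "bcoeff (bsubst U V H) i j = (\<Sum>a\<le>m. \<Sum>b\<le>m. bcoeff H a b * bcoeff (U ^ a * V ^ b) i j)"
proof -
  have "bsubst U V H = (\<Sum>a\<le>m. \<Sum>b\<le>m. bconst (bcoeff H a b) * (U ^ a * V ^ b))"
    by (rule beval_eqI) (simp add: beval_expand_tdeg[OF assms] mult.assoc)
  then show ?thesis by simp
qed

lemma bconv_bsubst:
  assumes "bconv m Fk F" "tdeg_le 1 U" "tdeg_le 1 V"
  shows "bconv m (\<lambda>k. bsubst U V (Fk k)) (bsubst U V F)"
  unfolding bconv_def
proof (intro conjI allI)
  fix i j
  show "(\<lambda>k. bcoeff (bsubst U V (Fk k)) i j) \<longlonglongrightarrow> bcoeff (bsubst U V F) i j"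
    unfolding bcoeff_bsubst[OF bconvD(1)[OF assms(1)]] bcoeff_bsubst[OF bconvD(2)[OF assms(1)]]
    by (intro tendsto_intros bconvD(3)[OF assms(1)])
qed (use bconvD(1,2)[OF assms(1)] assms(2,3) in \<open>auto intro!: tdeg_le_bsubst\<close>)

lemma tdeg_le_affine: "tdeg_le 1 (bX + bconst s)" "tdeg_le 1 (bY + bconst s)"
  "tdeg_le 1 (bX - bconst l * bY)"
proof -
  have "tdeg_le (0 + 1) (bconst l * bY)"
    by (intro tdeg_le_mult tdeg_le_bconst tdeg_le_bY)
  then show "tdeg_le 1 (bX - bconst l * bY)"
    by (intro tdeg_le_diff tdeg_le_bX) simp
  show "tdeg_le 1 (bX + bconst s)"
    by (intro tdeg_le_add tdeg_le_bX tdeg_le_mono[OF tdeg_le_bconst]) simp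
  show "tdeg_le 1 (bY + bconst s)"
    by (intro tdeg_le_add tdeg_le_bY tdeg_le_mono[OF tdeg_le_bconst]) simp
qed

lemma translate_eq_bsubst: "translate s t = bsubst (bX + bconst s) (bY + bconst t)"
  by (intro ext beval_eqI) (simp add: beval_translate)

lemma bconv_translate: "bconv m Fk F \<Longrightarrow> bconv m (\<lambda>k. translate s t (Fk k)) (translate s t F)"
  unfolding translate_eq_bsubst by (rule bconv_bsubst[OF _ tdeg_le_affine(1,2)])

lemma bconv_shear: "bconv m Fk F \<Longrightarrow> bconv m (\<lambda>k. shear l (Fk k)) (shear l F)"
  unfolding shear_def by (rule bconv_bsubst[OF _ tdeg_le_affine(3) tdeg_le_bY])

lemma finite_family_convergent_subseq:
  fixes f :: "nat \<Rightarrow> 'a \<Rightarrow> complex"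
  assumes "finite I" "\<And>p k. p \<in> I \<Longrightarrow> cmod (f k p) \<le> B"
  shows "\<exists>r. strict_mono (r :: nat \<Rightarrow> nat) \<and> (\<forall>p\<in>I. \<exists>l. (\<lambda>k. f (r k) p) \<longlonglongrightarrow> l)"
  using assms
proof (induction I rule: finite_induct)
  case empty
  then show ?case by (intro exI[of _ "\<lambda>k. k"]) (auto simp: strict_mono_def)
next
  case (insert q I)
  then obtain r where r: "strict_mono r" "\<forall>p\<in>I. \<exists>l. (\<lambda>k. f (r k) p) \<longlonglongrightarrow> l"
    by auto
  have "\<forall>k. f (r k) q \<in> cball 0 B" using insert.prems by simp
  then obtain l r' where r': "strict_mono (r' :: nat \<Rightarrow> nat)" "((\<lambda>k. f (r k) q) \<circ> r') \<longlonglongrightarrow> l"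
    using compact_cball[of "0 :: complex" B] unfolding compact_def by meson
  have "\<exists>l. (\<lambda>k. f ((r \<circ> r') k) p) \<longlonglongrightarrow> l" if "p \<in> insert q I" for p
  proof (cases "p = q")
    case True
    then show ?thesis using r'(2) by (auto simp: o_def)
  next
    case False
    then have "p \<in> I" using that by simp
    then obtain l where "(\<lambda>k. f (r k) p) \<longlonglongrightarrow> l" using r(2) by blast
    from LIMSEQ_subseq_LIMSEQ[OF this r'(1)] show ?thesis by (auto simp: o_def)
  qed
  then show ?case using strict_mono_o[OF r(1) r'(1)] by blast
qed

lemma bconv_subseq_exists:
  assumes "\<And>k. tdeg_le m (Fk k)" "\<And>k. pnorm (Fk k) \<le> B"
  obtains r F where "strict_mono (r :: nat \<Rightarrow> nat)" "bconv m (\<lambda>k. Fk (r k)) F"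
proof -
  have "\<exists>r. strict_mono (r :: nat \<Rightarrow> nat) \<and>
      (\<forall>p\<in>{..m} \<times> {..m}. \<exists>l. (\<lambda>k. bcoeff (Fk (r k)) (fst p) (snd p)) \<longlonglongrightarrow> l)"
    by (rule finite_family_convergent_subseq[where B = B])
      (auto intro: order_trans[OF bcoeff_le_pnorm assms(2)])
  then obtain r g where r: "strict_mono (r :: nat \<Rightarrow> nat)" and
      g: "\<And>p. p \<in> {..m} \<times> {..m} \<Longrightarrow> (\<lambda>k. bcoeff (Fk (r k)) (fst p) (snd p)) \<longlonglongrightarrow> g p"
    by metis
  define F where "F = (\<Sum>i\<le>m. \<Sum>j\<le>m. monom (monom (g (i, j)) i) j)"
  have coeff_F: "bcoeff F a b = (if a \<le> m \<and> b \<le> m then g (a, b) else 0)" for a b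
  proof -
    have "bcoeff F a b = (\<Sum>i\<le>m. \<Sum>j\<le>m. if j = b then (if i = a then g (i, j) else 0) else 0)"
      unfolding F_def by (simp add: bcoeff_monom) (intro sum.cong refl; auto)
    also have "\<dots> = (if b \<le> m then (if a \<le> m then g (a, b) else 0) else 0)"
      by (simp add: sum.delta)
    finally show ?thesis by auto
  qed
  have lim: "(\<lambda>k. bcoeff (Fk (r k)) i j) \<longlonglongrightarrow> bcoeff F i j" for i j
  proof (cases "i \<le> m \<and> j \<le> m")
    case True
    then show ?thesis using g[of "(i, j)"] coeff_F by simp
  next
    case False
    then have "bcoeff (Fk (r k)) i j = 0" for k
      using tdeg_leD[OF assms(1)[of "r k"], of i j] by blast
    then show ?thesis using False by (auto simp: coeff_F)
  qed
  have "tdeg_le m F"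
    unfolding tdeg_le_def
  proof (intro allI impI, rule ccontr)
    fix i j assume nz: "bcoeff F i j \<noteq> 0" and ij: "\<not> i + j \<le> m"
    have "bcoeff (Fk (r k)) i j = 0" for k
      using assms(1)[of "r k"] ij unfolding tdeg_le_def by blast
    then have "(\<lambda>_. 0) \<longlonglongrightarrow> bcoeff F i j" using lim[of i j] by simp
    then show False using nz by (simp add: LIMSEQ_const_iff)
  qed
  then have "bconv m (\<lambda>k. Fk (r k)) F"
    unfolding bconv_def using assms(1) lim by blast
  with r show ?thesis by (rule that)
qed

lemma tendsto_imp_cmod_bounded:
  fixes f :: "nat \<Rightarrow> complex"
  assumes "f \<longlonglongrightarrow> l"
  shows "\<exists>b. \<forall>k. cmod (f k) \<le> b"
proof -
  have "Bseq f" by (rule convergent_imp_Bseq[OF convergentI[OF assms]])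
  then show ?thesis unfolding Bseq_def by blast
qed

lemma bconv_bounded:
  assumes "bconv m Fk F" "X \<longlonglongrightarrow> x"
  shows "\<exists>B. \<forall>k y. cmod y \<le> M \<longrightarrow> cmod (beval (Fk k) (X k) y) \<le> B"
proof -
  have "\<exists>b. \<forall>k. cmod (bcoeff (Fk k) i j * X k ^ i) \<le> b" for i j
  proof -
    have "(\<lambda>k. bcoeff (Fk k) i j * X k ^ i) \<longlonglongrightarrow> bcoeff F i j * x ^ i"
      by (intro tendsto_intros bconvD(3)[OF assms(1)] assms(2))
    then show ?thesis by (rule tendsto_imp_cmod_bounded)
  qed
  then obtain b where b: "\<And>i j k. cmod (bcoeff (Fk k) i j * X k ^ i) \<le> b i j" by metis
  have "cmod (beval (Fk k) (X k) y) \<le> (\<Sum>i\<le>m. \<Sum>j\<le>m. b i j * M ^ j)" if y: "cmod y \<le> M" for k y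
    unfolding beval_expand_tdeg[OF bconvD(1)[OF assms(1)]]
  proof (intro order_trans[OF norm_sum] sum_mono)
    fix i j
    have "cmod (bcoeff (Fk k) i j * X k ^ i) * cmod y ^ j \<le> b i j * M ^ j"
      using b[of k i j] y norm_ge_zero order_trans[OF norm_ge_zero b]
      by (intro mult_mono power_mono) auto
    then show "cmod (bcoeff (Fk k) i j * X k ^ i * y ^ j) \<le> b i j * M ^ j"
      by (simp add: norm_mult norm_power)
  qed
  then show ?thesis by blast
qed

lemma bconv_coeff_bounded:
  assumes "bconv m Fk F" "X \<longlonglongrightarrow> x"
  shows "\<exists>B. \<forall>k. cmod (poly (coeff (Fk k) j) (X k)) \<le> B"
proof -
  have ex: "poly (coeff G j) z = (\<Sum>i\<le>m. bcoeff G i j * z ^ i)" if "tdeg_le m G" for G z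
  proof -
    have "degree (coeff G j) \<le> m"
      using tdeg_leD[OF that] by (intro degree_le) (force simp: bcoeff_def)
    then show ?thesis
      unfolding bcoeff_def by (rule poly_as_sum_of_monoms'[THEN arg_cong[of _ _ "\<lambda>p. poly p z"],
        simplified poly_sum poly_monom, symmetric])
  qed
  have "(\<lambda>k. poly (coeff (Fk k) j) (X k)) \<longlonglongrightarrow> (\<Sum>i\<le>m. bcoeff F i j * x ^ i)"
    unfolding ex[OF bconvD(1)[OF assms(1)]]
    by (intro tendsto_intros bconvD(3)[OF assms(1)] assms(2))
  then show ?thesis by (rule tendsto_imp_cmod_bounded)
qed

section \<open>Critical points under coefficientwise limits\<close>

context isolated_form
begin

text \<open>Critical points cannot be lost in a limit. The norms \<open>N k\<close> of
  \<open>K_x\<close> share their degree and leading coefficient; along \<open>X\<close>, which tends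
  to \<open>a + l b\<close>, one factor of \<open>N k\<close> tends to 0 and the others stay
  bounded, so \<open>N k\<close> has a root nearby, over which lies a critical point of
  \<open>Gk k\<close>. This controls the value of \<open>x + l y\<close> alone, so
  \<open>(a', b')\<close> may be another point of the same line.\<close>

lemma critical_point_approx_shear:
  assumes low: "\<And>k. tdeg_le n (Gk k - Hh)" and lowG: "tdeg_le n (G - Hh)"
    and conv: "bconv (Suc n) Gk G" and good: "good l"
    and crit: "beval (dx G) a b = 0" "beval (dy G) a b = 0"
  shows "\<exists>A B a' b'. (\<forall>k. beval (dx (Gk k)) (A k) (B k) = 0 \<and> beval (dy (Gk k)) (A k) (B k) = 0) \<and>
    (\<exists>r. strict_mono (r :: nat \<Rightarrow> nat) \<and> (A \<circ> r) \<longlonglongrightarrow> a' \<and> (B \<circ> r) \<longlonglongrightarrow> b') \<and> a' + l * b' = a + l * b"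
proof -
  define c where "c = of_nat (Suc n) * beval Hh (- l) 1"
  define Kk where "Kk k = shear l (Gk k)" for k
  define K where "K = shear l G"
  define x0 where "x0 = a + l * b"
  have pc: "polar_curve (Kk k) n c" for k
    unfolding Kk_def c_def using good by (intro shear_polar_curve[OF low]) (simp add: good_def)
  have "polar_curve K n c"
    unfolding K_def c_def using good by (intro shear_polar_curve[OF lowG]) (simp add: good_def)
  then have c0: "c \<noteq> 0" by (rule polar_curve.c_nonzero)
  let ?roots = "\<lambda>k x. polar_curve.roots (Kk k) x"
  have convK: "bconv (Suc n) Kk K" unfolding Kk_def K_def by (rule bconv_shear[OF conv])
  note convx = bconv_dx[OF convK] and convy = bconv_dy[OF convK]
  have critK: "beval (dx K) x0 b = 0" "beval (dy K) x0 b = 0"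
    using crit by (simp_all add: K_def x0_def dx_shear dy_shear)
  have fin: "finite {x. card (?roots k x) \<noteq> n}" for k
    using polar_curve.finite_card_roots_neq[OF pc] shear_finite_exceptional(2)[OF low good]
    unfolding Kk_def by blast
  \<comment> \<open>Avoiding the ramified fibres makes the product formula for \<open>N k\<close>
    available at \<open>X k\<close>.\<close>
  obtain X where "X \<longlonglongrightarrow> x0" "\<And>k. X k \<notin> {x. card (?roots k x) \<noteq> n}"
    by (rule ex_sequence_avoiding_finite[OF fin], rule that)
  then have X: "X \<longlonglongrightarrow> x0" "\<And>k. card (?roots k (X k)) = n" by simp_all
  have root_bound: "\<exists>M. \<forall>k y. y \<in> ?roots k (Z k) \<longrightarrow> cmod y \<le> M" if Z: "Z \<longlonglongrightarrow> z" for Z z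
  proof -
    have "\<exists>b. \<forall>k. cmod (poly (coeff (dy (Kk k)) j) (Z k)) \<le> b" for j
      by (rule bconv_coeff_bounded[OF convy Z])
    then obtain m where m: "\<And>j k. cmod (poly (coeff (dy (Kk k)) j) (Z k)) \<le> m j"
      by metis
    have "cmod y \<le> 1 + (\<Sum>j<n. m j) / cmod c" if "y \<in> ?roots k (Z k)" for k y
      by (rule polar_curve.root_bound[OF pc that m])
    then show ?thesis by blast
  qed
  obtain M where M: "\<And>k y. y \<in> ?roots k (X k) \<Longrightarrow> cmod y \<le> M" using root_bound[OF X(1)] by blast
  obtain B0 where B0: "\<And>k y. cmod y \<le> M \<Longrightarrow> cmod (beval (dx (Kk k)) (X k) y) \<le> B0"
    using bconv_bounded[OF convx X(1)] by blast
  define B where "B = max 1 B0"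
  have "\<exists>r. r \<in> ?roots k (X k) \<and> cmod c * cmod (b - r) ^ n \<le> cmod (beval (dy (Kk k)) (X k) b)" for k
    using polar_curve.root_near[OF pc, of k "X k" b] by blast
  then obtain Y where Y: "\<And>k. Y k \<in> ?roots k (X k)"
      "\<And>k. cmod c * cmod (b - Y k) ^ n \<le> cmod (beval (dy (Kk k)) (X k) b)"
    by metis
  have "(\<lambda>k. beval (dy (Kk k)) (X k) b) \<longlonglongrightarrow> 0"
    using bconv_beval[OF convy X(1) tendsto_const[of b]] critK by simp
  from tendsto_from_power_bound[OF _ n_pos Y(2) this tendsto_const] have Yb: "Y \<longlonglongrightarrow> b"
    using c0 by simp
  have "\<exists>N :: complex poly. \<forall>x.
     (card (?roots k x) = n \<longrightarrow> poly N x = (\<Prod>y\<in>?roots k x. beval (dx (Kk k)) x y)) \<and>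
     (poly N x = 0 \<longleftrightarrow> (\<exists>y\<in>?roots k x. beval (dx (Kk k)) x y = 0))" for k
    by (rule polar_curve.norm_poly_exists[OF pc])
  then obtain N where N: "\<And>k x. card (?roots k x) = n \<Longrightarrow>
      poly (N k) x = (\<Prod>y\<in>?roots k x. beval (dx (Kk k)) x y)"
     "\<And>k x. poly (N k) x = 0 \<longleftrightarrow> (\<exists>y\<in>?roots k x. beval (dx (Kk k)) x y = 0)"
    by metis
  define L where "L = (\<Prod>e\<in>directions l. beval (dx Hh) (1 - l * e) e)"
  have "L \<noteq> 0"
    using dx_directions_nonzero good_directions(2)[OF good] by (auto simp: L_def)
  have roots_eq: "?roots k x = {y. beval (dy (Kk k)) x y = 0}" for k x
    by (rule polar_curve.roots_def[OF pc])
  have N': "poly (N k) x = (\<Prod>y | beval (dy (shear l (Gk k))) x y =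
      0. beval (dx (shear l (Gk k))) x y)"
    if "card {y. beval (dy (shear l (Gk k))) x y = 0} = n" for k x
    using N(1)[of k x] that unfolding roots_eq unfolding Kk_def by blast
  have degN: "degree (N k) = n * n" "lead_coeff (N k) = L" for k
    unfolding L_def by (rule norm_poly_degree[OF low good N'], assumption)+
  have small: "cmod (poly (N k) (X k)) \<le> cmod (beval (dx (Kk k)) (X k) (Y k)) * B ^ (n - 1)" for k
  proof -
    have fin: "finite (?roots k (X k))" by (rule polar_curve.finite_roots[OF pc])
    have "cmod (poly (N k) (X k)) = cmod (beval (dx (Kk k)) (X k) (Y k)) *
        (\<Prod>y\<in>?roots k (X k) - {Y k}. cmod (beval (dx (Kk k)) (X k) y))"
      unfolding N(1)[OF X(2)] prod_norm[symmetric] by (rule prod.remove[OF fin Y(1)])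
    also have "(\<Prod>y\<in>?roots k (X k) - {Y k}. cmod (beval (dx (Kk k)) (X k) y)) \<le>
        (\<Prod>y\<in>?roots k (X k) - {Y k}. B)"
    proof (intro prod_mono conjI)
      fix y assume "y \<in> ?roots k (X k) - {Y k}"
      then have "cmod (beval (dx (Kk k)) (X k) y) \<le> B0" by (intro B0 M[of y k]) simp
      then show "cmod (beval (dx (Kk k)) (X k) y) \<le> B" by (simp add: B_def)
    qed simp
    also have "\<dots> = B ^ (n - 1)" using X(2)[of k] Y(1)[of k] fin by simp
    finally show ?thesis by (simp add: mult_left_mono)
  qed
  \<comment> \<open>Degree \<open>n * n\<close> and coefficient \<open>L\<close> are the same for
    all \<open>k\<close>, so small values of \<open>N k\<close> bound the distance to a root
    uniformly.\<close>
  have "\<exists>\<rho>. poly (N k) \<rho> = 0 \<and> cmod L * cmod (X k - \<rho>) ^ (n * n) \<le> cmod (poly (N k) (X k))" for k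
    using complex_poly_root_near[of "N k" "X k"] n_pos unfolding degN(2) unfolding degN(1) by simp
  then obtain \<rho> where \<rho>: "\<And>k. poly (N k) (\<rho> k) = 0"
      "\<And>k. cmod L * cmod (X k - \<rho> k) ^ (n * n) \<le> cmod (poly (N k) (X k))"
    by metis
  have "(\<lambda>k. beval (dx (Kk k)) (X k) (Y k) * of_real (B ^ (n - 1))) \<longlonglongrightarrow>
      beval (dx K) x0 b * of_real (B ^ (n - 1))"
    by (intro tendsto_intros bconv_beval[OF convx] X Yb)
  then have lim: "(\<lambda>k. beval (dx (Kk k)) (X k) (Y k) * of_real (B ^ (n - 1))) \<longlonglongrightarrow> 0"
    using critK by simp
  have "B \<ge> 0" by (simp add: B_def)
  then have "cmod (beval (dx (Kk k)) (X k) (Y k) * of_real (B ^ (n - 1))) =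
      cmod (beval (dx (Kk k)) (X k) (Y k)) * B ^ (n - 1)" for k
    by (simp add: norm_mult norm_power)
  then have le: "cmod L * cmod (X k - \<rho> k) ^ (n * n) \<le>
      cmod (beval (dx (Kk k)) (X k) (Y k) * of_real (B ^ (n - 1)))" for k
    using \<rho>(2)[of k] small[of k] by simp
  have \<rho>_lim: "\<rho> \<longlonglongrightarrow> x0"
    by (rule tendsto_from_power_bound[OF _ _ le lim X(1)]) (use n_pos \<open>L \<noteq> 0\<close> in auto)
  have "\<exists>v. v \<in> ?roots k (\<rho> k) \<and> beval (dx (Kk k)) (\<rho> k) v = 0" for k
    using N(2)[of k "\<rho> k"] \<rho>(1)[of k] by blast
  then obtain V where V: "\<And>k. V k \<in> ?roots k (\<rho> k)" "\<And>k. beval (dx (Kk k)) (\<rho> k) (V k) = 0"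
    by metis
  obtain M' where M': "\<And>k y. y \<in> ?roots k (\<rho> k) \<Longrightarrow> cmod y \<le> M'"
    using root_bound[OF \<rho>_lim] by blast
  have "\<forall>k. V k \<in> cball 0 M'" using M'[OF V(1)] by simp
  then obtain b' r where r: "strict_mono (r :: nat \<Rightarrow> nat)" "(V \<circ> r) \<longlonglongrightarrow> b'"
    using compact_cball[of "0 :: complex" M'] unfolding compact_def by meson
  have dxG: "beval (dx (Gk k)) (\<rho> k - l * V k) (V k) = 0" for k
    using V(2)[of k] by (simp add: Kk_def dx_shear)
  have "beval (dy (Kk k)) (\<rho> k) (V k) = 0" for k
    using V(1)[of k] by (simp add: roots_eq)
  then have dyG: "beval (dy (Gk k)) (\<rho> k - l * V k) (V k) = 0" for k
    using dxG[of k] by (simp add: Kk_def dy_shear)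
  have "(\<lambda>k. (\<rho> \<circ> r) k - l * (V \<circ> r) k) \<longlonglongrightarrow> x0 - l * b'"
    by (intro tendsto_intros LIMSEQ_subseq_LIMSEQ[OF \<rho>_lim r(1)] r(2))
  then have lim: "((\<lambda>k. \<rho> k - l * V k) \<circ> r) \<longlonglongrightarrow> x0 - l * b'" by (simp add: o_def)
  have crit_seq: "\<forall>k. beval (dx (Gk k)) (\<rho> k - l * V k) (V k) =
      0 \<and> beval (dy (Gk k)) (\<rho> k - l * V k) (V k) = 0"
    using dxG dyG by blast
  have subseq: "\<exists>r. strict_mono (r :: nat \<Rightarrow> nat) \<and>
      ((\<lambda>k. \<rho> k - l * V k) \<circ> r) \<longlonglongrightarrow> x0 - l * b' \<and> (V \<circ> r) \<longlonglongrightarrow> b'"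
    using r lim by blast
  have "x0 - l * b' + l * b' = a + l * b" by (simp add: x0_def)
  with crit_seq subseq show ?thesis
    by (intro exI[of _ "\<lambda>k. \<rho> k - l * V k"] exI[of _ V] exI[of _ "x0 - l * b'"] exI[of _ b'] conjI)
qed

text \<open>The slope is chosen so that the line \<open>x + l y = a + l b\<close> contains no other
  of the finitely many critical points of \<open>G\<close>. The approximating critical points then
  accumulate at \<open>(a, b)\<close> itself, and their values tend to 0.\<close>

lemma critical_values_limit:
  assumes low: "\<And>k. tdeg_le n (Gk k - Hh)" and lowG: "tdeg_le n (G - Hh)"
    and conv: "bconv (Suc n) Gk G"
    and small: "\<And>k x y. beval (dx (Gk k)) x y = 0 \<Longrightarrow> beval (dy (Gk k)) x y = 0 \<Longrightarrow>
        cmod (beval (Gk k) x y) \<le> e k"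
    and e: "e \<longlonglongrightarrow> 0"
    and crit: "beval (dx G) a b = 0" "beval (dy G) a b = 0"
  shows "beval G a b = 0"
proof -
  define S where "S = {(a, b). beval (dx G) a b = 0 \<and> beval (dy G) a b = 0}"
  have "finite S" unfolding S_def by (rule finite_critical_points[OF lowG])
  \<comment> \<open>For \<open>b' = b\<close> the quotient is 0 by convention, which excludes the
    slope 0 at most; in that case the equation of the line already gives
    \<open>a' = a\<close>.\<close>
  then obtain l where l: "good l" "l \<notin> (\<lambda>(a', b'). (a' - a) / (b - b')) ` S"
    using ex_good_avoiding by blast
  obtain A B a' b' r where AB: "\<And>k. beval (dx (Gk k)) (A k) (B k) =
      0" "\<And>k. beval (dy (Gk k)) (A k) (B k) = 0"
    and r: "strict_mono (r :: nat \<Rightarrow> nat)" "(A \<circ> r) \<longlonglongrightarrow> a'" "(B \<circ> r) \<longlonglongrightarrow> b'"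
    and line: "a' + l * b' = a + l * b"
    using critical_point_approx_shear[OF low lowG conv l(1) crit] by blast
  have conv_r: "bconv m (Fk \<circ> r) F" if "bconv m Fk F" for m Fk F
    unfolding bconv_def
  proof (intro conjI allI)
    show "(\<lambda>k. bcoeff ((Fk \<circ> r) k) i j) \<longlonglongrightarrow> bcoeff F i j" for i j
      using LIMSEQ_subseq_LIMSEQ[OF bconvD(3)[OF that, of i j] r(1)] by (simp add: o_def)
  qed (use bconvD(1,2)[OF that] in auto)
  have "(\<lambda>k. beval (dx (Gk (r k))) ((A \<circ> r) k) ((B \<circ> r) k)) \<longlonglongrightarrow> beval (dx G) a' b'"
    "(\<lambda>k. beval (dy (Gk (r k))) ((A \<circ> r) k) ((B \<circ> r) k)) \<longlonglongrightarrow> beval (dy G) a' b'"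
    using bconv_beval[OF conv_r[OF bconv_dx[OF conv]] r(2,3)]
      bconv_beval[OF conv_r[OF bconv_dy[OF conv]] r(2,3)] by (simp_all add: o_def)
  then have S: "(a', b') \<in> S"
    using AB by (simp add: S_def LIMSEQ_const_iff)
  have "b' = b"
  proof (rule ccontr)
    assume "b' \<noteq> b"
    then have "l = (a' - a) / (b - b')" using line by (simp add: field_simps)
    then show False using l(2) S by force
  qed
  then have "a' = a" using line by simp
  have "(\<lambda>k. beval (Gk (r k)) ((A \<circ> r) k) ((B \<circ> r) k)) \<longlonglongrightarrow> beval G a b"
    using bconv_beval[OF conv_r[OF conv] r(2,3)] \<open>a' = a\<close> \<open>b' = b\<close> by (simp add: o_def)
  moreover have "(\<lambda>k. beval (Gk (r k)) ((A \<circ> r) k) ((B \<circ> r) k)) \<longlonglongrightarrow> 0"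
  proof (rule Lim_null_comparison)
    show "\<forall>\<^sub>F k in sequentially. norm (beval (Gk (r k)) ((A \<circ> r) k) ((B \<circ> r) k)) \<le> (e \<circ> r) k"
      using small AB by (intro always_eventually) simp
    show "(e \<circ> r) \<longlonglongrightarrow> 0" by (rule LIMSEQ_subseq_LIMSEQ[OF e r(1)])
  qed
  ultimately show ?thesis by (rule LIMSEQ_unique)
qed

text \<open>The limit of a subsequence has no critical value except possibly 0 and so is a translate
  of \<open>Hh\<close>. The translation taking it to \<open>Hh\<close> brings the polynomials of
  large index close to \<open>Hh\<close>.\<close>

theorem no_degenerating_sequence:
  assumes low: "\<And>k :: nat. tdeg_le n (Gk k - Hh)" and bounded: "\<And>k. pnorm (Gk k - Hh) \<le> B"
    and small: "\<And>k x y. beval (dx (Gk k)) x y = 0 \<Longrightarrow> beval (dy (Gk k)) x y = 0 \<Longrightarrow>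
        cmod (beval (Gk k) x y) \<le> e k"
    and e: "e \<longlonglongrightarrow> 0" and "\<delta> > 0"
  shows "\<exists>k s t. pnorm (translate s t (Gk k) - Hh) < \<delta>"
proof -
  obtain r h where r: "strict_mono (r :: nat \<Rightarrow> nat)" and h: "bconv n (\<lambda>k. Gk (r k) - Hh) h"
    using bconv_subseq_exists[of n "\<lambda>k. Gk k - Hh" B] low bounded by blast
  define G where "G = h + Hh"
  have tHh: "tdeg_le (Suc n) Hh" by (rule homogeneous_imp_tdeg_le[OF form])
  have lowG: "tdeg_le n (G - Hh)" using bconvD(2)[OF h] by (simp add: G_def)
  have conv: "bconv (Suc n) (\<lambda>k. Gk (r k)) G"
    unfolding bconv_def
  proof (intro conjI allI)
    fix k
    have "tdeg_le (Suc n) (Gk (r k) - Hh + Hh)"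
      by (intro tdeg_le_add tHh tdeg_le_mono[OF low]) simp
    then show "tdeg_le (Suc n) (Gk (r k))" by simp
  next
    show "tdeg_le (Suc n) G"
      unfolding G_def by (intro tdeg_le_add tHh tdeg_le_mono[OF bconvD(2)[OF h]]) simp
  next
    fix i j
    have "(\<lambda>k. bcoeff (Gk (r k) - Hh) i j + bcoeff Hh i j) \<longlonglongrightarrow> bcoeff h i j + bcoeff Hh i j"
      by (intro tendsto_intros bconvD(3)[OF h])
    then show "(\<lambda>k. bcoeff (Gk (r k)) i j) \<longlonglongrightarrow> bcoeff G i j" by (simp add: G_def)
  qed
  have er: "(\<lambda>k. e (r k)) \<longlonglongrightarrow> 0" using LIMSEQ_subseq_LIMSEQ[OF e r] by (simp add: o_def)
  have "beval G x y = 0" if "beval (dx G) x y = 0" "beval (dy G) x y = 0" for x y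
    by (rule critical_values_limit[OF low lowG conv small er that])
  then obtain s t where st: "translate s t G = Hh"
    using translate_eq_form[OF lowG] by blast
  have "bconv (Suc n) (\<lambda>k. translate s t (Gk (r k)) - Hh) (translate s t G - Hh)"
    by (intro bconv_diff_const bconv_translate conv tHh)
  from bconv_pnorm[OF this] have "(\<lambda>k. pnorm (translate s t (Gk (r k)) - Hh)) \<longlonglongrightarrow> 0"
    by (simp add: st)
  then have "\<forall>\<^sub>F k in sequentially. pnorm (translate s t (Gk (r k)) - Hh) < \<delta>"
    using \<open>\<delta> > 0\<close> by (rule order_tendstoD)
  then show ?thesis using eventually_happens by force
qed

end

section \<open>Rescaling\<close>

text \<open>Forms of degree \<open>d\<close> are fixed, a coefficient of total degree
  \<open>j \<le> d\<close> is divided by \<open>r^(d - j)\<close>, and critical values are divided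
  by \<open>r^d\<close>.\<close>

definition rescale :: "nat \<Rightarrow> complex \<Rightarrow> bipoly \<Rightarrow> bipoly" where
  "rescale d r H = bconst (1 / r ^ d) * bsubst (bconst r * bX) (bconst r * bY) H"

lemma beval_rescale: "beval (rescale d r H) x y = beval H (r * x) (r * y) / r ^ d"
  by (simp add: rescale_def)

lemma bcoeff_rescale: "bcoeff (rescale d r H) i j = r ^ (i + j) * bcoeff H i j / r ^ d"
proof -
  obtain m where m: "tdeg_le m H" using ex_tdeg_le by blast
  have pow: "(bconst r * bX) ^ a * (bconst r * bY) ^ b = monom (monom (r ^ (a + b)) a) b" for a b
    by (rule beval_eqI) (simp add: power_mult_distrib power_add)
  have "bcoeff (bsubst (bconst r * bX) (bconst r * bY) H) i j =
      (\<Sum>a\<le>m. \<Sum>b\<le>m. if b = j then (if a = i then r ^ (a + b) * bcoeff H a b else 0) else 0)"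
    unfolding bcoeff_bsubst[OF m] pow bcoeff_monom by (intro sum.cong refl) auto
  also have "\<dots> = (if j \<le> m then (if i \<le> m then r ^ (i + j) * bcoeff H i j else 0) else 0)"
    by (simp add: sum.delta)
  also have "\<dots> = r ^ (i + j) * bcoeff H i j"
    using tdeg_leD[OF m, of i j] by auto
  finally show ?thesis by (simp add: rescale_def)
qed

lemma rescale_diff: "rescale d r (F - G) = rescale d r F - rescale d r G"
  by (rule beval_eqI) (simp add: beval_rescale diff_divide_distrib)

lemma rescale_form:
  assumes "homogeneous (int d) F" "r \<noteq> 0"
  shows "rescale d r F = F"
  by (rule beval_eqI) (simp add: beval_rescale beval_homogeneous[OF assms(1)] assms(2))

lemma translate_rescale: "translate s t (rescale d r H) = rescale d r (translate (r * s) (r * t) H)"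
  by (rule beval_eqI) (simp add: beval_rescale beval_translate distrib_left)

lemma rescale_mult: "rescale d (r * r') H = rescale d r (rescale d r' H)"
  by (rule beval_eqI) (simp add: beval_rescale mult_ac power_mult_distrib)

lemma rescale_1 [simp]: "rescale d 1 H = H"
  by (rule beval_eqI) (simp add: beval_rescale)

lemma beval_dx_rescale: "beval (dx (rescale d r H)) x y = r * beval (dx H) (r * x) (r * y) / r ^ d"
proof -
  have "((\<lambda>x. r * x) has_field_derivative r) (at x)" by (auto intro!: derivative_eq_intros)
  from DERIV_cdivide[OF beval_deriv_compose[of "\<lambda>x. r * x" r x "\<lambda>_. r * y" 0 H, OF this
      DERIV_const], of "r ^ d"]
  have "((\<lambda>x. beval (rescale d r H) x y) has_field_derivative
      r * beval (dx H) (r * x) (r * y) / r ^ d) (at x)"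
    by (simp add: beval_rescale mult.commute)
  then show ?thesis by (rule DERIV_unique[OF beval_dx])
qed

lemma beval_dy_rescale: "beval (dy (rescale d r H)) x y = r * beval (dy H) (r * x) (r * y) / r ^ d"
proof -
  have "((\<lambda>y. r * y) has_field_derivative r) (at y)" by (auto intro!: derivative_eq_intros)
  from DERIV_cdivide[OF beval_deriv_compose[of "\<lambda>_. r * x" 0 y "\<lambda>y. r * y" r H, OF DERIV_const
      this], of "r ^ d"]
  have "((\<lambda>y. beval (rescale d r H) x y) has_field_derivative
      r * beval (dy H) (r * x) (r * y) / r ^ d) (at y)"
    by (simp add: beval_rescale mult.commute)
  then show ?thesis by (rule DERIV_unique[OF beval_dy])
qed

lemma tdeg_le_rescale: "tdeg_le m H \<Longrightarrow> tdeg_le m (rescale d r H)"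
  unfolding tdeg_le_def bcoeff_rescale by (metis div_0 mult_zero_right)

lemma pnorm_rescale_le:
  fixes r :: real
  assumes "tdeg_le n h" "r \<ge> 1"
  shows "pnorm (rescale (Suc n) r h) \<le> pnorm h / r"
proof -
  have "cmod (bcoeff (rescale (Suc n) r h) i j) \<le> cmod (bcoeff h i j) / r" for i j
  proof (cases "bcoeff h i j = 0")
    case False
    then have "i + j \<le> n" using assms(1) by (simp add: tdeg_le_def)
    then have "r * r ^ (i + j) \<le> r ^ Suc n"
      using assms(2) by (simp add: power_increasing)
    then have "r ^ (i + j) / r ^ Suc n \<le> 1 / r"
      using assms(2) by (simp add: divide_simps mult.commute)
    then have "r ^ (i + j) / r ^ Suc n * cmod (bcoeff h i j) \<le> 1 / r * cmod (bcoeff h i j)"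
      by (rule mult_right_mono) simp
    then show ?thesis
      using assms(2) by (simp add: bcoeff_rescale norm_mult norm_divide norm_power)
  qed (use assms(2) in \<open>simp add: bcoeff_rescale\<close>)
  then show ?thesis
    unfolding pnorm_eq[OF tdeg_le_rescale[OF assms(1)]] pnorm_eq[OF assms(1)] sum_divide_distrib
    by (intro sum_mono)
qed

lemma pnorm_le_rescale:
  fixes r :: real
  assumes "r \<ge> 1"
  shows "pnorm h \<le> r ^ d * pnorm (rescale d r h)"
proof -
  obtain m where m: "tdeg_le m h" using ex_tdeg_le by blast
  have "cmod (bcoeff h i j) \<le> r ^ d * cmod (bcoeff (rescale d r h) i j)" for i j
  proof -
    have "1 * cmod (bcoeff h i j) \<le> r ^ (i + j) * cmod (bcoeff h i j)"
      using assms by (intro mult_right_mono) (auto intro: one_le_power)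
    then show ?thesis
      using assms by (simp add: bcoeff_rescale norm_mult norm_divide norm_power)
  qed
  then show ?thesis
    unfolding pnorm_eq[OF tdeg_le_rescale[OF m]] pnorm_eq[OF m] sum_distrib_left
    by (intro sum_mono)
qed

lemma translate_0 [simp]: "translate 0 0 H = H"
  by (rule beval_eqI) (simp add: beval_translate)

lemma translate_translate: "translate s t (translate s' t' H) = translate (s + s') (t + t') H"
  by (rule beval_eqI) (simp add: beval_translate add_ac)

text \<open>The terms of top degree cancel. For \<open>a = 0\<close> the difference is 0, so the
  truncation in \<open>a - 1\<close> does no harm.\<close>

lemma tdeg_le_power_shift:
  assumes "tdeg_le 1 V"
  shows "tdeg_le (a - 1) ((V + bconst s) ^ a - V ^ a)"
proof (induction a)
  case 0
  then show ?case by (simp add: tdeg_le_0)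
next
  case (Suc a)
  have s: "tdeg_le a (bconst s * V ^ a)"
    using tdeg_le_mult[OF tdeg_le_bconst tdeg_le_power[OF assms]] by simp
  have split: "(V + bconst s) ^ Suc a - V ^ Suc a =
      (V + bconst s) * ((V + bconst s) ^ a - V ^ a) + bconst s * V ^ a"
    by (simp add: algebra_simps)
  show ?case
  proof (cases a)
    case 0
    then show ?thesis using tdeg_le_bconst[of s] by simp
  next
    case (Suc b)
    have "tdeg_le 1 (V + bconst s)"
      by (intro tdeg_le_add assms tdeg_le_mono[OF tdeg_le_bconst]) simp
    from tdeg_le_mult[OF this Suc.IH] Suc
    have "tdeg_le a ((V + bconst s) * ((V + bconst s) ^ a - V ^ a))" by simp
    then show ?thesis unfolding split using s by (simp add: tdeg_le_add)
  qed
qed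

text \<open>For each monomial the difference telescopes into a shift in \<open>x\<close> and a shift
  in \<open>y\<close>, both covered by \<open>tdeg_le_power_shift\<close>.\<close>

lemma tdeg_le_translate_diff:
  assumes "tdeg_le (Suc m) F"
  shows "tdeg_le m (translate s t F - F)"
proof -
  let ?U = "bX + bconst s" and ?V = "bY + bconst t"
  have "translate s t F - F = (\<Sum>a\<le>Suc m. \<Sum>b\<le>Suc m. bconst (bcoeff F a b) * (?U ^ a * ?V ^ b - bX ^
      a * bY ^ b))"
    by (rule beval_eqI)
      (simp add: beval_translate beval_expand_tdeg[OF assms] sum_subtractf right_diff_distrib
          mult.assoc)
  moreover have "tdeg_le m (bconst (bcoeff F a b) * (?U ^ a * ?V ^ b - bX ^ a * bY ^ b))" for a b
  proof (cases "bcoeff F a b = 0")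
    case True
    then show ?thesis using tdeg_le_0 by (simp add: bconst_def)
  next
    case False
    then have ab: "a + b \<le> Suc m" using assms by (simp add: tdeg_le_def)
    have "tdeg_le m ((?U ^ a - bX ^ a) * ?V ^ b)"
    proof (cases a)
      case (Suc a')
      show ?thesis
        by (rule tdeg_le_mono[OF tdeg_le_mult[OF tdeg_le_power_shift[OF tdeg_le_bX]
            tdeg_le_power[OF tdeg_le_affine(2)]]])
          (use ab Suc in simp)
    qed (simp add: tdeg_le_0)
    moreover have "tdeg_le m (bX ^ a * (?V ^ b - bY ^ b))"
    proof (cases b)
      case (Suc b')
      show ?thesis
        by (rule tdeg_le_mono[OF tdeg_le_mult[OF tdeg_le_power[OF tdeg_le_bX]
            tdeg_le_power_shift[OF tdeg_le_bY]]])
          (use ab Suc in simp)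
    qed (simp add: tdeg_le_0)
    ultimately have "tdeg_le m ((?U ^ a - bX ^ a) * ?V ^ b + bX ^ a * (?V ^ b - bY ^ b))"
      by (rule tdeg_le_add)
    also have "(?U ^ a - bX ^ a) * ?V ^ b + bX ^ a * (?V ^ b - bY ^ b) =
        ?U ^ a * ?V ^ b - bX ^ a * bY ^ b"
      by (simp add: algebra_simps)
    finally show ?thesis using tdeg_le_mult[OF tdeg_le_bconst] by fastforce
  qed
  ultimately show ?thesis by (simp only:) (intro tdeg_le_sum)
qed

lemma tdeg_le_translate: "tdeg_le m F \<Longrightarrow> tdeg_le m (translate s t F)"
  unfolding translate_eq_bsubst by (rule tdeg_le_bsubst[OF tdeg_le_affine(1,2)])

context isolated_form
begin

lemma low_translate:
  assumes "tdeg_le n (H - Hh)"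
  shows "tdeg_le n (translate s t H - Hh)"
proof -
  have eq: "translate s t H - Hh = translate s t (H - Hh) + (translate s t Hh - Hh)"
    by (rule beval_eqI) (simp add: beval_translate)
  show ?thesis
    unfolding eq
    by (intro tdeg_le_add tdeg_le_translate assms tdeg_le_translate_diff homogeneous_imp_tdeg_le
        form)
qed

lemma rescale_minus_form: "r \<noteq> 0 \<Longrightarrow> rescale (Suc n) r H - Hh = rescale (Suc n) r (H - Hh)"
  by (simp add: rescale_diff rescale_form[OF form])

lemma critical_rescale:
  assumes "\<And>x y. beval (dx H) x y = 0 \<Longrightarrow> beval (dy H) x y = 0 \<Longrightarrow> cmod (beval H x y) \<le> e"
    and "r \<ge> 1" and "beval (dx (rescale d (of_real r) H)) x y =
        0" "beval (dy (rescale d (of_real r) H)) x y = 0"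
  shows "cmod (beval (rescale d (of_real r) H) x y) \<le> e / r ^ d"
proof -
  have "beval (dx H) (r * x) (r * y) = 0" "beval (dy H) (r * x) (r * y) = 0"
    using assms(2-4) by (auto simp: beval_dx_rescale beval_dy_rescale)
  then have "cmod (beval H (r * x) (r * y)) \<le> e" by (rule assms(1))
  then show ?thesis
    using assms(2) by (simp add: beval_rescale norm_divide norm_power divide_right_mono)
qed

text \<open>
  Halving the scale until the translates of \<open>H\<close> come within distance \<open>1\<close> of the form brings \<open>H\<close> into
  a compact set which stays away from the translates of the form.
\<close>

lemma normalise_scale:
  assumes low: "tdeg_le n (H - Hh)" and far: "\<And>s t. 1 \<le> pnorm (translate s t H - Hh)"
    and small: "\<And>x y. beval (dx H) x y = 0 \<Longrightarrow> beval (dy H) x y = 0 \<Longrightarrow> cmod (beval H x y) \<le> e"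
  shows "\<exists>G. tdeg_le n (G - Hh) \<and> pnorm (G - Hh) \<le> 1 \<and>
    (\<forall>x y. beval (dx G) x y = 0 \<longrightarrow> beval (dy G) x y = 0 \<longrightarrow> cmod (beval G x y) \<le> e) \<and>
    (\<forall>s t. (1 / 2) ^ Suc n \<le> pnorm (translate s t G - Hh))"
proof -
  define F where "F p = rescale (Suc n) (of_real (2 ^ p)) H" for p :: nat
  define P where "P p \<longleftrightarrow> (\<exists>s t. pnorm (translate s t (F p) - Hh) < 1)" for p
  have lowF: "tdeg_le n (F p - Hh)" for p
    unfolding F_def by (subst rescale_minus_form) (auto intro: tdeg_le_rescale low)
  obtain p0 :: nat where p0: "pnorm (H - Hh) < 2 ^ p0"
    using real_arch_pow[of 2 "pnorm (H - Hh)"] by auto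
  have nz: "complex_of_real (2 ^ p0) \<noteq> 0" by simp
  have "pnorm (F p0 - Hh) \<le> pnorm (H - Hh) / 2 ^ p0"
    unfolding F_def rescale_minus_form[OF nz] by (rule pnorm_rescale_le[OF low]) simp
  also have "\<dots> < 1" using p0 by simp
  finally have "P p0" unfolding P_def by (metis translate_0)
  have notP0: "\<not> P 0" using far by (simp add: P_def F_def not_less)
  \<comment> \<open>The first power of two at which some translate comes within distance 1. It is
    not the zeroth by \<open>far\<close>, and at its predecessor \<open>q\<close> all translates
    keep distance at least 1.\<close>
  define p where "p = (LEAST p. P p)"
  have "P p" unfolding p_def using \<open>P p0\<close> by (rule LeastI)
  with notP0 obtain q where q: "p = Suc q" by (cases p) auto
  have "\<not> P q" using not_less_Least[of q P] q by (simp add: p_def)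
  obtain s t where st: "pnorm (translate s t (F p) - Hh) < 1" using \<open>P p\<close> unfolding P_def by blast
  define G where "G = translate s t (F p)"
  have F_Suc: "F p = rescale (Suc n) (of_real 2) (F q)"
    by (simp add: F_def q rescale_mult)
  have "(1 / 2) ^ Suc n \<le> pnorm (translate s' t' G - Hh)" for s' t'
  proof -
    let ?T = "translate (2 * (s' + s)) (2 * (t' + t)) (F q)"
    have "translate s' t' G - Hh = rescale (Suc n) (of_real 2) (?T - Hh)"
      unfolding G_def translate_translate F_Suc translate_rescale
      by (subst rescale_minus_form[symmetric]) simp_all
    moreover have "1 \<le> pnorm (?T - Hh)" using \<open>\<not> P q\<close> by (simp add: P_def not_less)
    \<comment> \<open>A single rescaling by 2 shrinks norms at most by the factor
      \<open>2^(n+1)\<close>, the origin of the constant \<open>(1/2)^(n+1)\<close>.\<close>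
    ultimately have "1 \<le> 2 ^ Suc n * pnorm (translate s' t' G - Hh)"
      using pnorm_le_rescale[of 2 "?T - Hh" "Suc n"] by simp
    then show ?thesis by (simp add: power_divide divide_le_eq mult.commute)
  qed
  moreover have "cmod (beval G x y) \<le> e" if crit: "beval (dx G) x y = 0" "beval (dy G) x y = 0"
      for x y
  proof -
    have "beval (dx (F p)) (x + s) (y + t) = 0" "beval (dy (F p)) (x + s) (y + t) = 0"
      using crit by (simp_all add: G_def dx_translate dy_translate beval_translate)
    then have le: "cmod (beval (F p) (x + s) (y + t)) \<le> e / (2 ^ p) ^ Suc n"
      unfolding F_def by (intro critical_rescale small) simp_all
    have "(1 :: real) \<le> (2 ^ p) ^ Suc n" by (intro one_le_power) simp
    then have "cmod (beval (F p) (x + s) (y + t)) * 1 \<le>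
        cmod (beval (F p) (x + s) (y + t)) * (2 ^ p) ^ Suc n"
      by (intro mult_left_mono) simp_all
    also have "\<dots> \<le> e"
      using le by (simp add: pos_le_divide_eq del: power_Suc)
    finally show ?thesis by (simp add: G_def beval_translate)
  qed
  moreover have "tdeg_le n (G - Hh)" unfolding G_def by (rule low_translate[OF lowF])
  moreover have "pnorm (G - Hh) \<le> 1" using st by (simp add: G_def)
  ultimately show ?thesis by blast
qed

text \<open>Counterexamples for the bounds \<open>1 / (k + 1)\<close> would be normalised by
  \<open>normalise_scale\<close> to a bounded sequence whose critical values tend to 0 while its
  translates stay away from \<open>Hh\<close>, against
  \<open>no_degenerating_sequence\<close>.\<close>

lemma near_form_if_critical_values_small:
  "\<exists>\<epsilon>>0. \<forall>H. tdeg_le n (H - Hh) \<longrightarrow>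
    (\<forall>x y. beval (dx H) x y = 0 \<longrightarrow> beval (dy H) x y = 0 \<longrightarrow> cmod (beval H x y) \<le> \<epsilon>) \<longrightarrow>
    (\<exists>s t. pnorm (translate s t H - Hh) < 1)"
proof (rule ccontr)
  assume neg: "\<not> ?thesis"
  have "\<exists>G. tdeg_le n (G - Hh) \<and> pnorm (G - Hh) \<le> 1 \<and>
    (\<forall>x y. beval (dx G) x y = 0 \<longrightarrow> beval (dy G) x y = 0 \<longrightarrow> cmod (beval G x y) \<le> 1 / real (Suc k)) \<and>
    (\<forall>s t. (1 / 2) ^ Suc n \<le> pnorm (translate s t G - Hh))" for k
  proof -
    have "1 / real (Suc k) > 0" by simp
    with neg obtain H where "tdeg_le n (H - Hh)"
      "\<And>x y. beval (dx H) x y = 0 \<Longrightarrow> beval (dy H) x y = 0 \<Longrightarrow> cmod (beval H x y) \<le> 1 / real (Suc k)"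
      "\<And>s t. 1 \<le> pnorm (translate s t H - Hh)"
      by (meson not_le)
    then show ?thesis by (intro normalise_scale)
  qed
  then obtain Gk where Gk: "\<And>k. tdeg_le n (Gk k - Hh)" "\<And>k. pnorm (Gk k - Hh) \<le> 1"
    "\<And>k x y. beval (dx (Gk k)) x y = 0 \<Longrightarrow> beval (dy (Gk k)) x y = 0 \<Longrightarrow>
      cmod (beval (Gk k) x y) \<le> 1 / real (Suc k)"
    "\<And>k s t. (1 / 2) ^ Suc n \<le> pnorm (translate s t (Gk k) - Hh)"
    by metis
  have "(\<lambda>k. 1 / real (Suc k)) \<longlonglongrightarrow> 0"
    using LIMSEQ_inverse_real_of_nat by (simp add: inverse_eq_divide)
  from no_degenerating_sequence[OF Gk(1,2,3) this, of "(1 / 2) ^ Suc n"]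
  obtain k s t where "pnorm (translate s t (Gk k) - Hh) < (1 / 2) ^ Suc n" by auto
  then show False using Gk(4)[of s t k] by linarith
qed

end

section \<open>Critical values and effective nonhomogeneity\<close>

lemma effective_nonhomogeneity_le:
  "effective_nonhomogeneity H \<le> pnorm (translate s t H - principal_part H)"
  unfolding effective_nonhomogeneity_def
  by (rule cINF_lower2[of _ _ "(s, t)"]) (auto intro!: bdd_belowI2[of _ 0] pnorm_nonneg)

lemma bcoeff_total_degree:
  shows "bcoeff H i j \<noteq> 0 \<Longrightarrow> i + j \<le> total_degree H"
    and "total_degree H > 0 \<Longrightarrow> \<exists>i j. i + j = total_degree H \<and> bcoeff H i j \<noteq> 0"
proof -
  have "{i + j |i j. bcoeff H i j \<noteq> 0} = (\<lambda>(i, j). i + j) ` {(i, j). bcoeff H i j \<noteq> 0}"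
    by auto
  then have fin: "finite (insert 0 {i + j |i j. bcoeff H i j \<noteq> 0})"
    using finite_bcoeff_nonzero[of H] by simp
  show "i + j \<le> total_degree H" if "bcoeff H i j \<noteq> 0"
    unfolding total_degree_def using that by (intro Max_ge fin) auto
  show "\<exists>i j. i + j = total_degree H \<and> bcoeff H i j \<noteq> 0" if pos: "total_degree H > 0"
  proof -
    have "total_degree H \<in> insert 0 {i + j |i j. bcoeff H i j \<noteq> 0}"
      unfolding total_degree_def by (rule Max_in[OF fin]) simp
    then show ?thesis
      unfolding insert_iff
    proof
      assume "total_degree H = 0"
      then show ?thesis using pos by linarith
    next
      assume "total_degree H \<in> {i + j |i j. bcoeff H i j \<noteq> 0}"
      then obtain i j where "total_degree H = i + j" "bcoeff H i j \<noteq> 0" by blast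
      then show ?thesis by metis
    qed
  qed
qed

lemma tdeg_le_minus_principal_part:
  assumes "total_degree H = Suc n"
  shows "tdeg_le n (H - principal_part H)"
  unfolding tdeg_le_def
proof (intro allI impI)
  fix i j assume "bcoeff (H - principal_part H) i j \<noteq> 0"
  then have "i + j \<noteq> Suc n" "bcoeff H i j \<noteq> 0"
    by (auto simp: bcoeff_principal_part assms split: if_splits)
  then show "i + j \<le> n" using bcoeff_total_degree(1)[of H i j] assms by simp
qed

text \<open>This settles \<open>n = 0\<close>: as the gradient \<open>(p, q)\<close> is nonzero,
  some translation with \<open>p s + q t = - c\<close> absorbs the constant term.\<close>

lemma linear_translate_eq_principal_part:
  assumes "total_degree H = 1"
  shows "\<exists>s t. translate s t H = principal_part H"
proof -
  define p where "p = bcoeff H 1 0"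
  define q where "q = bcoeff H 0 1"
  define c where "c = bcoeff H 0 0"
  have H: "tdeg_le 1 H" using bcoeff_total_degree(1)[of H] assms by (simp add: tdeg_le_def)
  then have P: "tdeg_le 1 (principal_part H)"
    using assms by (simp add: tdeg_le_def bcoeff_principal_part)
  have "bcoeff H 1 1 \<noteq> 0 \<Longrightarrow> (1 :: nat) + 1 \<le> 1"
    using H unfolding tdeg_le_def by blast
  then have "bcoeff H 1 1 = 0" by linarith
  then have evH: "beval H x y = c + q * y + p * x" for x y
    by (simp add: beval_expand_tdeg[OF H] p_def q_def c_def)
  have evP: "beval (principal_part H) x y = q * y + p * x" for x y
    by (simp add: beval_expand_tdeg[OF P] p_def q_def bcoeff_principal_part assms)
  have "p \<noteq> 0 \<or> q \<noteq> 0"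
  proof -
    obtain i j where ij: "i + j = 1" "bcoeff H i j \<noteq> 0"
      using bcoeff_total_degree(2)[of H] assms by auto
    then have "i = 1 \<and> j = 0 \<or> i = 0 \<and> j = 1" by linarith
    then show ?thesis using ij(2) by (auto simp: p_def q_def)
  qed
  then obtain s t where "p * s + q * t = - c"
  proof
    assume "p \<noteq> 0"
    then show ?thesis by (intro that[of "- c / p" 0]) simp
  next
    assume "q \<noteq> 0"
    then show ?thesis by (intro that[of 0 "- c / q"]) simp
  qed
  then have "c + q * (y + t) + p * (x + s) = q * y + p * x" for x y
    by (simp add: algebra_simps)
  then have "translate s t H = principal_part H"
    by (intro beval_eqI) (simp add: beval_translate evH evP)
  then show ?thesis by blast
qed

text \<open>By normalization \<open>x^(2n-1)\<close> and \<open>y^(2n-1)\<close> are combinations of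
  the two partial derivatives, so they vanish at every common zero; the exponent is positive as
  \<open>n > 0\<close>.\<close>

lemma normalized_isolated_form:
  assumes "normalized n Hh" "n > 0"
  shows "isolated_form Hh n"
proof
  show "n > 0" by (fact assms(2))
  show "homogeneous (int (Suc n)) Hh"
    using assms(1) by (simp add: normalized_def add.commute)
  fix x y assume zero: "beval (dx Hh) x y = 0" "beval (dy Hh) x y = 0"
  have vanish: "beval f x y = 0" if "homogeneous (2 * int n - 1) f" for f
    using assms(1) that zero unfolding normalized_def normalized_pair_def
    by (metis beval_add beval_mult mult_zero_left add_0)
  have deg: "2 * int n - 1 = int (2 * n - 1)" using assms(2) by simp
  have "homogeneous (2 * int n - 1) (monom (monom 1 (2 * n - 1)) 0)"
    "homogeneous (2 * int n - 1) (monom (monom 1 0) (2 * n - 1))"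
    unfolding homogeneous_def bcoeff_monom deg by (auto split: if_splits)
  from vanish[OF this(1)] vanish[OF this(2)] show "x = 0 \<and> y = 0"
    unfolding beval_monom by simp
qed

theorem corollary4:
  fixes n :: nat and Hh :: bipoly
  assumes "normalized n Hh"
  shows "\<exists>\<alpha> \<beta> :: real. \<alpha> > 0 \<and> \<beta> > 0 \<and>
    (\<forall>H. quasimonic n H \<and> principal_part H = Hh \<longrightarrow>
       (effective_nonhomogeneity H \<ge> 1 \<longrightarrow> critical_values H \<inter> {t. cmod t > \<alpha>} \<noteq> {}) \<and>
       (critical_values H \<subseteq> {t. cmod t \<le> 1} \<longrightarrow> effective_nonhomogeneity H \<le> \<beta>))"
proof (cases "n = 0")
  case True
  \<comment> \<open>For linear Hamiltonians the premise of the first implication fails, and any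
    positive bound serves in the second.\<close>
  have "effective_nonhomogeneity H \<le> 0" if "quasimonic n H" for H
  proof -
    have "total_degree H = 1" using that True by (simp add: quasimonic_def)
    then obtain s t where "translate s t H = principal_part H"
      using linear_translate_eq_principal_part by blast
    then show ?thesis using effective_nonhomogeneity_le[of H s t] by simp
  qed
  then show ?thesis by (intro exI[of _ 1]) force
next
  case False
  interpret isolated_form Hh n
    by (rule normalized_isolated_form[OF assms]) (use False in simp)
  obtain \<epsilon> where \<epsilon>: "\<epsilon> > 0" "\<And>H. tdeg_le n (H - Hh) \<Longrightarrow>
    (\<And>x y. beval (dx H) x y = 0 \<Longrightarrow> beval (dy H) x y = 0 \<Longrightarrow> cmod (beval H x y) \<le> \<epsilon>) \<Longrightarrow>
    \<exists>s t. pnorm (translate s t H - Hh) < 1"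
    using near_form_if_critical_values_small by blast
  \<comment> \<open>Rescaling by \<open>r\<close> divides critical values in the unit disc by
    \<open>r^(n+1) \<ge> r \<ge> 1 / \<epsilon>\<close> and so brings them into the disc of radius
    \<open>\<epsilon>\<close>. The price is the factor \<open>r^(n+1)\<close> in the norm, which
    becomes \<open>\<beta>\<close>; \<open>\<alpha>\<close> is \<open>\<epsilon>\<close>
    itself.\<close>
  define r where "r = max 1 (1 / \<epsilon>)"
  have r: "r \<ge> 1" "1 / \<epsilon> \<le> r" by (simp_all add: r_def)
  have "critical_values H \<inter> {t. cmod t > \<epsilon>} \<noteq> {}"
    if low: "tdeg_le n (H - Hh)" and H: "principal_part H = Hh"
        and large: "effective_nonhomogeneity H \<ge> 1" for H
  proof
    assume empty: "critical_values H \<inter> {t. cmod t > \<epsilon>} = {}"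
    have "cmod (beval H x y) \<le> \<epsilon>" if "beval (dx H) x y = 0" "beval (dy H) x y = 0" for x y
    proof -
      have "beval H x y \<in> critical_values H" using that by (auto simp: critical_values_def)
      then show ?thesis using empty by (auto simp: not_less)
    qed
    then obtain s t where "pnorm (translate s t H - Hh) < 1" using \<epsilon>(2)[OF low] by blast
    then show False using effective_nonhomogeneity_le[of H s t] large H by simp
  qed
  moreover have "effective_nonhomogeneity H \<le> r ^ Suc n"
    if low: "tdeg_le n (H - Hh)" and H: "principal_part H = Hh"
        and bounded: "critical_values H \<subseteq> {t. cmod t \<le> 1}" for H
  proof -
    let ?F = "rescale (Suc n) (of_real r) H"
    have r0: "complex_of_real r \<noteq> 0" using r(1) by simp
    have lowF: "tdeg_le n (?F - Hh)"
      unfolding rescale_minus_form[OF r0] by (rule tdeg_le_rescale[OF low])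
    have "cmod (beval ?F x y) \<le> \<epsilon>" if "beval (dx ?F) x y = 0" "beval (dy ?F) x y = 0" for x y
    proof -
      have "cmod (beval H x y) \<le> 1" if "beval (dx H) x y = 0" "beval (dy H) x y = 0" for x y
        using bounded that by (auto simp: critical_values_def)
      from critical_rescale[OF this r(1) that] have "cmod (beval ?F x y) \<le> 1 / r ^ Suc n" .
      also have "\<dots> \<le> 1 / r ^ 1"
        using r(1) by (intro divide_left_mono power_increasing) auto
      also have "\<dots> \<le> \<epsilon>" using r \<epsilon>(1) by (simp add: field_simps)
      finally show ?thesis .
    qed
    then obtain s t where st: "pnorm (translate s t ?F - Hh) < 1" using \<epsilon>(2)[OF lowF] by blast
    let ?T = "translate (of_real r * s) (of_real r * t) H"
    have "translate s t ?F - Hh = rescale (Suc n) (of_real r) (?T - Hh)"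
      unfolding translate_rescale by (rule rescale_minus_form[OF r0])
    then have "pnorm (?T - Hh) \<le> r ^ Suc n * pnorm (translate s t ?F - Hh)"
      using pnorm_le_rescale[OF r(1), of "?T - Hh" "Suc n"] by simp
    also have "\<dots> \<le> r ^ Suc n * 1"
      using st r(1) by (intro mult_left_mono) auto
    finally show ?thesis
      using effective_nonhomogeneity_le[of H "of_real r * s" "of_real r * t"] H by simp
  qed
  moreover have "tdeg_le n (H - Hh)" if "quasimonic n H" "principal_part H = Hh" for H
    using tdeg_le_minus_principal_part[of H n] that by (simp add: quasimonic_def)
  moreover have "r ^ Suc n > 0" using r(1) by (intro zero_less_power) linarith
  ultimately show ?thesis using \<epsilon>(1) by meson
qed

end
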